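(* Let $d=1$, let $\{V(x)\}_{x\in\mathbb{R}}$ be the two-sided semi-selfsimilar Lévy environment with index $\alpha$ under the probability measure $Q$ (as defined in the context), and let $W(x)=V(x)$ for $x\in\mathbb{R}$. Suppose that $(\{V_+(x)\}_{x\ge0},Q)$ is a symmetric stable process with index $\alpha\in(0,2)$, where symmetry means that $\{V_+(x)\}_{x\ge0}$ and $\{-V_+(x)\}_{x\ge0}$ have the same finite-dimensional distributions under $Q$. Then $\lambda_{\mathrm{ess}}^W=0$, $Q$-almost surely. In particular, $\{P_t^W\}_{t>0}$ is noncompact in $L^2(\mathbb{R};\mu^W)$, $Q$-almost surely.
   Context: **Semi-selfsimilar Lévy environment.** Let $\mathcal{W}$ be the set of functions $w:\mathbb{R}\to\mathbb{R}$ with $w(0)=0$ that are right continuous with left limits on $[0,\infty)$ and left continuous with right limits on $(-\infty,0]$, with the $\sigma$-field $\mathcal{B}(\mathcal{W})$ generated by the cylindrical sets. For $w\in\mathcal W$ and $x\ge0$ put $V_+(x)(w)=w(x)$ and $V_-(x)(w)=w(-x)$. Let $Q$ be a probability measure on $(\mathcal{W},\mathcal{B}(\mathcal{W}))$ such that $\{V_+(x)\}_{x\ge0}$ is a real-valued Lévy process satisfying: (i) $Q(V_+(0)=0)=1$ and $Q(V_+(x)=0)<1$ for all $x>0$; (ii) its paths are $Q$-a.s. right continuous with left limits; (iii) there exist $c>0$, $c\ne1$, and $\alpha\in(0,2)$ such that $\{V_+(cx)\}_{x\ge0}$ and $\{c^{1/\alpha}V_+(x)\}_{x\ge0}$ have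 the same finite-dimensional distributions. Let $r_0=\inf\{c>1:\{V_+(cx)\}_{x\ge0}\overset{d}{=}\{c^{1/\alpha}V_+(x)\}_{x\ge0}\}$ ($\overset{d}{=}$ denotes equality of finite-dimensional distributions). If $r_0=1$ the scaling relation holds for every $c>0$ and the process is called an $\alpha$-stable Lévy process; if $r_0>1$ it holds for $c=r_0^n$, $n\in\mathbb{Z}$, and the process is called an $(r_0,\alpha)$-semi-selfsimilar Lévy process. Suppose also that $\{V_-(x)\}_{x\ge0}$ is, under $Q$, a process of the same kind with the same $\alpha$ and $r_0$, independent of $\{V_+(x)\}_{x\ge0}$. Define $V(x)=V_+(x)$ for $x\ge0$ and $V(x)=V_-(-x)$ for $x<0$. **Dirichlet form, semigroup, essential spectrum.** For a locally bounded measurable function $w:\mathbb{R}\to\mathbb{R}$, let $\mu^w(\mathrm{d}x)=e^{-w(x)}\,\mathrm{d}x$ and $\mathcal{E}^w(u,v)=\frac12\int_{\mathbb{R}}u'v'\,e^{-w}\,\mathrm{d}x$. The form $(\mathcal{E}^w,C_c^\infty(\mathbb{R}))$ is closable on $L^2(\mathbb{R};\mu^w)$; let $(\mathcal{E}^w,\mathcal{F}^w)$ be its closure with respect to the norm $(\mathcal{E}^w(u,u)+\|u\|_{L^2(\mathbb{R};\mu^w)}^2)^{1/2}$, which is a regular Dirichlet form. Let $L^w$ be the associated non-positive definite self-adjoint operator, i.e. its domain $D(L^w)\subset\mathcal{F}^w$ and $\mathcal{E}^w(u,v)=\langle -L^wu,v\rangle_{L^2(\mathbb{R};\mu^w)}$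 for $u\in D(L^w)$, $v\in\mathcal{F}^w$. Let $\{P_t^w\}_{t>0}$ be the Markovian semigroup on $L^2(\mathbb{R};\mu^w)$ generated by $L^w$, let $\sigma_{\mathrm{ess}}(-L^w)$ be the essential spectrum of $-L^w$, and $\lambda_{\mathrm{ess}}^w=\inf\sigma_{\mathrm{ess}}(-L^w)$, with $\inf\emptyset=\infty$. The semigroup is compact if and only if $\sigma_{\mathrm{ess}}(-L^w)=\emptyset$, i.e. $\lambda_{\mathrm{ess}}^w=\infty$; otherwise it is noncompact. For a random function $W$, these objects are defined realization by realization. *)

theory Defs
  imports "HOL-Probability.Probability"
begin

section \<open>Square integrable functions and unbounded operators\<close>

text \<open>
  The elements of \<open>L\<^sup>2(M)\<close> are represented by square integrable functions. All notions below are
  invariant under changing these functions on null sets. An unbounded operator is given by its graph,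
  a set of pairs \<open>(u, A u)\<close>; the graphs used here contain every representative of \<open>u\<close> and \<open>A u\<close>.
\<close>

definition L2 :: "'a measure \<Rightarrow> ('a \<Rightarrow> real) set" where
  "L2 M = {u \<in> borel_measurable M. integrable M (\<lambda>x. (u x)\<^sup>2)}"

definition l2_inner :: "'a measure \<Rightarrow> ('a \<Rightarrow> real) \<Rightarrow> ('a \<Rightarrow> real) \<Rightarrow> real" where
  "l2_inner M u v = (\<integral>x. u x * v x \<partial>M)"

definition l2_norm :: "'a measure \<Rightarrow> ('a \<Rightarrow> real) \<Rightarrow> real" where
  "l2_norm M u = sqrt (l2_inner M u u)"

definition l2_tendsto :: "'a measure \<Rightarrow> ('b \<Rightarrow> 'a \<Rightarrow> real) \<Rightarrow> ('a \<Rightarrow> real) \<Rightarrow> 'b filter \<Rightarrow> bool" where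
  "l2_tendsto M u v F \<longleftrightarrow> ((\<lambda>n. l2_norm M (\<lambda>x. u n x - v x)) \<longlongrightarrow> 0) F"

type_synonym 'a l2_graph = "(('a \<Rightarrow> real) \<times> ('a \<Rightarrow> real)) set"

text \<open>
  The number \<open>r\<close> is in the resolvent set if \<open>A - r\<close> maps its domain bijectively onto \<open>L\<^sup>2(M)\<close> with
  bounded inverse. Only real \<open>r\<close> are considered, which is enough for self-adjoint operators.
\<close>

definition resolvent_set :: "'a measure \<Rightarrow> 'a l2_graph \<Rightarrow> real set" where
  "resolvent_set M A = {r.
     (\<forall>g\<in>L2 M. \<exists>(u, f)\<in>A. AE x in M. f x - r * u x = g x) \<and>
     (\<exists>C. \<forall>(u, f)\<in>A. l2_norm M u \<le> C * l2_norm M (\<lambda>x. f x - r * u x))}"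

definition spectrum_of :: "'a measure \<Rightarrow> 'a l2_graph \<Rightarrow> real set" where
  "spectrum_of M A = - resolvent_set M A"

definition eigenspace :: "'a measure \<Rightarrow> 'a l2_graph \<Rightarrow> real \<Rightarrow> ('a \<Rightarrow> real) set" where
  "eigenspace M A r = {u. \<exists>f. (u, f) \<in> A \<and> (AE x in M. f x = r * u x)}"

definition finite_dim :: "'a measure \<Rightarrow> ('a \<Rightarrow> real) set \<Rightarrow> bool" where
  "finite_dim M U \<longleftrightarrow>
     (\<exists>B. finite B \<and> B \<subseteq> U \<and> (\<forall>u\<in>U. \<exists>c. AE x in M. u x = (\<Sum>b\<in>B. c b * b x)))"

text \<open>The discrete spectrum consists of the isolated points of the spectrum that are eigenvalues
  of finite multiplicity.\<close>

definition discrete_spectrum :: "'a measure \<Rightarrow> 'a l2_graph \<Rightarrow> real set" where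
  "discrete_spectrum M A = {r. r isolated_in spectrum_of M A \<and>
     (\<exists>u\<in>eigenspace M A r. \<not> (AE x in M. u x = 0)) \<and> finite_dim M (eigenspace M A r)}"

definition essential_spectrum :: "'a measure \<Rightarrow> 'a l2_graph \<Rightarrow> real set" where
  "essential_spectrum M A = spectrum_of M A - discrete_spectrum M A"

definition compact_operator :: "'a measure \<Rightarrow> (('a \<Rightarrow> real) \<Rightarrow> 'a \<Rightarrow> real) \<Rightarrow> bool" where
  "compact_operator M T \<longleftrightarrow>
     (\<forall>u :: nat \<Rightarrow> 'a \<Rightarrow> real. (\<forall>n. u n \<in> L2 M) \<and> (\<exists>C. \<forall>n. l2_norm M (u n) \<le> C) \<longrightarrow>
        (\<exists>s g. strict_mono s \<and> g \<in> L2 M \<and> l2_tendsto M (\<lambda>n. T (u (s n))) g sequentially))"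


section \<open>Markovian semigroups\<close>

type_synonym 'a operator_family = "real \<Rightarrow> ('a \<Rightarrow> real) \<Rightarrow> 'a \<Rightarrow> real"

text \<open>Strongly continuous symmetric Markovian contraction semigroups \<open>(P t)\<close>, \<open>t > 0\<close>, on
  \<open>L\<^sup>2(M)\<close>. Linearity together with contractivity makes each \<open>P t\<close> well-defined on classes of
  almost everywhere equal functions.\<close>

definition markovian_semigroup :: "'a measure \<Rightarrow> 'a operator_family \<Rightarrow> bool" where
  "markovian_semigroup M P \<longleftrightarrow>
     (\<forall>t>0. \<forall>u\<in>L2 M. P t u \<in> L2 M) \<and>
     (\<forall>t>0. \<forall>u\<in>L2 M. \<forall>v\<in>L2 M. \<forall>a b.
        AE x in M. P t (\<lambda>y. a * u y + b * v y) x = a * P t u x + b * P t v x) \<and>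
     (\<forall>t>0. \<forall>u\<in>L2 M. l2_norm M (P t u) \<le> l2_norm M u) \<and>
     (\<forall>t>0. \<forall>u\<in>L2 M. \<forall>v\<in>L2 M. l2_inner M (P t u) v = l2_inner M u (P t v)) \<and>
     (\<forall>s>0. \<forall>t>0. \<forall>u\<in>L2 M. AE x in M. P (s + t) u x = P s (P t u) x) \<and>
     (\<forall>u\<in>L2 M. l2_tendsto M (\<lambda>t. P t u) u (at_right 0)) \<and>
     (\<forall>t>0. \<forall>u\<in>L2 M. (AE x in M. 0 \<le> u x \<and> u x \<le> 1) \<longrightarrow>
        (AE x in M. 0 \<le> P t u x \<and> P t u x \<le> 1))"

definition infinitesimal_generator :: "'a measure \<Rightarrow> 'a operator_family \<Rightarrow> 'a l2_graph" where
  "infinitesimal_generator M P = {(u, f). u \<in> L2 M \<and> f \<in> L2 M \<and>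
     l2_tendsto M (\<lambda>t x. (P t u x - u x) / t) f (at_right 0)}"

definition compact_semigroup :: "'a measure \<Rightarrow> 'a operator_family \<Rightarrow> bool" where
  "compact_semigroup M P \<longleftrightarrow> (\<forall>t>0. compact_operator M (P t))"


section \<open>The Dirichlet form of an environment on the real line\<close>

definition env_measure :: "(real \<Rightarrow> real) \<Rightarrow> real measure" where
  "env_measure w = density lborel (\<lambda>x. ennreal (exp (- w x)))"

definition test_functions :: "(real \<Rightarrow> real) set" where
  "test_functions =
     {u. (\<forall>k. (deriv ^^ k) u differentiable_on UNIV) \<and> compact (closure {x. u x \<noteq> 0})}"

definition pre_form :: "(real \<Rightarrow> real) \<Rightarrow> (real \<Rightarrow> real) \<Rightarrow> (real \<Rightarrow> real) \<Rightarrow> real" where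
  "pre_form w u v = 1 / 2 * (\<integral>x. deriv u x * deriv v x * exp (- w x) \<partial>lborel)"

definition form_approx :: "(real \<Rightarrow> real) \<Rightarrow> (real \<Rightarrow> real) \<Rightarrow> (nat \<Rightarrow> real \<Rightarrow> real) \<Rightarrow> bool" where
  "form_approx w u \<phi> \<longleftrightarrow>
     (\<forall>n. \<phi> n \<in> test_functions) \<and>
     l2_tendsto (env_measure w) \<phi> u sequentially \<and>
     (\<forall>e>0. \<exists>N. \<forall>m\<ge>N. \<forall>n\<ge>N.
        pre_form w (\<lambda>x. \<phi> m x - \<phi> n x) (\<lambda>x. \<phi> m x - \<phi> n x) < e)"

definition form_domain :: "(real \<Rightarrow> real) \<Rightarrow> (real \<Rightarrow> real) set" where
  "form_domain w = {u \<in> L2 (env_measure w). \<exists>\<phi>. form_approx w u \<phi>}"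

text \<open>The value of the closed form is independent of the approximating sequences because
  \<^term>\<open>pre_form w\<close> is closable when \<open>w\<close> is measurable and locally bounded.\<close>

definition closed_form :: "(real \<Rightarrow> real) \<Rightarrow> (real \<Rightarrow> real) \<Rightarrow> (real \<Rightarrow> real) \<Rightarrow> real" where
  "closed_form w u v = (THE r. \<forall>\<phi> \<psi>. form_approx w u \<phi> \<longrightarrow> form_approx w v \<psi> \<longrightarrow>
     (\<lambda>n. pre_form w (\<phi> n) (\<psi> n)) \<longlonglongrightarrow> r)"

definition form_generator :: "(real \<Rightarrow> real) \<Rightarrow> real l2_graph" where
  "form_generator w = {(u, f). u \<in> form_domain w \<and> f \<in> L2 (env_measure w) \<and>
     (\<forall>v\<in>form_domain w. closed_form w u v = l2_inner (env_measure w) (\<lambda>x. - f x) v)}"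

definition neg_form_generator :: "(real \<Rightarrow> real) \<Rightarrow> real l2_graph" where
  "neg_form_generator w = {(u, \<lambda>x. - f x) | u f. (u, f) \<in> form_generator w}"

text \<open>In \<^typ>\<open>ereal\<close> the infimum of the empty set is \<open>\<infinity>\<close>.\<close>

definition lambda_ess :: "(real \<Rightarrow> real) \<Rightarrow> ereal" where
  "lambda_ess w = Inf (ereal ` essential_spectrum (env_measure w) (neg_form_generator w))"

text \<open>If \<open>w\<close> is measurable and locally bounded, there is exactly one such \<open>P\<close> up to null sets:
  the generator determines the semigroup, which exists and is Markovian since the closed form is a
  Dirichlet form.\<close>

definition semigroup_of_env :: "(real \<Rightarrow> real) \<Rightarrow> real operator_family \<Rightarrow> bool" where
  "semigroup_of_env w P \<longleftrightarrow>
     markovian_semigroup (env_measure w) P \<and>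
     infinitesimal_generator (env_measure w) P = form_generator w"


section \<open>Semi-selfsimilar Levy processes\<close>

text \<open>Processes have type \<^typ>\<open>real \<Rightarrow> 'a \<Rightarrow> real\<close>; only times \<open>t \<ge> 0\<close> are relevant.\<close>

definition rcll :: "(real \<Rightarrow> real) \<Rightarrow> bool" where
  "rcll f \<longleftrightarrow> (\<forall>x\<ge>0. continuous (at_right x) f) \<and> (\<forall>x>0. \<exists>l. (f \<longlongrightarrow> l) (at_left x))"

definition levy_process :: "'a measure \<Rightarrow> (real \<Rightarrow> 'a \<Rightarrow> real) \<Rightarrow> bool" where
  "levy_process M X \<longleftrightarrow>
     prob_space M \<and>
     (\<forall>t\<ge>0. X t \<in> borel_measurable M) \<and>
     (AE \<omega> in M. X 0 \<omega> = 0) \<and>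
     (\<forall>(n::nat) t. 0 \<le> t 0 \<and> (\<forall>i<n. t i < t (Suc i)) \<longrightarrow>
        prob_space.indep_vars M (\<lambda>_. borel) (\<lambda>i \<omega>. X (t (Suc i)) \<omega> - X (t i) \<omega>) {..<n}) \<and>
     (\<forall>s\<ge>0. \<forall>t\<ge>0. distr M borel (\<lambda>\<omega>. X (s + t) \<omega> - X s \<omega>)
        = distr M borel (\<lambda>\<omega>. X t \<omega> - X 0 \<omega>)) \<and>
     (\<forall>t\<ge>0. \<forall>e>0.
        ((\<lambda>s. measure M {\<omega> \<in> space M. \<bar>X s \<omega> - X t \<omega>\<bar> > e}) \<longlongrightarrow> 0) (at t within {0..})) \<and>
     (AE \<omega> in M. rcll (\<lambda>t. X t \<omega>))"

definition same_fdd :: "'a measure \<Rightarrow> (real \<Rightarrow> 'a \<Rightarrow> real) \<Rightarrow> (real \<Rightarrow> 'a \<Rightarrow> real) \<Rightarrow> bool" where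
  "same_fdd M X Y \<longleftrightarrow> (\<forall>I. finite I \<and> I \<subseteq> {0..} \<longrightarrow>
     distr M (\<Pi>\<^sub>M i\<in>I. borel) (\<lambda>\<omega>. \<lambda>i\<in>I. X i \<omega>) = distr M (\<Pi>\<^sub>M i\<in>I. borel) (\<lambda>\<omega>. \<lambda>i\<in>I. Y i \<omega>))"

definition scales_by :: "'a measure \<Rightarrow> (real \<Rightarrow> 'a \<Rightarrow> real) \<Rightarrow> real \<Rightarrow> real \<Rightarrow> bool" where
  "scales_by M X \<alpha> c \<longleftrightarrow> same_fdd M (\<lambda>x. X (c * x)) (\<lambda>x \<omega>. c powr (1 / \<alpha>) * X x \<omega>)"

definition scaling_ratio :: "'a measure \<Rightarrow> (real \<Rightarrow> 'a \<Rightarrow> real) \<Rightarrow> real \<Rightarrow> real" where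
  "scaling_ratio M X \<alpha> = Inf {c. c > 1 \<and> scales_by M X \<alpha> c}"

text \<open>Both the stable (\<open>scaling_ratio = 1\<close>) and the strictly semi-selfsimilar
  (\<open>scaling_ratio > 1\<close>) case.\<close>

definition scaling_levy_process :: "'a measure \<Rightarrow> (real \<Rightarrow> 'a \<Rightarrow> real) \<Rightarrow> real \<Rightarrow> bool" where
  "scaling_levy_process M X \<alpha> \<longleftrightarrow>
     levy_process M X \<and>
     (\<forall>x>0. measure M {\<omega> \<in> space M. X x \<omega> = 0} < 1) \<and>
     0 < \<alpha> \<and> \<alpha> < 2 \<and>
     (\<exists>c>0. c \<noteq> 1 \<and> scales_by M X \<alpha> c)"

definition stable_levy_process :: "'a measure \<Rightarrow> (real \<Rightarrow> 'a \<Rightarrow> real) \<Rightarrow> real \<Rightarrow> bool" where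
  "stable_levy_process M X \<alpha> \<longleftrightarrow> scaling_levy_process M X \<alpha> \<and> scaling_ratio M X \<alpha> = 1"

definition symmetric_process :: "'a measure \<Rightarrow> (real \<Rightarrow> 'a \<Rightarrow> real) \<Rightarrow> bool" where
  "symmetric_process M X \<longleftrightarrow> same_fdd M X (\<lambda>x \<omega>. - X x \<omega>)"


section \<open>The two-sided environment\<close>

definition path_space :: "(real \<Rightarrow> real) set" where
  "path_space = {w. w 0 = 0 \<and>
     (\<forall>x\<ge>0. continuous (at_right x) w) \<and> (\<forall>x>0. \<exists>l. (w \<longlongrightarrow> l) (at_left x)) \<and>
     (\<forall>x\<le>0. continuous (at_left x) w) \<and> (\<forall>x<0. \<exists>l. (w \<longlongrightarrow> l) (at_right x))}"

text \<open>The \<open>\<sigma>\<close>-field generated by the cylinder sets.\<close>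

definition path_algebra :: "(real \<Rightarrow> real) measure" where
  "path_algebra = restrict_space (\<Pi>\<^sub>M x\<in>UNIV. borel) path_space"

definition V_plus :: "real \<Rightarrow> (real \<Rightarrow> real) \<Rightarrow> real" where
  "V_plus x w = w x"

definition V_minus :: "real \<Rightarrow> (real \<Rightarrow> real) \<Rightarrow> real" where
  "V_minus x w = w (- x)"

definition V :: "(real \<Rightarrow> real) \<Rightarrow> real \<Rightarrow> real" where
  "V w x = (if x \<ge> 0 then V_plus x w else V_minus (- x) w)"

definition levy_environment :: "(real \<Rightarrow> real) measure \<Rightarrow> real \<Rightarrow> bool" where
  "levy_environment Q \<alpha> \<longleftrightarrow>
     prob_space Q \<and> space Q = path_space \<and> sets Q = sets path_algebra \<and>
     scaling_levy_process Q V_plus \<alpha> \<and>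
     scaling_levy_process Q V_minus \<alpha> \<and>
     scaling_ratio Q V_minus \<alpha> = scaling_ratio Q V_plus \<alpha> \<and>
     prob_space.indep_var Q
       (\<Pi>\<^sub>M x\<in>{0..}. borel) (\<lambda>w. \<lambda>x\<in>{0..}. V_plus x w)
       (\<Pi>\<^sub>M x\<in>{0..}. borel) (\<lambda>w. \<lambda>x\<in>{0..}. V_minus x w)"

end

theory Submission
  imports Defs
begin

text \<open>
  Fix a path \<open>w\<close> and let \<open>\<mu>\<close> be the measure \<open>exp (- w x) dx\<close>. The proof rests on a criterion for single
  paths: if \<open>exp w\<close> and \<open>exp (- w)\<close> both have infinite integral over the half-line, then the bottom
  of the essential spectrum is 0 and the semigroup is not compact.

  Divergence of both integrals produces test functions of norm one and arbitrarily small energy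
  (\<open>low_energy_test_function\<close>). The cheapest way to climb from 0 to 1 across an interval \<open>I\<close> is to
  choose the slope proportional to \<open>exp w\<close>, which costs the energy \<open>1 / (2 \<integral>\<^sub>I exp w)\<close>. Climbing on
  \<open>[0, 1]\<close> and descending on a far interval \<open>[c, d]\<close> with \<open>\<integral> exp w \<ge> 1\<close> has bounded cost, whereas the mass
  between the two slopes is as large as desired.

  Applying \<open>c (c - L)\<^sup>-\<^sup>1\<close> to these test functions yields a Weyl sequence of the operator at 0
  (\<open>weyl_sequence\<close>), so 0 belongs to the spectrum. It is not in the discrete spectrum because it is
  not an eigenvalue: a function of energy zero is constant, and a nonzero constant is not square
  integrable when the total mass is infinite (\<open>zero_gradient_imp_zero\<close>). The form is nonnegative, so
  no point below 0 is in the spectrum. If the semigroup were compact, then, since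
  \<open>\<parallel>P\<^sub>1 u - u\<parallel> \<le> \<parallel>L u\<parallel>\<close> (\<open>semigroup_increment_le\<close>), the Weyl sequence would have a norm convergent
  subsequence. Its limit would have norm one and energy zero, which has just been excluded.

  The closed form is made accessible through weak gradients. On test functions the form is
  \<open>1/2 \<langle>u', v'\<rangle>\<close> in \<open>L\<^sup>2(\<mu>)\<close>; by completeness of \<open>L\<^sup>2\<close>, an approximating sequence is one whose
  derivatives converge, and by \<open>closability\<close> their limit depends only on the limit function. Hence
  the closed form is \<open>1/2 \<langle>g, h\<rangle>\<close> for the weak gradients \<open>g\<close> and \<open>h\<close> (\<open>closed_form_eq\<close>).

  For the random path, fix \<open>s \<ge> 0\<close> and consider the walk \<open>n \<mapsto> V(s + n)\<close>. Its increments are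
  independent, and by symmetry it is nonnegative with probability at least \<open>1/2\<close> at each time. So it
  fails to drift to \<open>- \<infinity>\<close> with positive probability, hence almost surely by Kolmogorov's zero-one
  law, and \<open>\<Sum>\<^sub>n exp (V(s + n)) = \<infinity>\<close>. The same holds for \<open>- V\<close>. Integrating over \<open>s \<in> [0, 1)\<close> with
  Fubini's theorem gives the divergence of both integrals for almost every path. The slopes and
  the mass between them lie in \<open>[0, \<infinity>)\<close>, where the path is the symmetric process \<open>V\<^sub>+\<close>.
\<close>

section \<open>Smooth functions of compact support\<close>

definition smooth :: "(real \<Rightarrow> real) \<Rightarrow> bool" where
  "smooth u \<longleftrightarrow> (\<forall>k. (deriv ^^ k) u differentiable_on UNIV)"

text \<open>
  A class of differentiable functions that is closed under derivatives consists of smooth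
  functions. This replaces computing higher derivatives in all proofs of smoothness below.
\<close>

lemma smooth_coinduct:
  assumes "P u" and step: "\<And>u. P u \<Longrightarrow> u differentiable_on UNIV \<and> P (deriv u)"
  shows "smooth u"
proof -
  have "P ((deriv ^^ k) u)" for k
    by (induction k) (use assms in auto)
  with step show ?thesis by (auto simp: smooth_def)
qed

lemma smooth_deriv: "smooth u \<Longrightarrow> smooth (deriv u)"
  unfolding smooth_def by (metis comp_apply funpow_Suc_right)

lemma smooth_DERIV:
  assumes "smooth u" shows "(u has_real_derivative deriv u x) (at x)"
proof -
  have "u differentiable_on UNIV"
    using assms unfolding smooth_def by (metis funpow_0)
  then show ?thesis
    by (simp add: DERIV_deriv_iff_real_differentiable differentiable_on_def)
qed

lemma smooth_continuous_on: "smooth u \<Longrightarrow> continuous_on S u"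
  using smooth_DERIV by (metis DERIV_continuous_on has_field_derivative_at_within)

lemma differentiable_on_DERIV:
  "(\<And>x. (u has_real_derivative u' x) (at x)) \<Longrightarrow> u differentiable_on UNIV"
  unfolding differentiable_on_def using has_field_derivative_imp_has_derivative differentiableI
  by blast

text \<open>
  Closing the smooth functions under sums and products gives a class closed under derivatives by
  the Leibniz rule, so that closure of smoothness under sums and products follows from
  coinduction without a formula for the \<open>k\<close>-th derivative of a product.
\<close>

inductive smooth_algebra :: "(real \<Rightarrow> real) \<Rightarrow> bool" where
  base: "smooth u \<Longrightarrow> smooth_algebra u"
| add: "smooth_algebra u \<Longrightarrow> smooth_algebra v \<Longrightarrow> smooth_algebra (\<lambda>x. u x + v x)"
| mult: "smooth_algebra u \<Longrightarrow> smooth_algebra v \<Longrightarrow> smooth_algebra (\<lambda>x. u x * v x)"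

lemma smooth_algebra_deriv:
  "smooth_algebra u \<Longrightarrow> (\<forall>x. (u has_real_derivative deriv u x) (at x)) \<and> smooth_algebra (deriv u)"
proof (induction rule: smooth_algebra.induct)
  case (base u)
  then show ?case using smooth_DERIV smooth_deriv smooth_algebra.base by blast
next
  case (add u v)
  have D: "((\<lambda>x. u x + v x) has_real_derivative deriv u x + deriv v x) (at x)" for x
    using add by (intro derivative_intros) auto
  then have "deriv (\<lambda>x. u x + v x) = (\<lambda>x. deriv u x + deriv v x)"
    by (auto intro: DERIV_imp_deriv)
  with D add show ?case by (auto intro: smooth_algebra.intros)
next
  case (mult u v)
  have D: "((\<lambda>x. u x * v x) has_real_derivative deriv u x * v x + u x * deriv v x) (at x)" for x
    using mult by (auto intro!: derivative_eq_intros)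
  then have "deriv (\<lambda>x. u x * v x) = (\<lambda>x. deriv u x * v x + u x * deriv v x)"
    by (auto intro: DERIV_imp_deriv)
  with D mult show ?case by (auto intro: smooth_algebra.intros)
qed

lemma smooth_algebra_smooth: "smooth_algebra u \<Longrightarrow> smooth u"
proof (rule smooth_coinduct[of smooth_algebra])
  fix u :: "real \<Rightarrow> real" assume "smooth_algebra u"
  note D = smooth_algebra_deriv[OF this]
  then show "u differentiable_on UNIV \<and> smooth_algebra (deriv u)"
    using differentiable_on_DERIV[of u "deriv u"] by auto
qed assumption

lemma smooth_add: "smooth u \<Longrightarrow> smooth v \<Longrightarrow> smooth (\<lambda>x. u x + v x)"
  and smooth_mult: "smooth u \<Longrightarrow> smooth v \<Longrightarrow> smooth (\<lambda>x. u x * v x)"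
  using smooth_algebra_smooth[OF smooth_algebra.add] smooth_algebra_smooth[OF smooth_algebra.mult]
    smooth_algebra.base by auto

lemma smooth_const: "smooth (\<lambda>x. c)"
proof (rule smooth_coinduct[of "\<lambda>u. \<exists>c. u = (\<lambda>x. c)"])
  fix u :: "real \<Rightarrow> real" assume "\<exists>c. u = (\<lambda>x. c)"
  then obtain c where u: "u = (\<lambda>x. c)" by auto
  then have D: "(u has_real_derivative 0) (at x)" for x by simp
  then have "deriv u = (\<lambda>x. 0)" by (auto intro: DERIV_imp_deriv)
  with D show "u differentiable_on UNIV \<and> (\<exists>c. deriv u = (\<lambda>x. c))"
    using differentiable_on_DERIV[of u "\<lambda>x. 0"] by auto
qed auto

lemma smooth_antideriv:
  assumes "\<And>x. (u has_real_derivative v x) (at x)" "smooth v"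
  shows "smooth u"
proof (rule smooth_coinduct[of "\<lambda>f. f = u \<or> smooth f"])
  have "deriv u = v" using assms(1) by (auto intro: DERIV_imp_deriv)
  then show "f differentiable_on UNIV \<and> (deriv f = u \<or> smooth (deriv f))" if "f = u \<or> smooth f" for f
  proof -
    have "deriv f = v \<or> smooth (deriv f)" using that \<open>deriv u = v\<close> smooth_deriv by auto
    moreover have "f differentiable_on UNIV"
      using that differentiable_on_DERIV[of f "deriv f"] smooth_DERIV[of f]
        differentiable_on_DERIV[of u v] assms(1) by auto
    ultimately show ?thesis using assms(2) by auto
  qed
qed auto

lemma smooth_id: "smooth (\<lambda>x. x)"
  by (rule smooth_antideriv[of _ "\<lambda>x. 1"]) (auto intro: smooth_const)

lemma smooth_affine:
  assumes "smooth u" shows "smooth (\<lambda>x. u (a * x + b))"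
proof (rule smooth_coinduct[of "\<lambda>f. \<exists>u c. smooth u \<and> f = (\<lambda>x. c * u (a * x + b))"])
  show "\<exists>v c. smooth v \<and> (\<lambda>x. u (a * x + b)) = (\<lambda>x. c * v (a * x + b))"
    using assms by (intro exI[of _ u] exI[of _ 1]) auto
next
  fix f assume "\<exists>u c. smooth u \<and> f = (\<lambda>x. c * u (a * x + b))"
  then obtain u c where u: "smooth u" and f: "f = (\<lambda>x. c * u (a * x + b))" by auto
  have D: "(f has_real_derivative c * a * deriv u (a * x + b)) (at x)" for x
    unfolding f by (auto intro!: derivative_eq_intros DERIV_chain2[OF smooth_DERIV[OF u]])
  then have "deriv f = (\<lambda>x. c * a * deriv u (a * x + b))"
    by (auto intro: DERIV_imp_deriv)
  then have "\<exists>u c. smooth u \<and> deriv f = (\<lambda>x. c * u (a * x + b))"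
    using smooth_deriv[OF u] by blast
  with differentiable_on_DERIV[OF D] show "f differentiable_on UNIV \<and>
      (\<exists>u c. smooth u \<and> deriv f = (\<lambda>x. c * u (a * x + b)))" by blast
qed

lemma smooth_real_polynomial_function:
  "real_polynomial_function p \<Longrightarrow> smooth p"
proof (induction rule: real_polynomial_function.induct)
  case (linear f)
  then obtain c where "f = (\<lambda>x. x * c)" using real_bounded_linear by blast
  then show ?case using smooth_mult[OF smooth_id smooth_const] by simp
next
  case (const c)
  show ?case by (rule smooth_const)
next
  case (add f g)
  then show ?case by (intro smooth_add)
next
  case (mult f g)
  then show ?case by (intro smooth_mult)
qed

text \<open>
  The functions \<open>p(1/x) exp(-1/x)\<close> on the positive half-line, extended by zero. With the
  polynomial \<open>p\<close> as a parameter the family is closed under derivatives.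
\<close>

definition exp_flat :: "real poly \<Rightarrow> real \<Rightarrow> real" where
  "exp_flat p x = (if x \<le> 0 then 0 else poly p (1 / x) * exp (- (1 / x)))"

lemma poly_exp_tendsto_0: "((\<lambda>y::real. poly p y * exp (- y)) \<longlongrightarrow> 0) at_top"
proof -
  have "((\<lambda>y. \<Sum>i\<le>degree p. coeff p i * (y ^ i / exp y)) \<longlongrightarrow> (\<Sum>i\<le>degree p. coeff p i * 0)) at_top"
    by (rule tendsto_sum, rule tendsto_mult[OF tendsto_const tendsto_power_div_exp_0])
  moreover have "(\<Sum>i\<le>degree p. coeff p i * (y ^ i / exp y)) = poly p y * exp (- y)" for y :: real
    by (simp add: poly_altdef sum_distrib_right exp_minus divide_inverse mult.assoc)
  ultimately show ?thesis by simp
qed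

text \<open>
  At the origin the difference quotient is \<open>y p(y) exp(-y)\<close> with \<open>y = 1/h\<close>, which vanishes as
  \<open>h\<close> tends to 0 from the right because the exponential beats every polynomial.
\<close>

lemma exp_flat_DERIV:
  "(exp_flat p has_real_derivative exp_flat ([:0, 0, 1:] * (p - pderiv p)) x) (at x)"
proof -
  consider "x < 0" | "x = 0" | "x > 0" by linarith
  then show ?thesis
  proof cases
    case 1
    have "eventually (\<lambda>y. exp_flat p y = 0) (nhds x)"
      using eventually_nhds_in_open[of "{..<0}" x] 1 by (auto elim!: eventually_mono simp: exp_flat_def)
    then show ?thesis using 1
      by (subst DERIV_cong_ev[OF refl _ refl]) (auto simp: exp_flat_def)
  next
    case 2
    have L: "((\<lambda>h. exp_flat p h / h) \<longlongrightarrow> 0) (at_left 0)"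
      by (rule tendsto_eventually) (auto simp: eventually_at_left_field exp_flat_def intro!: exI[of _ "-1"])
    have "((\<lambda>y. poly ([:0, 1:] * p) y * exp (- y)) \<longlongrightarrow> 0) at_top"
      by (rule poly_exp_tendsto_0)
    then have "((\<lambda>h. poly ([:0, 1:] * p) (inverse h) * exp (- inverse h)) \<longlongrightarrow> 0) (at_right 0)"
      by (rule filterlim_compose[OF _ filterlim_inverse_at_top_right])
    then have R: "((\<lambda>h. exp_flat p h / h) \<longlongrightarrow> 0) (at_right 0)"
      by (rule Lim_transform_eventually)
         (auto simp: eventually_at_right_field exp_flat_def field_simps intro!: exI[of _ 1])
    have "((\<lambda>h. exp_flat p h / h) \<longlongrightarrow> 0) (at 0)"
      using L R by (simp add: filterlim_at_split)
    then show ?thesis using 2 by (simp add: DERIV_def exp_flat_def)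
  next
    case 3
    have ev: "eventually (\<lambda>y. exp_flat p y = poly p (1 / y) * exp (- (1 / y))) (nhds x)"
      using eventually_nhds_in_open[of "{0<..}" x] 3 by (auto elim!: eventually_mono simp: exp_flat_def)
    have "((\<lambda>y. poly p (1 / y) * exp (- (1 / y))) has_real_derivative
        exp_flat ([:0, 0, 1:] * (p - pderiv p)) x) (at x)"
      using 3 by (auto intro!: derivative_eq_intros DERIV_chain2[OF poly_DERIV]
          simp: exp_flat_def field_simps power2_eq_square)
    then show ?thesis
      by (subst DERIV_cong_ev[OF refl ev refl])
  qed
qed

lemma smooth_exp_flat: "smooth (exp_flat p)"
proof (rule smooth_coinduct[of "\<lambda>f. \<exists>p. f = exp_flat p"])
  fix f assume "\<exists>p. f = exp_flat p"
  then obtain p where f: "f = exp_flat p" by auto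
  have "deriv f = exp_flat ([:0, 0, 1:] * (p - pderiv p))"
    unfolding f by (intro ext DERIV_imp_deriv exp_flat_DERIV)
  then show "f differentiable_on UNIV \<and> (\<exists>p. deriv f = exp_flat p)"
    using exp_flat_DERIV differentiable_on_DERIV f by blast
qed auto

definition bump :: "real \<Rightarrow> real \<Rightarrow> real \<Rightarrow> real" where
  "bump a b x = exp_flat 1 (x - a) * exp_flat 1 (b - x)"

lemma smooth_bump: "smooth (bump a b)"
proof -
  have "smooth (\<lambda>x. exp_flat 1 (1 * x + - a) * exp_flat 1 (- 1 * x + b))"
    by (intro smooth_mult smooth_affine smooth_exp_flat)
  moreover have "bump a b = (\<lambda>x. exp_flat 1 (1 * x + - a) * exp_flat 1 (- 1 * x + b))"
    by (auto simp: bump_def fun_eq_iff)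
  ultimately show ?thesis by simp
qed

lemma bump_nonneg: "0 \<le> bump a b x"
  and bump_le_1: "bump a b x \<le> 1"
  and bump_pos: "a < x \<Longrightarrow> x < b \<Longrightarrow> 0 < bump a b x"
  and bump_zero: "x \<notin> {a<..<b} \<Longrightarrow> bump a b x = 0"
  by (auto simp: bump_def exp_flat_def intro!: mult_le_one)

lemma test_functions_iff:
  "u \<in> test_functions \<longleftrightarrow> smooth u \<and> (\<exists>a b. \<forall>x. x \<notin> {a..b} \<longrightarrow> u x = 0)"
proof -
  have "compact (closure {x. u x \<noteq> 0}) \<longleftrightarrow> (\<exists>a b. \<forall>x. x \<notin> {a..b} \<longrightarrow> u x = 0)"
  proof
    assume "compact (closure {x. u x \<noteq> 0})"
    then have "bounded {x. u x \<noteq> 0}"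
      using compact_imp_bounded bounded_subset closure_subset by metis
    then obtain a where "\<And>x. u x \<noteq> 0 \<Longrightarrow> \<bar>x\<bar> \<le> a"
      by (auto simp: bounded_iff)
    then have "\<forall>x. x \<notin> {-a..a} \<longrightarrow> u x = 0" by force
    then show "\<exists>a b. \<forall>x. x \<notin> {a..b} \<longrightarrow> u x = 0" by blast
  next
    assume "\<exists>a b. \<forall>x. x \<notin> {a..b} \<longrightarrow> u x = 0"
    then obtain a b where "\<forall>x. x \<notin> {a..b} \<longrightarrow> u x = 0" by blast
    then have "{x. u x \<noteq> 0} \<subseteq> {a..b}" by blast
    then show "compact (closure {x. u x \<noteq> 0})"
      by (meson bounded_closed_interval bounded_subset compact_closure)
  qed
  then show ?thesis by (simp add: test_functions_def smooth_def)
qed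

lemma test_functionI:
  "smooth u \<Longrightarrow> (\<And>x. x \<notin> {a..b} \<Longrightarrow> u x = 0) \<Longrightarrow> u \<in> test_functions"
  by (auto simp: test_functions_iff)

lemma test_function_support:
  assumes "u \<in> test_functions"
  obtains R where "R > 0" "\<forall>x. x \<notin> {-R..R} \<longrightarrow> u x = 0"
proof -
  obtain a b where ab: "\<And>x. x \<notin> {a..b} \<Longrightarrow> u x = 0"
    using assms by (auto simp: test_functions_iff)
  show ?thesis by (rule that[of "\<bar>a\<bar> + \<bar>b\<bar> + 1"]) (auto intro!: ab)
qed

lemma test_smooth: "u \<in> test_functions \<Longrightarrow> smooth u"
  by (simp add: test_functions_iff)

lemmas test_DERIV = smooth_DERIV[OF test_smooth]

lemma deriv_zero_outside:
  fixes u :: "real \<Rightarrow> real"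
  assumes "\<And>x. x \<notin> {a..b} \<Longrightarrow> u x = 0" "x \<notin> {a..b}"
  shows "deriv u x = 0"
proof (rule DERIV_imp_deriv)
  have "eventually (\<lambda>y. y \<in> - {a..b}) (nhds x)"
    using assms(2) by (intro eventually_nhds_in_open open_Compl closed_atLeastAtMost) auto
  then have "eventually (\<lambda>y. u y = 0) (nhds x)"
    by eventually_elim (use assms(1) in blast)
  then show "(u has_real_derivative 0) (at x)"
    by (subst DERIV_cong_ev[OF refl _ refl]) auto
qed

lemma test_deriv: "u \<in> test_functions \<Longrightarrow> deriv u \<in> test_functions"
proof -
  assume u: "u \<in> test_functions"
  obtain R where "R > 0" and R: "\<forall>x. x \<notin> {-R..R} \<longrightarrow> u x = 0"
    by (rule test_function_support[OF u])
  show ?thesis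
  proof (rule test_functionI[of _ "-R" R])
    show "smooth (deriv u)" by (rule smooth_deriv[OF test_smooth[OF u]])
    show "deriv u x = 0" if "x \<notin> {-R..R}" for x
      using deriv_zero_outside[of "-R" R u x] R that by blast
  qed
qed

lemma test_lincomb:
  assumes "u \<in> test_functions" "v \<in> test_functions"
  shows "(\<lambda>x. c * u x + d * v x) \<in> test_functions"
proof -
  obtain R where "R > 0" and R: "\<forall>x. x \<notin> {-R..R} \<longrightarrow> u x = 0"
    by (rule test_function_support[OF assms(1)])
  obtain S where "S > 0" and S: "\<forall>x. x \<notin> {-S..S} \<longrightarrow> v x = 0"
    by (rule test_function_support[OF assms(2)])
  show ?thesis
  proof (rule test_functionI[where a = "- (\<bar>R\<bar> + \<bar>S\<bar>)" and b = "\<bar>R\<bar> + \<bar>S\<bar>"])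
    show "smooth (\<lambda>x. c * u x + d * v x)"
      using assms by (intro smooth_add smooth_mult smooth_const test_smooth)
    fix x assume "x \<notin> {- (\<bar>R\<bar> + \<bar>S\<bar>)..\<bar>R\<bar> + \<bar>S\<bar>}"
    then have "x \<notin> {-R..R}" "x \<notin> {-S..S}" by auto
    then show "c * u x + d * v x = 0" by (simp add: R S)
  qed
qed

lemma test_bounded:
  assumes "u \<in> test_functions"
  obtains B where "B > 0" "\<forall>x. \<bar>u x\<bar> \<le> B"
proof -
  obtain R where "R > 0" and R: "\<forall>x. x \<notin> {-R..R} \<longrightarrow> u x = 0"
    by (rule test_function_support[OF assms])
  have "compact (u ` {-R..R})"
    using assms by (intro compact_continuous_image smooth_continuous_on test_smooth) auto
  then have "bounded (u ` {-R..R})" by (rule compact_imp_bounded)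
  then obtain B where B: "B > 0" "\<And>x. x \<in> {-R..R} \<Longrightarrow> \<bar>u x\<bar> \<le> B"
    unfolding bounded_pos by auto
  have "\<bar>u x\<bar> \<le> B" for x
    using B R by (cases "x \<in> {-R..R}") auto
  with B(1) show ?thesis using that by blast
qed

lemma test_measurable: "u \<in> test_functions \<Longrightarrow> u \<in> borel_measurable borel"
  by (intro borel_measurable_continuous_onI smooth_continuous_on test_smooth)

lemma deriv_test_lincomb:
  assumes "u \<in> test_functions" "v \<in> test_functions"
  shows "deriv (\<lambda>x. a * u x + b * v x) = (\<lambda>x. a * deriv u x + b * deriv v x)"
  by (rule ext, rule DERIV_imp_deriv, intro DERIV_add DERIV_cmult test_DERIV assms)

lemma test_diff: "u \<in> test_functions \<Longrightarrow> v \<in> test_functions \<Longrightarrow> (\<lambda>x. u x - v x) \<in> test_functions"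
  and deriv_test_diff: "u \<in> test_functions \<Longrightarrow> v \<in> test_functions \<Longrightarrow>
    deriv (\<lambda>x. u x - v x) = (\<lambda>x. deriv u x - deriv v x)"
  using test_lincomb[of u v 1 "-1"] deriv_test_lincomb[of u v 1 "-1"] by simp_all


section \<open>Approximation by test functions\<close>

lemma integrable_bounded_interval:
  fixes f :: "real \<Rightarrow> real"
  assumes "f \<in> borel_measurable borel" "\<And>x. x \<in> {a..b} \<Longrightarrow> \<bar>f x\<bar> \<le> B" "\<And>x. x \<notin> {a..b} \<Longrightarrow> f x = 0"
  shows "integrable lborel f"
  by (rule integrableI_bounded_set[of "{a..b}" _ _ B]) (use assms in \<open>auto simp: emeasure_lborel_Icc_eq\<close>)

lemma bounded_interval_convergence:
  fixes f :: "nat \<Rightarrow> real \<Rightarrow> real"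
  assumes [measurable]: "\<And>n. f n \<in> borel_measurable borel" "g \<in> borel_measurable borel"
    and bd: "\<And>n x. x \<in> {a..b} \<Longrightarrow> \<bar>f n x\<bar> \<le> C" and out: "\<And>n x. x \<notin> {a..b} \<Longrightarrow> f n x = 0"
    and lim: "AE x in lborel. (\<lambda>n. f n x) \<longlonglongrightarrow> g x"
  shows "(\<lambda>n. \<integral>x. f n x \<partial>lborel) \<longlonglongrightarrow> (\<integral>x. g x \<partial>lborel)"
proof (rule integral_dominated_convergence[where w = "\<lambda>x. C * indicator {a..b} x"])
  show "integrable lborel (\<lambda>x. C * indicator {a..b} x)"
    by (rule integrable_bounded_interval[of _ a b "\<bar>C\<bar>"]) (auto simp: indicator_def)
  fix n show "AE x in lborel. norm (f n x) \<le> C * indicator {a..b} x"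
    by (rule AE_I2) (use bd out in \<open>auto simp: indicator_def\<close>)
qed (use lim in auto)

text \<open>
  Divide \<open>h\<close> by a bump function \<open>\<rho>\<close> that is positive on a neighbourhood of its support,
  approximate the quotient almost everywhere by continuous functions, replace these by
  polynomials with Weierstrass' theorem, and multiply by \<open>\<rho>\<close> again. The approximants share a
  bound and a support, so limits may be taken under the integral against every locally bounded
  weight.
\<close>

lemma approx_by_test_functions:
  fixes h :: "real \<Rightarrow> real"
  assumes [measurable]: "h \<in> borel_measurable borel"
    and hB: "\<And>x. \<bar>h x\<bar> \<le> B" and h0: "\<And>x. x \<notin> {a..b} \<Longrightarrow> h x = 0" and ab: "a \<le> b"
  obtains \<theta> C where "\<And>n. \<theta> n \<in> test_functions" "\<And>n x. \<bar>\<theta> n x\<bar> \<le> C"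
    "\<And>n x. x \<notin> {a - 1<..<b + 1} \<Longrightarrow> \<theta> n x = 0" "AE x in lborel. (\<lambda>n. \<theta> n x) \<longlonglongrightarrow> h x"
proof -
  define \<rho> where "\<rho> = bump (a - 1) (b + 1)"
  have sm: "smooth \<rho>" by (simp add: \<rho>_def smooth_bump)
  have [measurable]: "\<rho> \<in> borel_measurable borel"
    by (intro borel_measurable_continuous_onI smooth_continuous_on sm)
  have "\<exists>x\<in>{a..b}. \<forall>y\<in>{a..b}. \<rho> x \<le> \<rho> y"
    using ab by (intro continuous_attains_inf smooth_continuous_on sm) auto
  then obtain z where z: "z \<in> {a..b}" "\<And>y. y \<in> {a..b} \<Longrightarrow> \<rho> z \<le> \<rho> y" by auto
  have zpos: "\<rho> z > 0" using z(1) by (auto simp: \<rho>_def intro!: bump_pos)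
  \<comment> \<open>The quotient of \<open>h\<close> and \<open>\<rho>\<close>; outside the support of \<open>h\<close> it is 0, whatever \<open>\<rho>\<close> is.\<close>
  define k where "k x = h x / \<rho> x" for x
  define D where "D = \<bar>B\<bar> / \<rho> z"
  have D0: "D \<ge> 0" using zpos by (simp add: D_def)
  have kD: "\<bar>k x\<bar> \<le> D" for x
  proof (cases "x \<in> {a..b}")
    case True
    have "\<bar>h x\<bar> \<le> \<bar>B\<bar>" using hB[of x] by linarith
    then have "\<bar>h x\<bar> / \<rho> x \<le> \<bar>B\<bar> / \<rho> z"
      using z(2)[OF True] zpos by (intro frac_le) auto
    then show ?thesis using z(2)[OF True] zpos by (simp add: k_def D_def)
  qed (simp add: k_def h0 D0)
  have [measurable]: "k \<in> borel_measurable borel" unfolding k_def by measurable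
  have "k \<in> borel_measurable lebesgue"
    by (intro measurable_completion) simp
  then have "k measurable_on UNIV"
    by (simp add: measurable_on_iff_borel_measurable)
  then obtain N g where N: "negligible N" and g: "\<And>n. continuous_on UNIV (g n)"
    and gl: "\<And>x. x \<notin> N \<Longrightarrow> (\<lambda>n. g n x) \<longlonglongrightarrow> k x"
    by (auto simp: measurable_on_def)
  \<comment> \<open>Truncation at the bound of \<open>k\<close> keeps the limit and makes the approximants uniformly bounded.\<close>
  define G where "G n x = max (- D) (min D (g n x))" for n x
  have GD: "\<bar>G n x\<bar> \<le> D" for n x using D0 by (auto simp: G_def)
  have "\<exists>p. real_polynomial_function p \<and> (\<forall>x\<in>{a - 1..b + 1}. \<bar>G n x - p x\<bar> < 1 / real (Suc n))" for n
  proof -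
    have "continuous_on {a - 1..b + 1} (G n)" unfolding G_def
      by (intro continuous_intros continuous_on_subset[OF g]) auto
    then obtain q where "real_polynomial_function q"
      "\<And>x. x \<in> {a - 1..b + 1} \<Longrightarrow> \<bar>G n x - q x\<bar> < 1 / real (Suc n)"
      by (rule Stone_Weierstrass_real_polynomial_function[rotated, of _ _ "1 / real (Suc n)"]) auto
    then show ?thesis by blast
  qed
  then obtain p where p: "\<And>n. real_polynomial_function (p n)"
    and pG: "\<And>n x. x \<in> {a - 1..b + 1} \<Longrightarrow> \<bar>G n x - p n x\<bar> < 1 / real (Suc n)" by metis
  define \<theta> where "\<theta> n x = \<rho> x * p n x" for n x
  have out: "\<theta> n x = 0" if "x \<notin> {a - 1<..<b + 1}" for n x
    using that by (simp add: \<theta>_def \<rho>_def bump_zero)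
  show ?thesis
  proof (rule that[of \<theta> "D + 1"])
    show "\<theta> n \<in> test_functions" for n
    proof (rule test_functionI[of _ "a - 1" "b + 1"])
      show "smooth (\<theta> n)" unfolding \<theta>_def
        by (intro smooth_mult sm smooth_real_polynomial_function p)
    qed (auto intro!: out)
    show "\<bar>\<theta> n x\<bar> \<le> D + 1" for n x
    proof (cases "x \<in> {a - 1<..<b + 1}")
      case True
      then have "\<bar>G n x - p n x\<bar> < 1 / real (Suc n)" by (intro pG) auto
      moreover have "1 / real (Suc n) \<le> 1" by simp
      ultimately have "\<bar>p n x\<bar> \<le> D + 1" using GD[of n x] by linarith
      then have "\<bar>\<rho> x\<bar> * \<bar>p n x\<bar> \<le> 1 * (D + 1)"
        by (intro mult_mono) (auto simp: \<rho>_def bump_nonneg bump_le_1)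
      then show ?thesis by (simp add: \<theta>_def abs_mult)
    qed (simp add: out D0)
    have "AE x in lborel. x \<notin> N"
    proof -
      have "N \<in> null_sets lebesgue" using N negligible_iff_null_sets by blast
      then show ?thesis using AE_not_in AE_completion_iff by blast
    qed
    then show "AE x in lborel. (\<lambda>n. \<theta> n x) \<longlonglongrightarrow> h x"
    proof eventually_elim
      case (elim x)
      show ?case
      proof (cases "x \<in> {a - 1<..<b + 1}")
        case True
        have "(\<lambda>n. G n x) \<longlonglongrightarrow> max (- D) (min D (k x))"
          unfolding G_def by (intro tendsto_intros gl elim)
        moreover have "max (- D) (min D (k x)) = k x" using kD[of x] by auto
        moreover have "(\<lambda>n. G n x - p n x) \<longlonglongrightarrow> 0"
        proof (rule Lim_null_comparison)
          show "\<forall>\<^sub>F n in sequentially. norm (G n x - p n x) \<le> 1 / real (Suc n)"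
            using True less_imp_le[OF pG[of x]] by (intro always_eventually allI) auto
        qed (use LIMSEQ_inverse_real_of_nat in \<open>simp add: inverse_eq_divide\<close>)
        ultimately have "(\<lambda>n. G n x - (G n x - p n x)) \<longlonglongrightarrow> k x - 0"
          by (intro tendsto_diff) auto
        then have "(\<lambda>n. \<rho> x * p n x) \<longlonglongrightarrow> \<rho> x * k x" by (intro tendsto_intros) simp
        moreover have "\<rho> x > 0" using True by (auto simp: \<rho>_def intro!: bump_pos)
        ultimately show ?thesis by (simp add: \<theta>_def k_def)
      next
        case False
        then show ?thesis using out[OF False] h0[of x] by auto
      qed
    qed
  qed (rule out)
qed

lemma test_function_with_derivative:
  assumes "v \<in> test_functions" and v0: "\<And>x. x \<notin> {a<..<b} \<Longrightarrow> v x = 0" and "a < b"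
    and int0: "(\<integral>x. v x \<partial>lborel) = 0"
  defines "u \<equiv> \<lambda>x. \<integral>y. v y * indicator {..x} y \<partial>lborel"
  shows "u \<in> test_functions" "deriv u = v" "\<And>x. x \<notin> {a..b} \<Longrightarrow> u x = 0"
proof -
  have cont: "continuous_on S v" for S by (intro smooth_continuous_on test_smooth assms)
  obtain F where F: "\<And>x. (F has_vector_derivative v x) (at x)"
    using einterval_antiderivative[of "-\<infinity>" "\<infinity>" v] cont[of UNIV]
    by (auto simp: continuous_on_eq_continuous_at)
  have FTC: "(\<integral>y. v y * indicator {s..t} y \<partial>lborel) = F t - F s" if "s \<le> t" for s t
    using integral_FTC_atLeastAtMost[OF that, of F v] F cont
    by (auto simp: has_vector_derivative_at_within mult.commute)
  have left: "F x = F a" if "x \<le> a" for x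
  proof -
    have "(\<lambda>y. v y * indicator {x..a} y) = (\<lambda>y. 0)" using v0 by (auto simp: indicator_def fun_eq_iff)
    then show ?thesis using FTC[OF that] by simp
  qed
  have u: "u x = F x - F a" for x
  proof (cases "x \<ge> a")
    case True
    have "(\<lambda>y. v y * indicator {..x} y) = (\<lambda>y. v y * indicator {a..x} y)"
      using v0 by (auto simp: indicator_def fun_eq_iff)
    then show ?thesis using FTC[OF True] by (simp add: u_def)
  next
    case False
    then have "(\<lambda>y. v y * indicator {..x} y) = (\<lambda>y. 0)" using v0 by (auto simp: indicator_def fun_eq_iff)
    then show ?thesis using False left[of x] by (simp add: u_def)
  qed
  have D: "(u has_real_derivative v x) (at x)" for x
  proof -
    have "((\<lambda>x. F x - F a) has_real_derivative v x - 0) (at x)"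
      by (intro DERIV_diff DERIV_const) (simp add: F has_real_derivative_iff_has_vector_derivative)
    moreover have "u = (\<lambda>x. F x - F a)" by (rule ext, rule u)
    ultimately show ?thesis by simp
  qed
  have du: "deriv u = v"
  proof
    show "deriv u x = v x" for x using D[of x] by (rule DERIV_imp_deriv)
  qed
  have out: "u x = 0" if "x \<notin> {a..b}" for x
  proof (cases "x < a")
    case True
    then show ?thesis using left[of x] u[of x] by simp
  next
    case False
    then have "(\<lambda>y. v y * indicator {..x} y) = v"
      using v0 that by (auto simp: indicator_def fun_eq_iff)
    then show ?thesis using int0 by (simp add: u_def)
  qed
  have "smooth u" by (rule smooth_antideriv[OF D test_smooth[OF assms(1)]])
  then show "u \<in> test_functions" using out by (rule test_functionI)
  show "deriv u = v" by (rule du)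
  show "\<And>x. x \<notin> {a..b} \<Longrightarrow> u x = 0" by (rule out)
qed

text \<open>
  The primitives of the approximants of \<open>h\<close> have compact support only if these integrate to
  zero. Their integrals tend to \<open>\<integral> h = 0\<close>, so subtracting a vanishing multiple of a fixed bump
  function corrects them without changing the limit.
\<close>

lemma approx_primitive_by_test_functions:
  fixes h :: "real \<Rightarrow> real"
  assumes [measurable]: "h \<in> borel_measurable borel"
    and hB: "\<And>x. \<bar>h x\<bar> \<le> B" and h0: "\<And>x. x \<notin> {a..b} \<Longrightarrow> h x = 0" and ab: "a \<le> b"
    and int0: "(\<integral>x. h x \<partial>lborel) = 0"
  obtains \<Theta> C where "\<And>n. \<Theta> n \<in> test_functions"
    "\<And>n x. \<bar>\<Theta> n x\<bar> \<le> C" "\<And>n x. \<bar>deriv (\<Theta> n) x\<bar> \<le> C"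
    "\<And>n x. x \<notin> {a - 1..b + 1} \<Longrightarrow> \<Theta> n x = 0"
    "AE x in lborel. (\<lambda>n. deriv (\<Theta> n) x) \<longlonglongrightarrow> h x"
    "\<And>x. (\<lambda>n. \<Theta> n x) \<longlonglongrightarrow> (\<integral>y. h y * indicator {..x} y \<partial>lborel)"
proof -
  obtain \<theta> C where \<theta>: "\<And>n. \<theta> n \<in> test_functions" and \<theta>C: "\<And>n x. \<bar>\<theta> n x\<bar> \<le> C"
    and \<theta>0: "\<And>n x. x \<notin> {a - 1<..<b + 1} \<Longrightarrow> \<theta> n x = 0"
    and \<theta>h: "AE x in lborel. (\<lambda>n. \<theta> n x) \<longlonglongrightarrow> h x"
    using approx_by_test_functions[OF assms(1) hB h0 ab] by blast
  have [measurable]: "\<theta> n \<in> borel_measurable borel" for n by (rule test_measurable[OF \<theta>])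
  define \<beta> where "\<beta> = bump (a - 1) (b + 1)"
  have \<beta>: "\<beta> \<in> test_functions"
    by (rule test_functionI[of _ "a - 1" "b + 1"]) (auto simp: \<beta>_def smooth_bump intro!: bump_zero)
  have [measurable]: "\<beta> \<in> borel_measurable borel" by (rule test_measurable[OF \<beta>])
  have \<beta>int: "integrable lborel \<beta>"
  proof (rule integrable_bounded_interval[of _ "a - 1" "b + 1" 1])
    show "\<bar>\<beta> x\<bar> \<le> 1" for x by (simp add: \<beta>_def bump_le_1 bump_nonneg)
    show "\<beta> x = 0" if "x \<notin> {a - 1..b + 1}" for x
      using that by (auto simp: \<beta>_def intro!: bump_zero)
  qed simp
  define I where "I = (\<integral>x. \<beta> x \<partial>lborel)"
  have "I \<noteq> 0"
  proof
    assume "I = 0"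
    then have "AE x in lborel. \<beta> x = 0"
      using integral_nonneg_eq_0_iff_AE[OF \<beta>int] by (auto simp: I_def \<beta>_def bump_nonneg)
    moreover have "AE x in lborel. \<beta> x = 0 \<longrightarrow> x \<notin> {a - 1<..<b + 1}"
      by (rule AE_I2) (use bump_pos[of "a - 1" _ "b + 1"] in \<open>force simp: \<beta>_def\<close>)
    ultimately have "AE x in lborel. x \<notin> {a - 1<..<b + 1}" by eventually_elim auto
    then have "emeasure lborel {a - 1<..<b + 1} = 0"
      by (subst (asm) AE_iff_measurable[OF _ refl]) (auto simp: greaterThanLessThan_def greaterThan_def lessThan_def Int_def)
    then show False using ab by simp
  qed
  define c where "c n = (\<integral>x. \<theta> n x \<partial>lborel) / I" for n
  have "(\<lambda>n. \<integral>x. \<theta> n x \<partial>lborel) \<longlonglongrightarrow> (\<integral>x. h x \<partial>lborel)"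
    by (rule bounded_interval_convergence[of _ _ "a - 1" "b + 1" C]) (use \<theta>C \<theta>0 \<theta>h in auto)
  then have c: "c \<longlonglongrightarrow> 0" unfolding c_def[abs_def] int0 by (auto intro: tendsto_divide_zero)
  then obtain K where K: "\<And>n. \<bar>c n\<bar> \<le> K"
    using convergent_imp_Bseq[OF convergentI[OF c]] by (auto simp: Bseq_def)
  define \<eta> where "\<eta> n x = 1 * \<theta> n x + (- c n) * \<beta> x" for n x
  have t: "\<eta> n \<in> test_functions" for n
    unfolding \<eta>_def by (rule test_lincomb[OF \<theta> \<beta>])
  have [measurable]: "\<eta> n \<in> borel_measurable borel" for n by (rule test_measurable[OF t])
  have t0: "\<eta> n x = 0" if "x \<notin> {a - 1<..<b + 1}" for n x
    using that by (simp add: \<eta>_def \<theta>0 \<beta>_def bump_zero)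
  have tC: "\<bar>\<eta> n x\<bar> \<le> C + K" for n x
  proof -
    have "\<bar>\<theta> n x\<bar> + \<bar>c n\<bar> * \<bar>\<beta> x\<bar> \<le> C + K * 1"
      using \<theta>C[of n x] K[of n] by (intro add_mono mult_mono) (auto simp: \<beta>_def bump_nonneg bump_le_1)
    then show ?thesis
      using abs_triangle_ineq4[of "\<theta> n x" "c n * \<beta> x"] by (simp add: \<eta>_def abs_mult)
  qed
  have tint: "(\<integral>x. \<eta> n x \<partial>lborel) = 0" for n
  proof -
    have "integrable lborel (\<theta> n)"
      by (rule integrable_bounded_interval[of _ "a - 1" "b + 1" C]) (use \<theta>C \<theta>0 in auto)
    then have "(\<integral>x. \<eta> n x \<partial>lborel) = (\<integral>x. \<theta> n x \<partial>lborel) - c n * I"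
      using \<beta>int by (simp add: \<eta>_def I_def)
    then show ?thesis using \<open>I \<noteq> 0\<close> by (simp add: c_def)
  qed
  have tlim: "AE x in lborel. (\<lambda>n. \<eta> n x) \<longlonglongrightarrow> h x"
    using \<theta>h
  proof eventually_elim
    case (elim x)
    have "(\<lambda>n. 1 * \<theta> n x + (- c n) * \<beta> x) \<longlonglongrightarrow> 1 * h x + (- 0) * \<beta> x"
      by (intro tendsto_intros elim c)
    then show ?case by (simp add: \<eta>_def)
  qed
  define \<Theta> where "\<Theta> n x = (\<integral>y. \<eta> n y * indicator {..x} y \<partial>lborel)" for n x
  have ab': "a - 1 < b + 1" using ab by simp
  have \<Theta>eq: "\<Theta> n = (\<lambda>x. \<integral>y. \<eta> n y * indicator {..x} y \<partial>lborel)" for n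
    by (rule ext) (rule \<Theta>_def)
  have T: "\<Theta> n \<in> test_functions" "deriv (\<Theta> n) = \<eta> n" for n
    unfolding \<Theta>eq by (rule test_function_with_derivative[of "\<eta> n" "a - 1" "b + 1"]; fact t t0 ab' tint)+
  have T0: "\<Theta> n x = 0" if "x \<notin> {a - 1..b + 1}" for n x
    unfolding \<Theta>eq
    by (rule test_function_with_derivative(3)[of "\<eta> n" "a - 1" "b + 1"]; fact t t0 ab' tint that)
  have C0: "C + K \<ge> 0" using tC[of 0 0] by linarith
  define M where "M = (C + K) * max 1 (b - a + 2)"
  have CM: "C + K \<le> M" using mult_left_mono[OF _ C0, of 1 "max 1 (b - a + 2)"] by (simp add: M_def)
  show ?thesis
  proof (rule that[of \<Theta> M])
    show "\<Theta> n \<in> test_functions" for n by (rule T(1))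
    show "\<bar>deriv (\<Theta> n) x\<bar> \<le> M" for n x using T(2) tC[of n x] CM by simp
    show "\<Theta> n x = 0" if "x \<notin> {a - 1..b + 1}" for n x by (rule T0[OF that])
    show "AE x in lborel. (\<lambda>n. deriv (\<Theta> n) x) \<longlonglongrightarrow> h x" using tlim T(2) by simp
    show "(\<lambda>n. \<Theta> n x) \<longlonglongrightarrow> (\<integral>y. h y * indicator {..x} y \<partial>lborel)" for x
      unfolding \<Theta>_def
    proof (rule bounded_interval_convergence[of _ _ "a - 1" "b + 1" "C + K"])
      show "AE y in lborel. (\<lambda>n. \<eta> n y * indicator {..x} y) \<longlonglongrightarrow> h y * indicator {..x} y"
        using tlim by eventually_elim (intro tendsto_intros)
    qed (use tC t0 C0 in \<open>auto simp: indicator_def\<close>)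
    show "\<bar>\<Theta> n x\<bar> \<le> M" for n x
    proof -
      have "\<bar>\<Theta> n x\<bar> \<le> (\<integral>y. \<bar>\<eta> n y * indicator {..x} y\<bar> \<partial>lborel)"
        unfolding \<Theta>_def by (rule integral_abs_bound)
      also have "\<dots> \<le> (\<integral>y. (C + K) * indicator {a - 1..b + 1} y \<partial>lborel)"
      proof (rule integral_mono)
        show "integrable lborel (\<lambda>y. \<bar>\<eta> n y * indicator {..x} y\<bar>)"
          by (rule integrable_bounded_interval[of _ "a - 1" "b + 1" "C + K"])
             (use tC t0 C0 in \<open>auto simp: indicator_def\<close>)
        show "\<bar>\<eta> n y * indicator {..x} y\<bar> \<le> (C + K) * indicator {a - 1..b + 1} y" for y
          using tC[of n y] t0[of y n] C0 by (auto simp: indicator_def)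
        show "integrable lborel (\<lambda>y. (C + K) * indicator {a - 1..b + 1} y)"
          by (rule integrable_bounded_interval[of _ "a - 1" "b + 1" "C + K"])
             (use C0 in \<open>auto simp: indicator_def\<close>)
      qed
      also have "\<dots> = (C + K) * (b - a + 2)" using ab by simp
      also have "\<dots> \<le> M" unfolding M_def using C0 by (intro mult_left_mono) auto
      finally show ?thesis .
    qed
  qed
qed


section \<open>The space of square integrable functions\<close>

lemma quadratic_discriminant_bound:
  fixes A B C :: real
  assumes "\<And>t. 0 \<le> A + 2 * t * B + t\<^sup>2 * C"
  shows "B\<^sup>2 \<le> A * C"
proof (cases "C = 0")
  case True
  have "B = 0"
  proof (rule ccontr)
    assume "B \<noteq> 0"
    then show False using assms[of "- (A + 1) / (2 * B)"] True by (simp add: field_simps)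
  qed
  then show ?thesis using True by simp
next
  case False
  have C: "C > 0"
  proof (rule ccontr)
    assume "\<not> C > 0"
    with False have "C < 0" by simp
    \<comment> \<open>A value so large that the quadratic term dominates the two others.\<close>
    define t where "t = (1 + \<bar>A\<bar> + 2 * \<bar>B\<bar>) / \<bar>C\<bar> + 1"
    have t1: "t \<ge> 1" by (simp add: t_def)
    have "t * \<bar>C\<bar> = 1 + \<bar>A\<bar> + 2 * \<bar>B\<bar> + \<bar>C\<bar>" using \<open>C < 0\<close> by (simp add: t_def field_simps)
    then have "t * (t * \<bar>C\<bar>) \<ge> t * (1 + \<bar>A\<bar> + 2 * \<bar>B\<bar>)" using t1 by (intro mult_left_mono) auto
    moreover have "t * (1 + \<bar>A\<bar>) \<ge> 1 + \<bar>A\<bar>" using t1 mult_right_mono[of 1 t "1 + \<bar>A\<bar>"] by simp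
    moreover have "t * B \<le> t * \<bar>B\<bar>" using t1 by (intro mult_left_mono) auto
    ultimately have "A + 2 * t * B + t\<^sup>2 * C < 0"
      using \<open>C < 0\<close> by (simp add: power2_eq_square algebra_simps)
    then show False using assms[of t] by simp
  qed
  have "0 \<le> A - B\<^sup>2 / C"
    using assms[of "- B / C"] C by (simp add: field_simps power2_eq_square)
  then show ?thesis using C by (simp add: field_simps)
qed

lemma L2_D:
  assumes "u \<in> L2 M"
  shows "u \<in> borel_measurable M" "integrable M (\<lambda>x. (u x)\<^sup>2)"
  using assms by (auto simp: L2_def)

lemma L2_mult_integrable:
  assumes "u \<in> L2 M" "v \<in> L2 M"
  shows "integrable M (\<lambda>x. u x * v x)"
proof (rule Bochner_Integration.integrable_bound)
  show "integrable M (\<lambda>x. (u x)\<^sup>2 + (v x)\<^sup>2)" by (intro Bochner_Integration.integrable_add L2_D assms)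
  show "(\<lambda>x. u x * v x) \<in> borel_measurable M" by (intro borel_measurable_times L2_D assms)
  show "AE x in M. norm (u x * v x) \<le> norm ((u x)\<^sup>2 + (v x)\<^sup>2)"
  proof (rule AE_I2)
    fix x
    have "0 \<le> (\<bar>u x\<bar> - \<bar>v x\<bar>)\<^sup>2" by simp
    then have "2 * (\<bar>u x\<bar> * \<bar>v x\<bar>) \<le> (u x)\<^sup>2 + (v x)\<^sup>2"
      by (simp add: power2_diff algebra_simps)
    moreover have "0 \<le> \<bar>u x\<bar> * \<bar>v x\<bar>" by simp
    ultimately have "\<bar>u x\<bar> * \<bar>v x\<bar> \<le> (u x)\<^sup>2 + (v x)\<^sup>2" by linarith
    then show "norm (u x * v x) \<le> norm ((u x)\<^sup>2 + (v x)\<^sup>2)" by (simp add: abs_mult)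
  qed
qed

lemma L2_lincomb:
  assumes "u \<in> L2 M" "v \<in> L2 M"
  shows "(\<lambda>x. a * u x + b * v x) \<in> L2 M"
proof -
  have "integrable M (\<lambda>x. a\<^sup>2 * (u x)\<^sup>2 + (2 * a * b) * (u x * v x) + b\<^sup>2 * (v x)\<^sup>2)"
    by (intro Bochner_Integration.integrable_add integrable_mult_right L2_D L2_mult_integrable assms)
  moreover have "(a * u x + b * v x)\<^sup>2 = a\<^sup>2 * (u x)\<^sup>2 + (2 * a * b) * (u x * v x) + b\<^sup>2 * (v x)\<^sup>2" for x
    by (simp add: power2_eq_square algebra_simps)
  moreover have "(\<lambda>x. a * u x + b * v x) \<in> borel_measurable M"
    by (intro borel_measurable_add borel_measurable_times borel_measurable_const L2_D assms)
  ultimately show ?thesis by (simp add: L2_def)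
qed

lemma L2_diff: "u \<in> L2 M \<Longrightarrow> v \<in> L2 M \<Longrightarrow> (\<lambda>x. u x - v x) \<in> L2 M"
  and L2_add: "u \<in> L2 M \<Longrightarrow> v \<in> L2 M \<Longrightarrow> (\<lambda>x. u x + v x) \<in> L2 M"
  and L2_scale: "u \<in> L2 M \<Longrightarrow> (\<lambda>x. c * u x) \<in> L2 M"
  using L2_lincomb[of u M v 1 "-1"] L2_lincomb[of u M v 1 1] L2_lincomb[of u M u c 0] by simp_all

lemma l2_inner_commute: "l2_inner M u v = l2_inner M v u"
  by (simp add: l2_inner_def mult.commute)

lemma l2_inner_lincomb:
  assumes "u \<in> L2 M" "v \<in> L2 M" "w \<in> L2 M"
  shows "l2_inner M (\<lambda>x. a * u x + b * v x) w = a * l2_inner M u w + b * l2_inner M v w"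
proof -
  have "l2_inner M (\<lambda>x. a * u x + b * v x) w = (\<integral>x. a * (u x * w x) + b * (v x * w x) \<partial>M)"
    unfolding l2_inner_def by (simp add: algebra_simps)
  also have "\<dots> = a * l2_inner M u w + b * l2_inner M v w"
    unfolding l2_inner_def
    by (subst Bochner_Integration.integral_add)
       (auto intro!: L2_mult_integrable assms)
  finally show ?thesis .
qed

lemma l2_inner_diff:
  "u \<in> L2 M \<Longrightarrow> v \<in> L2 M \<Longrightarrow> w \<in> L2 M \<Longrightarrow>
    l2_inner M (\<lambda>x. u x - v x) w = l2_inner M u w - l2_inner M v w"
  using l2_inner_lincomb[of u M v w 1 "-1"] by simp

lemma l2_inner_self_nonneg: "0 \<le> l2_inner M u u"
  by (simp add: l2_inner_def)

lemma l2_norm_sq: "(l2_norm M u)\<^sup>2 = l2_inner M u u"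
  and l2_norm_nonneg: "0 \<le> l2_norm M u"
  by (simp_all add: l2_norm_def l2_inner_self_nonneg)

lemma l2_norm_sq_lincomb:
  assumes "u \<in> L2 M" "v \<in> L2 M"
  shows "(l2_norm M (\<lambda>x. a * u x + b * v x))\<^sup>2 =
    a\<^sup>2 * (l2_norm M u)\<^sup>2 + 2 * a * b * l2_inner M u v + b\<^sup>2 * (l2_norm M v)\<^sup>2"
  using l2_inner_lincomb[OF assms L2_lincomb[OF assms, of a b], of a b]
    l2_inner_lincomb[OF assms assms(1), of a b] l2_inner_lincomb[OF assms assms(2), of a b]
    l2_inner_commute[of M v u]
    l2_inner_commute[of M u "\<lambda>x. a * u x + b * v x"] l2_inner_commute[of M v "\<lambda>x. a * u x + b * v x"]
  by (simp add: l2_norm_sq) (simp add: power2_eq_square algebra_simps)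

lemma l2_cauchy_schwarz:
  assumes "u \<in> L2 M" "v \<in> L2 M"
  shows "\<bar>l2_inner M u v\<bar> \<le> l2_norm M u * l2_norm M v"
proof -
  have "(l2_inner M u v)\<^sup>2 \<le> (l2_norm M u)\<^sup>2 * (l2_norm M v)\<^sup>2"
  proof (rule quadratic_discriminant_bound)
    fix t
    show "0 \<le> (l2_norm M u)\<^sup>2 + 2 * t * l2_inner M u v + t\<^sup>2 * (l2_norm M v)\<^sup>2"
      using l2_norm_sq_lincomb[OF assms, of 1 t] zero_le_power2[of "l2_norm M (\<lambda>x. 1 * u x + t * v x)"]
      by simp
  qed
  then have "(l2_inner M u v)\<^sup>2 \<le> (l2_norm M u * l2_norm M v)\<^sup>2"
    by (simp add: power_mult_distrib)
  then show ?thesis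
    by (metis abs_le_square_iff abs_of_nonneg l2_norm_nonneg mult_nonneg_nonneg)
qed

lemma l2_norm_triangle:
  assumes "u \<in> L2 M" "v \<in> L2 M"
  shows "l2_norm M (\<lambda>x. u x + v x) \<le> l2_norm M u + l2_norm M v"
proof (rule power2_le_imp_le)
  show "(l2_norm M (\<lambda>x. u x + v x))\<^sup>2 \<le> (l2_norm M u + l2_norm M v)\<^sup>2"
    using l2_norm_sq_lincomb[OF assms, of 1 1] l2_cauchy_schwarz[OF assms]
    by (simp add: power2_sum)
qed (simp add: l2_norm_nonneg)

lemma l2_norm_minus: "l2_norm M (\<lambda>x. - u x) = l2_norm M u"
  by (simp add: l2_norm_def l2_inner_def)

lemma l2_norm_diff_commute: "l2_norm M (\<lambda>x. u x - v x) = l2_norm M (\<lambda>x. v x - u x)"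
  by (simp add: l2_norm_def l2_inner_def algebra_simps)

lemma l2_norm_triangle_diff:
  assumes "u \<in> L2 M" "v \<in> L2 M" "w \<in> L2 M"
  shows "l2_norm M (\<lambda>x. u x - w x) \<le> l2_norm M (\<lambda>x. u x - v x) + l2_norm M (\<lambda>x. v x - w x)"
  using l2_norm_triangle[of "\<lambda>x. u x - v x" M "\<lambda>x. v x - w x"] L2_diff[OF assms(1,2)] L2_diff[OF assms(2,3)]
  by simp

lemma l2_norm_scale: "l2_norm M (\<lambda>x. c * u x) = \<bar>c\<bar> * l2_norm M u"
proof -
  have "l2_inner M (\<lambda>x. c * u x) (\<lambda>x. c * u x) = (\<integral>x. c\<^sup>2 * (u x * u x) \<partial>M)"
    unfolding l2_inner_def by (simp add: power2_eq_square algebra_simps)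
  then have "l2_inner M (\<lambda>x. c * u x) (\<lambda>x. c * u x) = c\<^sup>2 * l2_inner M u u"
    by (simp add: l2_inner_def)
  then show ?thesis by (simp add: l2_norm_def real_sqrt_mult)
qed

lemma l2_norm_cong_AE:
  assumes "AE x in M. u x = v x" "u \<in> borel_measurable M" "v \<in> borel_measurable M"
  shows "l2_norm M u = l2_norm M v"
  unfolding l2_norm_def l2_inner_def
  by (rule arg_cong[of _ _ sqrt], rule integral_cong_AE) (use assms in auto)

lemma l2_norm_zero_AE:
  assumes "u \<in> L2 M" "l2_norm M u = 0" shows "AE x in M. u x = 0"
proof -
  have "integral\<^sup>L M (\<lambda>x. u x * u x) = 0" using assms by (simp add: l2_norm_def l2_inner_def)
  then have "AE x in M. u x * u x = 0"
    using integral_nonneg_eq_0_iff_AE[OF L2_mult_integrable[OF assms(1,1)]] by simp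
  then show ?thesis by simp
qed

lemma l2_inner_tendsto:
  assumes "\<And>n. u n \<in> L2 M" "g \<in> L2 M" "v \<in> L2 M" "l2_tendsto M u g F"
  shows "((\<lambda>n. l2_inner M (u n) v) \<longlongrightarrow> l2_inner M g v) F"
proof -
  have "((\<lambda>n. l2_norm M (\<lambda>x. u n x - g x) * l2_norm M v) \<longlongrightarrow> 0) F"
    using assms(4) unfolding l2_tendsto_def by (intro tendsto_mult_left_zero)
  then have "((\<lambda>n. l2_inner M (u n) v - l2_inner M g v) \<longlongrightarrow> 0) F"
  proof (rule Lim_null_comparison[rotated], intro always_eventually allI)
    fix n
    show "norm (l2_inner M (u n) v - l2_inner M g v) \<le> l2_norm M (\<lambda>x. u n x - g x) * l2_norm M v"
      using l2_cauchy_schwarz[of "\<lambda>x. u n x - g x" M v] L2_diff[OF assms(1,2)] assms(1-3)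
        l2_inner_diff[of "u n" M g v] by auto
  qed
  then show ?thesis by (simp add: LIM_zero_iff)
qed

lemma l2_norm_tendsto:
  assumes "\<And>n. u n \<in> L2 M" "g \<in> L2 M" "l2_tendsto M u g F"
  shows "((\<lambda>n. l2_norm M (u n)) \<longlongrightarrow> l2_norm M g) F"
proof -
  have "((\<lambda>n. l2_norm M (u n) - l2_norm M g) \<longlongrightarrow> 0) F"
  proof (rule Lim_null_comparison, intro always_eventually allI)
    fix n
    show "norm (l2_norm M (u n) - l2_norm M g) \<le> l2_norm M (\<lambda>x. u n x - g x)"
      using l2_norm_triangle[of "\<lambda>x. u n x - g x" M g] l2_norm_triangle[of "\<lambda>x. g x - u n x" M "u n"]
        L2_diff[OF assms(1,2)] L2_diff[OF assms(2,1)] assms(1,2)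
        l2_norm_diff_commute[of M "u n" g] by auto
  qed (use assms(3) in \<open>simp add: l2_tendsto_def\<close>)
  then show ?thesis by (simp add: LIM_zero_iff)
qed

lemma l2_inner_tendsto2:
  assumes "\<And>n. u n \<in> L2 M" "f \<in> L2 M" "\<And>n. v n \<in> L2 M" "g \<in> L2 M"
    and "l2_tendsto M u f F" "l2_tendsto M v g F"
  shows "((\<lambda>n. l2_inner M (u n) (v n)) \<longlongrightarrow> l2_inner M f g) F"
proof -
  have "((\<lambda>n. l2_norm M (u n) * l2_norm M (\<lambda>x. v n x - g x)) \<longlongrightarrow> l2_norm M f * 0) F"
    using assms(6) l2_norm_tendsto[OF assms(1,2,5)] unfolding l2_tendsto_def by (intro tendsto_mult)
  then have "((\<lambda>n. l2_norm M (u n) * l2_norm M (\<lambda>x. v n x - g x)) \<longlongrightarrow> 0) F" by simp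
  then have "((\<lambda>n. l2_inner M (u n) (v n) - l2_inner M (u n) g) \<longlongrightarrow> 0) F"
  proof (rule Lim_null_comparison[rotated], intro always_eventually allI)
    fix n
    have "l2_inner M (u n) (\<lambda>x. v n x - g x) = l2_inner M (u n) (v n) - l2_inner M (u n) g"
      using l2_inner_diff[OF assms(3,4,1)] by (simp add: l2_inner_commute)
    then show "norm (l2_inner M (u n) (v n) - l2_inner M (u n) g)
        \<le> l2_norm M (u n) * l2_norm M (\<lambda>x. v n x - g x)"
      using l2_cauchy_schwarz[OF assms(1) L2_diff[OF assms(3,4)], of n n] by simp
  qed
  from tendsto_add[OF this l2_inner_tendsto[OF assms(1,2,4,5)]] show ?thesis by simp
qed

lemma l2_tendsto_diff:
  assumes "\<And>n. a n \<in> L2 M" "f \<in> L2 M" "\<And>n. b n \<in> L2 M" "g \<in> L2 M"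
    and "l2_tendsto M a f F" "l2_tendsto M b g F"
  shows "l2_tendsto M (\<lambda>n x. a n x - b n x) (\<lambda>x. f x - g x) F"
  unfolding l2_tendsto_def
proof (rule Lim_null_comparison, intro always_eventually allI)
  fix n
  have "l2_norm M (\<lambda>x. (a n x - f x) + (g x - b n x)) \<le> l2_norm M (\<lambda>x. a n x - f x) + l2_norm M (\<lambda>x. g x - b n x)"
    by (intro l2_norm_triangle L2_diff assms)
  moreover have "(\<lambda>x. (a n x - f x) + (g x - b n x)) = (\<lambda>x. a n x - b n x - (f x - g x))"
    by (simp add: fun_eq_iff)
  ultimately show "norm (l2_norm M (\<lambda>x. a n x - b n x - (f x - g x)))
      \<le> l2_norm M (\<lambda>x. a n x - f x) + l2_norm M (\<lambda>x. b n x - g x)"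
    using l2_norm_diff_commute[of M g "b n"] by (simp add: l2_norm_nonneg)
qed (use assms(5,6) tendsto_add[of _ 0 F _ 0] in \<open>auto simp: l2_tendsto_def\<close>)

lemma l2_tendsto_cong_AE:
  assumes "\<And>n. a n \<in> L2 M" "f \<in> L2 M" "g \<in> L2 M" "AE x in M. f x = g x" "l2_tendsto M a f F"
  shows "l2_tendsto M a g F"
proof -
  have "l2_norm M (\<lambda>x. a n x - f x) = l2_norm M (\<lambda>x. a n x - g x)" for n
    by (rule l2_norm_cong_AE; (intro L2_D(1) L2_diff assms(1-3))?) (use assms(4) in auto)
  with assms(5) show ?thesis by (simp add: l2_tendsto_def)
qed

text \<open>
  Along a subsequence the increments \<open>d\<^sub>k\<close> have norms at most \<open>2\<^sup>-\<^sup>k\<close>. Then \<open>\<Sum> 2\<^sup>k d\<^sub>k\<^sup>2\<close> is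
  integrable, hence finite almost everywhere, and \<open>\<bar>d\<^sub>k\<bar> \<le> 2\<^sup>-\<^sup>k + 2\<^sup>k d\<^sub>k\<^sup>2\<close> makes the
  subsequence converge almost everywhere. Fatou's lemma turns this into convergence in norm.
\<close>

lemma l2_complete:
  fixes u :: "nat \<Rightarrow> 'a \<Rightarrow> real"
  assumes u: "\<And>n. u n \<in> L2 M"
    and Cauchy: "\<And>e. e > 0 \<Longrightarrow> \<exists>N. \<forall>m\<ge>N. \<forall>n\<ge>N. l2_norm M (\<lambda>x. u m x - u n x) < e"
  obtains g where "g \<in> L2 M" "l2_tendsto M u g sequentially"
proof -
  have [measurable]: "u n \<in> borel_measurable M" for n using u L2_D by auto
  have nn: "(\<integral>\<^sup>+x. ennreal ((u m x - u n x)\<^sup>2) \<partial>M) = ennreal ((l2_norm M (\<lambda>x. u m x - u n x))\<^sup>2)" for m n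
    using L2_D(2)[OF L2_diff[OF u u]]
    by (subst nn_integral_eq_integral) (auto simp: l2_norm_sq, simp add: l2_inner_def power2_eq_square)
  have "\<forall>k. \<exists>N. \<forall>m\<ge>N. \<forall>n\<ge>N. l2_norm M (\<lambda>x. u m x - u n x) < (1 / 2) ^ k" using Cauchy by simp
  then obtain N where N: "\<And>k m n. m \<ge> N k \<Longrightarrow> n \<ge> N k \<Longrightarrow> l2_norm M (\<lambda>x. u m x - u n x) < (1 / 2) ^ k"
    by metis
  \<comment> \<open>Summing makes the indices nondecreasing, with \<open>r k\<close> at least \<open>N k\<close>.\<close>
  define r where "r k = (\<Sum>j\<le>k. N j)" for k
  have rN: "r k \<ge> N k" "r (Suc k) \<ge> r k" for k unfolding r_def by (auto simp: member_le_sum)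
  have r: "l2_norm M (\<lambda>x. u (r (Suc k)) x - u (r k) x) < (1 / 2) ^ k" for k
    using rN[of k] by (intro N) auto
  define d where "d k x = u (r (Suc k)) x - u (r k) x" for k x
  have [measurable]: "d k \<in> borel_measurable M" for k unfolding d_def by measurable
  have "(\<integral>\<^sup>+x. (\<Sum>k. ennreal (2 ^ k * (d k x)\<^sup>2)) \<partial>M) = (\<Sum>k. \<integral>\<^sup>+x. ennreal (2 ^ k * (d k x)\<^sup>2) \<partial>M)"
    by (rule nn_integral_suminf) auto
  also have "\<dots> \<le> (\<Sum>k. ennreal ((1 / 2) ^ k))"
  proof (intro suminf_le summableI)
    fix k
    have "(\<integral>\<^sup>+x. ennreal (2 ^ k * (d k x)\<^sup>2) \<partial>M) = ennreal (2 ^ k * (l2_norm M (d k))\<^sup>2)"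
      using nn[of "r (Suc k)" "r k"] by (simp add: ennreal_mult nn_integral_cmult d_def[abs_def])
    also have "2 ^ k * (l2_norm M (d k))\<^sup>2 \<le> 2 ^ k * ((1 / 2) ^ k)\<^sup>2"
      using r[of k] by (intro mult_left_mono power_mono) (auto simp: l2_norm_nonneg d_def[abs_def])
    also have "\<dots> = (1 / 2 :: real) ^ k" by (simp add: power2_eq_square power_one_over)
    finally show "(\<integral>\<^sup>+x. ennreal (2 ^ k * (d k x)\<^sup>2) \<partial>M) \<le> ennreal ((1 / 2) ^ k)"
      by (simp add: ennreal_leI)
  qed
  also have "\<dots> < \<infinity>"
    by (subst suminf_ennreal_eq[OF _ geometric_sums]) auto
  finally have "AE x in M. (\<Sum>k. ennreal (2 ^ k * (d k x)\<^sup>2)) \<noteq> \<infinity>"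
    by (intro nn_integral_PInf_AE) auto
  then have conv: "AE x in M. convergent (\<lambda>k. u (r k) x)"
  proof eventually_elim
    case (elim x)
    have "summable (\<lambda>k. 2 ^ k * (d k x)\<^sup>2)"
      using elim by (intro summable_suminf_not_top) auto
    then have "summable (\<lambda>k. (1 / 2) ^ k + 2 ^ k * (d k x)\<^sup>2)"
      by (intro summable_add summable_geometric) auto
    then have "summable (\<lambda>k. d k x)"
    proof (rule summable_comparison_test[rotated], intro exI[of _ 0] allI impI)
      fix k :: nat
      have "0 \<le> (1 - 2 ^ k * \<bar>d k x\<bar>)\<^sup>2" by simp
      then have "2 * (2 ^ k * \<bar>d k x\<bar>) \<le> 1 + (2 ^ k)\<^sup>2 * (d k x)\<^sup>2"
        by (simp add: power2_diff power_mult_distrib)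
      moreover have "0 \<le> 2 ^ k * \<bar>d k x\<bar>" by simp
      ultimately have "2 ^ k * \<bar>d k x\<bar> \<le> 1 + (2 ^ k)\<^sup>2 * (d k x)\<^sup>2" by linarith
      then show "norm (d k x) \<le> (1 / 2) ^ k + 2 ^ k * (d k x)\<^sup>2"
        by (simp add: field_simps power2_eq_square)
    qed
    then have "convergent (\<lambda>k. u (r 0) x + (\<Sum>j<k. d j x))"
      by (intro convergent_add convergent_const) (simp add: summable_iff_convergent)
    moreover have "u (r 0) x + (\<Sum>j<k. d j x) = u (r k) x" for k
      unfolding d_def by (subst sum_lessThan_telescope) simp
    ultimately show ?case by simp
  qed
  define g where "g x = lim (\<lambda>k. u (r k) x)" for x
  have [measurable]: "g \<in> borel_measurable M" unfolding g_def by measurable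
  have bound: "(\<integral>\<^sup>+x. ennreal ((g x - u n x)\<^sup>2) \<partial>M) \<le> ennreal (((1 / 2) ^ j)\<^sup>2)" if "n \<ge> N j" for n j
  proof -
    have "(\<integral>\<^sup>+x. ennreal ((g x - u n x)\<^sup>2) \<partial>M) = (\<integral>\<^sup>+x. liminf (\<lambda>k. ennreal ((u (r k) x - u n x)\<^sup>2)) \<partial>M)"
    proof (rule nn_integral_cong_AE)
      show "AE x in M. ennreal ((g x - u n x)\<^sup>2) = liminf (\<lambda>k. ennreal ((u (r k) x - u n x)\<^sup>2))"
        using conv
      proof eventually_elim
        case (elim x)
        then have "(\<lambda>k. u (r k) x) \<longlonglongrightarrow> g x" by (simp add: g_def convergent_LIMSEQ_iff)
        then have "(\<lambda>k. ennreal ((u (r k) x - u n x)\<^sup>2)) \<longlonglongrightarrow> ennreal ((g x - u n x)\<^sup>2)"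
          by (intro tendsto_ennrealI tendsto_intros)
        then show ?case using lim_imp_Liminf[of sequentially] by (metis sequentially_bot)
      qed
    qed
    also have "\<dots> \<le> liminf (\<lambda>k. \<integral>\<^sup>+x. ennreal ((u (r k) x - u n x)\<^sup>2) \<partial>M)"
      by (rule nn_integral_liminf) auto
    also have "\<dots> \<le> ennreal (((1 / 2) ^ j)\<^sup>2)"
    proof (rule Liminf_le)
      show "\<forall>\<^sub>F k in sequentially. (\<integral>\<^sup>+x. ennreal ((u (r k) x - u n x)\<^sup>2) \<partial>M) \<le> ennreal (((1 / 2) ^ j)\<^sup>2)"
        unfolding eventually_sequentially
      proof (intro exI[of _ j] allI impI)
        fix k assume "j \<le> k"
        have "r k \<ge> N j" unfolding r_def using \<open>j \<le> k\<close> by (auto intro: member_le_sum)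
        then show "(\<integral>\<^sup>+x. ennreal ((u (r k) x - u n x)\<^sup>2) \<partial>M) \<le> ennreal (((1 / 2) ^ j)\<^sup>2)"
          unfolding nn using N[OF _ that, of "r k"]
          by (intro ennreal_leI power_mono) (auto simp: l2_norm_nonneg)
      qed
    qed simp
    finally show ?thesis .
  qed
  have diff: "(\<lambda>x. g x - u n x) \<in> L2 M" if "n \<ge> N j" for n j
    unfolding L2_def using bound[OF that]
    by (auto intro!: integrableI_nonneg simp: less_top[symmetric] top_unique)
  have "(\<lambda>x. (g x - u (N 0) x) + u (N 0) x) \<in> L2 M" by (intro L2_add diff[of 0] u) simp
  then have g: "g \<in> L2 M" by simp
  have le: "l2_norm M (\<lambda>x. u n x - g x) \<le> (1 / 2) ^ j" if "n \<ge> N j" for n j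
  proof -
    have "ennreal ((l2_norm M (\<lambda>x. g x - u n x))\<^sup>2) = (\<integral>\<^sup>+x. ennreal ((g x - u n x)\<^sup>2) \<partial>M)"
      using L2_D(2)[OF diff[OF that]]
      by (subst nn_integral_eq_integral) (auto simp: l2_norm_sq, simp add: l2_inner_def power2_eq_square)
    also have "\<dots> \<le> ennreal (((1 / 2) ^ j)\<^sup>2)" by (rule bound[OF that])
    finally have "(l2_norm M (\<lambda>x. g x - u n x))\<^sup>2 \<le> ((1 / 2) ^ j)\<^sup>2" by simp
    then have "l2_norm M (\<lambda>x. g x - u n x) \<le> (1 / 2) ^ j" by (rule power2_le_imp_le) simp
    then show ?thesis by (simp add: l2_norm_diff_commute)
  qed
  have "l2_tendsto M u g sequentially"
    unfolding l2_tendsto_def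
  proof (rule LIMSEQ_I)
    fix e :: real assume "e > 0"
    then obtain j where j: "(1 / 2 :: real) ^ j < e" using real_arch_pow_inv[of e "1/2"] by auto
    have "norm (l2_norm M (\<lambda>x. u n x - g x) - 0) < e" if "n \<ge> N j" for n
      using le[OF that] j l2_norm_nonneg[of M "\<lambda>x. u n x - g x"] by simp
    then show "\<exists>no. \<forall>n\<ge>no. norm (l2_norm M (\<lambda>x. u n x - g x) - 0) < e" by blast
  qed
  with g show ?thesis by (rule that)
qed


section \<open>Increments of a semigroup\<close>

lemma markovian_semigroupD:
  assumes "markovian_semigroup M P"
  shows "\<And>t u. t > 0 \<Longrightarrow> u \<in> L2 M \<Longrightarrow> P t u \<in> L2 M"
    and "\<And>t u v a b. t > 0 \<Longrightarrow> u \<in> L2 M \<Longrightarrow> v \<in> L2 M \<Longrightarrow>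
      AE x in M. P t (\<lambda>y. a * u y + b * v y) x = a * P t u x + b * P t v x"
    and "\<And>t u. t > 0 \<Longrightarrow> u \<in> L2 M \<Longrightarrow> l2_norm M (P t u) \<le> l2_norm M u"
    and "\<And>s t u. s > 0 \<Longrightarrow> t > 0 \<Longrightarrow> u \<in> L2 M \<Longrightarrow> AE x in M. P (s + t) u x = P s (P t u) x"
  using assms by (simp_all add: markovian_semigroup_def)

text \<open>
  Write \<open>P\<^sub>2\<^sub>t u - u = P\<^sub>t (P\<^sub>t u - u) + (P\<^sub>t u - u)\<close> and use that \<open>P\<^sub>t\<close> is a contraction.
\<close>

lemma semigroup_increment_doubling:
  assumes P: "markovian_semigroup M P" and t: "t > 0" and u: "u \<in> L2 M"
  shows "l2_norm M (\<lambda>x. P (2 * t) u x - u x) \<le> 2 * l2_norm M (\<lambda>x. P t u x - u x)"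
proof -
  note D = markovian_semigroupD[OF P]
  have Pu: "P t u \<in> L2 M" "P (2 * t) u \<in> L2 M" using D(1) t u by auto
  have d: "(\<lambda>x. 1 * P t u x + (-1) * u x) \<in> L2 M" by (rule L2_lincomb[OF Pu(1) u])
  let ?d = "P t (\<lambda>x. 1 * P t u x + (-1) * u x)"
  have "AE x in M. P (2 * t) u x - u x = ?d x + (P t u x - u x)"
    using D(4)[OF t t u, folded mult_2] D(2)[OF t Pu(1) u, of 1 "-1"]
  proof eventually_elim
    case (elim x)
    show ?case unfolding elim by simp
  qed
  then have "l2_norm M (\<lambda>x. P (2 * t) u x - u x) = l2_norm M (\<lambda>x. ?d x + (P t u x - u x))"
    by (rule l2_norm_cong_AE; intro L2_D(1) L2_add L2_diff Pu u D(1)[OF t d])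
  also have "\<dots> \<le> l2_norm M ?d + l2_norm M (\<lambda>x. P t u x - u x)"
    by (intro l2_norm_triangle D(1)[OF t d] L2_diff Pu u)
  also have "l2_norm M ?d \<le> l2_norm M (\<lambda>x. P t u x - u x)"
    using D(3)[OF t d] by simp
  finally show ?thesis by simp
qed

text \<open>
  Iterating the doubling inequality bounds \<open>\<parallel>P\<^sub>t u - u\<parallel>\<close> by \<open>t\<close> times the norm of the difference
  quotient at time \<open>t / 2\<^sup>n\<close>, which converges to the generator applied to \<open>u\<close>.
\<close>

lemma semigroup_increment_le:
  assumes P: "markovian_semigroup M P" and gen: "(u, f) \<in> infinitesimal_generator M P" and t: "t > 0"
  shows "l2_norm M (\<lambda>x. P t u x - u x) \<le> t * l2_norm M f"
proof -
  from gen have u: "u \<in> L2 M" and f: "f \<in> L2 M"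
    and lim: "l2_tendsto M (\<lambda>t x. (P t u x - u x) / t) f (at_right 0)"
    by (auto simp: infinitesimal_generator_def)
  define h where "h n = t / 2 ^ n" for n :: nat
  have h: "h n > 0" for n using t by (simp add: h_def)
  have iter: "l2_norm M (\<lambda>x. P t u x - u x) \<le> 2 ^ n * l2_norm M (\<lambda>x. P (h n) u x - u x)" for n
  proof (induction n)
    case (Suc n)
    have "2 * h (Suc n) = h n" by (simp add: h_def)
    then have "2 ^ n * l2_norm M (\<lambda>x. P (h n) u x - u x) \<le> 2 ^ n * (2 * l2_norm M (\<lambda>x. P (h (Suc n)) u x - u x))"
      using semigroup_increment_doubling[OF P h[of "Suc n"] u] by (intro mult_left_mono) auto
    from order_trans[OF Suc this] show ?case by (simp add: mult.assoc mult.left_commute)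
  qed (simp add: h_def)
  have q: "(\<lambda>x. 1 / h n * (P (h n) u x - u x)) \<in> L2 M" for n
    by (intro L2_scale L2_diff markovian_semigroupD(1)[OF P h] u)
  have "h \<longlonglongrightarrow> 0" unfolding h_def[abs_def]
    using LIMSEQ_divide_realpow_zero[of 2 t] by simp
  then have "filterlim h (at_right 0) sequentially"
    by (rule tendsto_imp_filterlim_at_right) (auto intro!: always_eventually h)
  from filterlim_compose[OF lim[unfolded l2_tendsto_def] this]
  have "l2_tendsto M (\<lambda>n x. 1 / h n * (P (h n) u x - u x)) f sequentially"
    by (simp add: l2_tendsto_def)
  then have "(\<lambda>n. l2_norm M (\<lambda>x. 1 / h n * (P (h n) u x - u x))) \<longlonglongrightarrow> l2_norm M f"
    by (intro l2_norm_tendsto q f)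
  then have "(\<lambda>n. t * l2_norm M (\<lambda>x. 1 / h n * (P (h n) u x - u x))) \<longlonglongrightarrow> t * l2_norm M f"
    by (intro tendsto_mult tendsto_const)
  moreover have "t * l2_norm M (\<lambda>x. 1 / h n * (P (h n) u x - u x)) = 2 ^ n * l2_norm M (\<lambda>x. P (h n) u x - u x)" for n
    using t h[of n] unfolding l2_norm_scale by (simp add: h_def)
  ultimately show ?thesis using iter by (intro LIMSEQ_le_const) auto
qed


section \<open>The Dirichlet form of a locally bounded environment\<close>

locale loc_bounded_env =
  fixes w :: "real \<Rightarrow> real"
  assumes env_measurable [measurable]: "w \<in> borel_measurable borel"
    and loc_bounded: "\<And>R. \<exists>B. \<forall>x\<in>{-R..R}. \<bar>w x\<bar> \<le> B"
begin

abbreviation \<mu> :: "real measure" where "\<mu> \<equiv> env_measure w"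

lemma sets_env [measurable_cong]: "sets \<mu> = sets borel"
  and space_env [simp]: "space \<mu> = UNIV"
  by (simp_all add: env_measure_def)

lemma AE_env: "(AE x in \<mu>. P x) \<longleftrightarrow> (AE x in lborel. P x)"
  unfolding env_measure_def by (subst AE_density) auto

lemma integral_env:
  assumes [measurable]: "f \<in> borel_measurable borel"
  shows "(\<integral>x. f x \<partial>\<mu>) = (\<integral>x. f x * exp (- w x) \<partial>lborel)"
  and "integrable \<mu> f \<longleftrightarrow> integrable lborel (\<lambda>x. f x * exp (- w x))"
  unfolding env_measure_def
  by (subst integral_density integrable_density; simp add: mult.commute)+

lemma exp_loc_bounded:
  obtains B where "B > 0" "\<forall>x\<in>{a..b}. exp (- w x) \<le> B \<and> exp (w x) \<le> B"
proof -
  obtain B where B: "\<forall>x\<in>{-(\<bar>a\<bar> + \<bar>b\<bar>)..\<bar>a\<bar> + \<bar>b\<bar>}. \<bar>w x\<bar> \<le> B" using loc_bounded by blast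
  have "\<bar>w x\<bar> \<le> B" if "x \<in> {a..b}" for x
    using that by (intro B[rule_format]) auto
  then have "\<forall>x\<in>{a..b}. exp (- w x) \<le> exp B \<and> exp (w x) \<le> exp B" by force
  then show ?thesis by (intro that[of "exp B"]) auto
qed

lemma bounded_interval_L2:
  assumes [measurable]: "u \<in> borel_measurable borel"
    and "\<And>x. x \<in> {a..b} \<Longrightarrow> \<bar>u x\<bar> \<le> C" "\<And>x. x \<notin> {a..b} \<Longrightarrow> u x = 0"
  shows "u \<in> L2 \<mu>"
proof -
  obtain B where B: "B > 0" "\<forall>x\<in>{a..b}. exp (- w x) \<le> B \<and> exp (w x) \<le> B" by (rule exp_loc_bounded)
  have "integrable lborel (\<lambda>x. (u x)\<^sup>2 * exp (- w x))"
  proof (rule integrable_bounded_interval[of _ a b "C\<^sup>2 * B"])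
    fix x assume x: "x \<in> {a..b}"
    have "(u x)\<^sup>2 \<le> C\<^sup>2" using assms(2)[OF x] by (metis abs_ge_zero power2_abs power_mono)
    then show "\<bar>(u x)\<^sup>2 * exp (- w x)\<bar> \<le> C\<^sup>2 * B"
      using B x by (simp add: abs_mult) (intro mult_mono, auto)
  qed (use assms in auto)
  then show ?thesis unfolding L2_def by (simp add: integral_env(2))
qed

lemma test_L2: "u \<in> test_functions \<Longrightarrow> u \<in> L2 \<mu>"
proof -
  assume u: "u \<in> test_functions"
  obtain R where "R > 0" "\<forall>x. x \<notin> {-R..R} \<longrightarrow> u x = 0" by (rule test_function_support[OF u])
  moreover obtain B where "B > 0" "\<forall>x. \<bar>u x\<bar> \<le> B" by (rule test_bounded[OF u])
  ultimately show ?thesis by (intro bounded_interval_L2[of u "-R" R B] test_measurable[OF u]) auto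
qed

lemmas test_deriv_L2 = test_L2[OF test_deriv]

lemma pre_form_eq:
  assumes "u \<in> test_functions" "v \<in> test_functions"
  shows "pre_form w u v = 1 / 2 * l2_inner \<mu> (deriv u) (deriv v)"
  using test_measurable[OF test_deriv[OF assms(1)]] test_measurable[OF test_deriv[OF assms(2)]]
  by (simp add: pre_form_def l2_inner_def integral_env(1) del: times_divide_eq_left)

text \<open>
  The pairs of a function in the domain of the closed form and its weak derivative, defined as
  the closure of the graph of the derivative on test functions.
\<close>

definition gradient :: "(real \<Rightarrow> real) \<Rightarrow> (real \<Rightarrow> real) \<Rightarrow> bool" where
  "gradient u g \<longleftrightarrow> u \<in> L2 \<mu> \<and> g \<in> L2 \<mu> \<and>
     (\<exists>\<phi>. (\<forall>n. \<phi> n \<in> test_functions) \<and> l2_tendsto \<mu> \<phi> u sequentially \<and>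
          l2_tendsto \<mu> (\<lambda>n. deriv (\<phi> n)) g sequentially)"

lemma gradient_test: "u \<in> test_functions \<Longrightarrow> gradient u (deriv u)"
  unfolding gradient_def using test_L2 test_deriv_L2
  by (auto intro!: exI[of _ "\<lambda>_. u"] simp: l2_tendsto_def l2_norm_def l2_inner_def)

lemma l2_norm_deriv_diff_sq:
  assumes "u \<in> test_functions" "v \<in> test_functions"
  shows "pre_form w (\<lambda>x. u x - v x) (\<lambda>x. u x - v x)
    = 1 / 2 * (l2_norm \<mu> (\<lambda>x. deriv u x - deriv v x))\<^sup>2"
  using pre_form_eq[OF test_diff test_diff, OF assms assms] deriv_test_diff[OF assms]
  by (simp add: l2_norm_sq)

text \<open>
  The form of differences is half the squared distance of the derivatives, so the Cauchy
  condition is convergence of the derivatives in the complete space \<open>L\<^sup>2(\<mu>)\<close>.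
\<close>

lemma form_approx_iff:
  assumes "u \<in> L2 \<mu>"
  shows "form_approx w u \<phi> \<longleftrightarrow> (\<forall>n. \<phi> n \<in> test_functions) \<and> l2_tendsto \<mu> \<phi> u sequentially \<and>
    (\<exists>g\<in>L2 \<mu>. l2_tendsto \<mu> (\<lambda>n. deriv (\<phi> n)) g sequentially)"
proof -
  have "(\<forall>e>0. \<exists>N. \<forall>m\<ge>N. \<forall>n\<ge>N. pre_form w (\<lambda>x. \<phi> m x - \<phi> n x) (\<lambda>x. \<phi> m x - \<phi> n x) < e)
      \<longleftrightarrow> (\<exists>g\<in>L2 \<mu>. l2_tendsto \<mu> (\<lambda>n. deriv (\<phi> n)) g sequentially)"
    (is "?C \<longleftrightarrow> ?L") if t: "\<forall>n. \<phi> n \<in> test_functions"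
  proof -
    have D: "deriv (\<phi> n) \<in> L2 \<mu>" for n using t test_deriv_L2 by auto
    have P: "pre_form w (\<lambda>x. \<phi> m x - \<phi> n x) (\<lambda>x. \<phi> m x - \<phi> n x)
        = 1 / 2 * (l2_norm \<mu> (\<lambda>x. deriv (\<phi> m) x - deriv (\<phi> n) x))\<^sup>2" for m n
      using l2_norm_deriv_diff_sq t by auto
    show ?thesis
    proof
      assume C: ?C
      obtain g where "g \<in> L2 \<mu>" "l2_tendsto \<mu> (\<lambda>n. deriv (\<phi> n)) g sequentially"
      proof (rule l2_complete[OF D])
        fix e :: real assume "e > 0"
        with C have "\<exists>N. \<forall>m\<ge>N. \<forall>n\<ge>N.
            pre_form w (\<lambda>x. \<phi> m x - \<phi> n x) (\<lambda>x. \<phi> m x - \<phi> n x) < e\<^sup>2 / 2"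
          by (metis half_gt_zero zero_less_power)
        then obtain N where N: "\<And>m n. m \<ge> N \<Longrightarrow> n \<ge> N \<Longrightarrow>
            (l2_norm \<mu> (\<lambda>x. deriv (\<phi> m) x - deriv (\<phi> n) x))\<^sup>2 < e\<^sup>2" unfolding P by auto
        have "l2_norm \<mu> (\<lambda>x. deriv (\<phi> m) x - deriv (\<phi> n) x) < e" if "m \<ge> N" "n \<ge> N" for m n
          using N[OF that] \<open>e > 0\<close> by (auto intro: power2_less_imp_less)
        then show "\<exists>N. \<forall>m\<ge>N. \<forall>n\<ge>N. l2_norm \<mu> (\<lambda>x. deriv (\<phi> m) x - deriv (\<phi> n) x) < e" by blast
      qed
      then show ?L by blast
    next
      assume ?L
      then obtain g where g: "g \<in> L2 \<mu>" "l2_tendsto \<mu> (\<lambda>n. deriv (\<phi> n)) g sequentially" by auto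
      show ?C
      proof (intro allI impI)
        fix e :: real assume "e > 0"
        define d where "d = sqrt e / 2"
        have d: "d > 0" "4 * d\<^sup>2 = e" using \<open>e > 0\<close> by (auto simp: d_def power_divide)
        obtain N where N: "\<And>n. n \<ge> N \<Longrightarrow> l2_norm \<mu> (\<lambda>x. deriv (\<phi> n) x - g x) < d"
          using LIMSEQ_D[OF g(2)[unfolded l2_tendsto_def] d(1)] by (auto simp: l2_norm_nonneg)
        have "pre_form w (\<lambda>x. \<phi> m x - \<phi> n x) (\<lambda>x. \<phi> m x - \<phi> n x) < e" if "m \<ge> N" "n \<ge> N" for m n
        proof -
          have "l2_norm \<mu> (\<lambda>x. deriv (\<phi> m) x - deriv (\<phi> n) x) \<le> 2 * d"
            using l2_norm_triangle_diff[OF D g(1) D, of m n] N[OF that(1)] N[OF that(2)]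
              l2_norm_diff_commute[of \<mu> "deriv (\<phi> n)" g] by simp
          then have "(l2_norm \<mu> (\<lambda>x. deriv (\<phi> m) x - deriv (\<phi> n) x))\<^sup>2 \<le> (2 * d)\<^sup>2"
            by (intro power_mono l2_norm_nonneg)
          then show ?thesis using \<open>e > 0\<close> d(2) unfolding P by (simp add: power_mult_distrib)
        qed
        then show "\<exists>N. \<forall>m\<ge>N. \<forall>n\<ge>N. pre_form w (\<lambda>x. \<phi> m x - \<phi> n x) (\<lambda>x. \<phi> m x - \<phi> n x) < e" by blast
      qed
    qed
  qed
  then show ?thesis unfolding form_approx_def by blast
qed

lemma form_domain_iff: "u \<in> form_domain w \<longleftrightarrow> (\<exists>g. gradient u g)"
  unfolding form_domain_def gradient_def using form_approx_iff by blast

lemma integral_by_parts_test: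
  assumes "\<theta> \<in> test_functions" "\<phi> \<in> test_functions"
  shows "(\<integral>x. \<theta> x * deriv \<phi> x \<partial>lborel) = - (\<integral>x. deriv \<theta> x * \<phi> x \<partial>lborel)"
proof -
  obtain R where R: "R > 0" "\<forall>x. x \<notin> {-R..R} \<longrightarrow> \<theta> x = 0" by (rule test_function_support[OF assms(1)])
  have dR: "deriv \<theta> x = 0" if "x \<notin> {-R..R}" for x using deriv_zero_outside[of "-R" R \<theta> x] R that by blast
  have cont: "continuous_on S \<theta>" "continuous_on S \<phi>" "continuous_on S (deriv \<theta>)" "continuous_on S (deriv \<phi>)" for S
    using assms test_deriv by (auto intro!: smooth_continuous_on test_smooth)
  have bi: "integrable lborel f" if "continuous_on UNIV f" "\<And>x. x \<notin> {-R..R} \<Longrightarrow> f x = 0" for f :: "real \<Rightarrow> real"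
  proof -
    have "bounded (f ` {-R..R})"
      by (intro compact_imp_bounded compact_continuous_image continuous_on_subset[OF that(1)]) auto
    then obtain B where "\<forall>x\<in>{-R..R}. \<bar>f x\<bar> \<le> B" unfolding bounded_iff by auto
    then show ?thesis
      by (intro integrable_bounded_interval[of f "-R" R B] borel_measurable_continuous_onI that) auto
  qed
  have "(\<integral>x. indicator {-R - 1..R + 1} x *\<^sub>R (\<theta> x * deriv \<phi> x + deriv \<theta> x * \<phi> x) \<partial>lborel)
      = \<theta> (R + 1) * \<phi> (R + 1) - \<theta> (-R - 1) * \<phi> (-R - 1)"
  proof (rule integral_FTC_atLeastAtMost)
    show "((\<lambda>x. \<theta> x * \<phi> x) has_vector_derivative \<theta> x * deriv \<phi> x + deriv \<theta> x * \<phi> x)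
        (at x within {-R - 1..R + 1})" for x
      unfolding has_real_derivative_iff_has_vector_derivative[symmetric]
      by (rule has_field_derivative_at_within[OF DERIV_mult'[OF test_DERIV[OF assms(1)] test_DERIV[OF assms(2)]]])
  qed (use R cont in \<open>auto intro!: continuous_on_add continuous_on_mult\<close>)
  also have "\<dots> = 0" using R by simp
  also have "(\<lambda>x. indicator {-R - 1..R + 1} x *\<^sub>R (\<theta> x * deriv \<phi> x + deriv \<theta> x * \<phi> x))
      = (\<lambda>x. \<theta> x * deriv \<phi> x + deriv \<theta> x * \<phi> x)"
  proof
    fix x
    show "indicator {-R - 1..R + 1} x *\<^sub>R (\<theta> x * deriv \<phi> x + deriv \<theta> x * \<phi> x)
        = \<theta> x * deriv \<phi> x + deriv \<theta> x * \<phi> x"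
      using R dR[of x] by (cases "x \<in> {-R..R}") (auto simp: indicator_def)
  qed
  also have "(\<integral>x. \<theta> x * deriv \<phi> x + deriv \<theta> x * \<phi> x \<partial>lborel)
      = (\<integral>x. \<theta> x * deriv \<phi> x \<partial>lborel) + (\<integral>x. deriv \<theta> x * \<phi> x \<partial>lborel)"
    by (rule Bochner_Integration.integral_add; rule bi) (use R dR cont in \<open>auto intro!: continuous_on_mult\<close>)
  finally show ?thesis by simp
qed

text \<open>
  Multiplying by \<open>exp w\<close> cancels the density of \<open>\<mu>\<close>. In this way Lebesgue integrals against
  bounded functions of compact support become continuous functionals on \<open>L\<^sup>2(\<mu>)\<close>.
\<close>

lemma weight_inner:
  assumes [measurable]: "\<theta> \<in> borel_measurable borel" "v \<in> borel_measurable borel"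
  shows "l2_inner \<mu> (\<lambda>x. \<theta> x * exp (w x)) v = (\<integral>x. \<theta> x * v x \<partial>lborel)"
proof -
  have "\<theta> x * exp (w x) * v x * exp (- w x) = \<theta> x * v x * (exp (w x) * exp (- w x))" for x
    by (simp only: mult_ac)
  then have "\<theta> x * exp (w x) * v x * exp (- w x) = \<theta> x * v x" for x
    by (simp add: exp_minus_inverse)
  note eq = this
  have "l2_inner \<mu> (\<lambda>x. \<theta> x * exp (w x)) v = (\<integral>x. \<theta> x * exp (w x) * v x * exp (- w x) \<partial>lborel)"
    unfolding l2_inner_def by (rule integral_env(1)) measurable
  then show ?thesis by (simp only: eq)
qed

lemma weight_L2:
  assumes [measurable]: "\<theta> \<in> borel_measurable borel" and b: "\<And>x. \<bar>\<theta> x\<bar> \<le> C" and 0: "\<And>x. x \<notin> {a..b} \<Longrightarrow> \<theta> x = 0"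
  shows "(\<lambda>x. \<theta> x * exp (w x)) \<in> L2 \<mu>"
proof -
  obtain B where B: "B > 0" "\<forall>x\<in>{a..b}. exp (- w x) \<le> B \<and> exp (w x) \<le> B" by (rule exp_loc_bounded)
  show ?thesis
  proof (rule bounded_interval_L2[of _ a b "C * B"])
    fix x assume x: "x \<in> {a..b}"
    show "\<bar>\<theta> x * exp (w x)\<bar> \<le> C * B"
      unfolding abs_mult using B x b[of x] order_trans[OF abs_ge_zero b[of x]] by (intro mult_mono) auto
  qed (use 0 in auto)
qed

text \<open>
  Integration by parts in the limit gives \<open>\<integral> \<theta> k dx = 0\<close> for all test functions \<open>\<theta>\<close>. These
  approximate the sign of \<open>k\<close> on each bounded interval, so \<open>\<integral> \<bar>k\<bar> dx = 0\<close> there.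
\<close>

lemma closability:
  assumes \<phi>: "\<And>n. \<phi> n \<in> test_functions" and "l2_tendsto \<mu> \<phi> (\<lambda>x. 0) sequentially"
    and k: "k \<in> L2 \<mu>" and "l2_tendsto \<mu> (\<lambda>n. deriv (\<phi> n)) k sequentially"
  shows "AE x in lborel. k x = 0"
proof -
  have [measurable]: "k \<in> borel_measurable borel" using L2_D(1)[OF k] by simp
  have ortho: "(\<integral>x. \<theta> x * k x \<partial>lborel) = 0" if t: "\<theta> \<in> test_functions" for \<theta>
  proof -
    obtain R where R: "R > 0" "\<forall>x. x \<notin> {-R..R} \<longrightarrow> \<theta> x = 0" by (rule test_function_support[OF t])
    obtain B where B: "B > 0" "\<forall>x. \<bar>\<theta> x\<bar> \<le> B" by (rule test_bounded[OF t])
    obtain B' where B': "B' > 0" "\<forall>x. \<bar>deriv \<theta> x\<bar> \<le> B'" by (rule test_bounded[OF test_deriv[OF t]])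
    have L: "(\<lambda>x. \<theta> x * exp (w x)) \<in> L2 \<mu>"
      using R B by (intro weight_L2[of _ B "-R" R] test_measurable t) auto
    have L': "(\<lambda>x. deriv \<theta> x * exp (w x)) \<in> L2 \<mu>"
      using deriv_zero_outside[of "-R" R \<theta>] R B'
      by (intro weight_L2[of _ B' "-R" R] test_measurable test_deriv t) auto
    have "(\<lambda>n. l2_inner \<mu> (deriv (\<phi> n)) (\<lambda>x. \<theta> x * exp (w x))) \<longlonglongrightarrow> l2_inner \<mu> k (\<lambda>x. \<theta> x * exp (w x))"
      by (rule l2_inner_tendsto[OF test_deriv_L2[OF \<phi>] k L assms(4)])
    then have 1: "(\<lambda>n. \<integral>x. \<theta> x * deriv (\<phi> n) x \<partial>lborel) \<longlonglongrightarrow> (\<integral>x. \<theta> x * k x \<partial>lborel)"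
      using weight_inner[OF test_measurable[OF t] test_measurable[OF test_deriv[OF \<phi>]]]
        weight_inner[OF test_measurable[OF t], of k] by (simp add: l2_inner_commute)
    have "(\<lambda>n. l2_inner \<mu> (\<phi> n) (\<lambda>x. deriv \<theta> x * exp (w x))) \<longlonglongrightarrow> l2_inner \<mu> (\<lambda>x. 0) (\<lambda>x. deriv \<theta> x * exp (w x))"
      by (rule l2_inner_tendsto[OF test_L2[OF \<phi>] _ L' assms(2)]) (simp add: L2_def)
    then have "(\<lambda>n. \<integral>x. deriv \<theta> x * \<phi> n x \<partial>lborel) \<longlonglongrightarrow> 0"
      using weight_inner[OF test_measurable[OF test_deriv[OF t]] test_measurable[OF \<phi>]]
      by (simp add: l2_inner_commute[of _ "\<phi> _"]) (simp add: l2_inner_def)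
    then have "(\<lambda>n. \<integral>x. \<theta> x * deriv (\<phi> n) x \<partial>lborel) \<longlonglongrightarrow> - 0"
      unfolding integral_by_parts_test[OF t \<phi>] by (rule tendsto_minus)
    with 1 show ?thesis using LIMSEQ_unique by force
  qed
  have loc: "AE x in lborel. x \<in> {-real R..real R} \<longrightarrow> k x = 0" for R :: nat
  proof -
    \<comment> \<open>The integral of \<open>h k\<close> is the integral of \<open>\<bar>k\<bar>\<close> over the interval.\<close>
    define h where "h x = sgn (k x) * indicator {-real R..real R} x" for x
    have [measurable]: "h \<in> borel_measurable borel" unfolding h_def by measurable
    obtain \<theta> C where \<theta>: "\<And>n. \<theta> n \<in> test_functions" and \<theta>C: "\<And>n x. \<bar>\<theta> n x\<bar> \<le> C"
      and \<theta>0: "\<And>n x. x \<notin> {-real R - 1<..<real R + 1} \<Longrightarrow> \<theta> n x = 0"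
      and \<theta>h: "AE x in lborel. (\<lambda>n. \<theta> n x) \<longlonglongrightarrow> h x"
      by (rule approx_by_test_functions[of h 1 "-real R" "real R"])
         (auto simp: h_def indicator_def abs_sgn_eq)
    have [measurable]: "\<theta> n \<in> borel_measurable borel" for n by (rule test_measurable[OF \<theta>])
    have C0: "C \<ge> 0" using order_trans[OF abs_ge_zero \<theta>C[of 0 0]] .
    define c where "c x = C * indicator {-real R - 1..real R + 1} x" for x
    have [measurable]: "c \<in> borel_measurable borel" unfolding c_def by measurable
    have "(\<lambda>x. c x * exp (w x)) \<in> L2 \<mu>"
      by (rule weight_L2[of _ C "-real R - 1" "real R + 1"]) (use C0 in \<open>auto simp: c_def indicator_def\<close>)
    from L2_mult_integrable[OF this k] have "integrable lborel (\<lambda>x. c x * exp (w x) * k x * exp (- w x))"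
      by (subst (asm) integral_env(2)) auto
    moreover have "c x * exp (w x) * k x * exp (- w x) = c x * k x" for x by (simp add: exp_minus)
    ultimately have ck: "integrable lborel (\<lambda>x. c x * k x)" by simp
    have "(\<lambda>n. \<integral>x. \<theta> n x * k x \<partial>lborel) \<longlonglongrightarrow> (\<integral>x. h x * k x \<partial>lborel)"
    proof (rule integral_dominated_convergence[where w = "\<lambda>x. \<bar>c x * k x\<bar>"])
      show "AE x in lborel. (\<lambda>n. \<theta> n x * k x) \<longlonglongrightarrow> h x * k x"
        using \<theta>h by eventually_elim (intro tendsto_intros)
      show "AE x in lborel. norm (\<theta> n x * k x) \<le> \<bar>c x * k x\<bar>" for n
      proof (rule AE_I2)
        fix x
        have "\<bar>\<theta> n x\<bar> \<le> \<bar>c x\<bar>"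
          using \<theta>C[of n x] \<theta>0[of x n] C0 by (auto simp: c_def indicator_def)
        then show "norm (\<theta> n x * k x) \<le> \<bar>c x * k x\<bar>" by (simp add: abs_mult mult_right_mono)
      qed
    qed (use ck in auto)
    then have int: "(\<integral>x. h x * k x \<partial>lborel) = 0"
      using ortho[OF \<theta>] LIMSEQ_unique[OF _ tendsto_const] by simp
    have "AE x in lborel. h x * k x = 0"
    proof (rule integral_nonneg_eq_0_iff_AE[THEN iffD1, OF _ _ int])
      have hk: "h x * k x = \<bar>k x\<bar> * indicator {-real R..real R} x" for x
        by (auto simp: h_def indicator_def sgn_real_def)
      show "AE x in lborel. 0 \<le> h x * k x" by (simp add: hk)
      have "(\<lambda>x. h x * exp (w x)) \<in> L2 \<mu>"
        by (rule weight_L2[of h 1 "-real R" "real R"]) (auto simp: h_def indicator_def abs_sgn_eq)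
      from L2_mult_integrable[OF this k] have "integrable lborel (\<lambda>x. h x * exp (w x) * k x * exp (- w x))"
        by (subst (asm) integral_env(2)) auto
      moreover have "h x * exp (w x) * k x * exp (- w x) = h x * k x" for x by (simp add: exp_minus)
      ultimately show "integrable lborel (\<lambda>x. h x * k x)" by simp
    qed
    then show ?thesis by eventually_elim (auto simp: h_def indicator_def sgn_real_def split: if_splits)
  qed
  have "AE x in lborel. \<forall>R::nat. x \<in> {-real R..real R} \<longrightarrow> k x = 0"
    unfolding AE_all_countable using loc by blast
  then show ?thesis
  proof eventually_elim
    case (elim x)
    obtain R :: nat where "\<bar>x\<bar> \<le> real R" using real_arch_simple by blast
    then show ?case using elim[rule_format, of R] by (simp add: abs_le_iff)
  qed
qed



lemma gradient_L2: "gradient u g \<Longrightarrow> u \<in> L2 \<mu>" "gradient u g \<Longrightarrow> g \<in> L2 \<mu>"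
  by (simp_all add: gradient_def)

lemma gradient_unique:
  assumes "gradient u g" "gradient u h"
  shows "AE x in \<mu>. g x = h x"
proof -
  obtain \<phi> where \<phi>: "\<And>n. \<phi> n \<in> test_functions" "l2_tendsto \<mu> \<phi> u sequentially"
      "l2_tendsto \<mu> (\<lambda>n. deriv (\<phi> n)) g sequentially" using assms(1) by (auto simp: gradient_def)
  obtain \<psi> where \<psi>: "\<And>n. \<psi> n \<in> test_functions" "l2_tendsto \<mu> \<psi> u sequentially"
      "l2_tendsto \<mu> (\<lambda>n. deriv (\<psi> n)) h sequentially" using assms(2) by (auto simp: gradient_def)
  note L = gradient_L2[OF assms(1)] gradient_L2[OF assms(2)]
  have "AE x in lborel. g x - h x = 0"
  proof (rule closability)
    show "(\<lambda>x. \<phi> n x - \<psi> n x) \<in> test_functions" for n by (rule test_diff[OF \<phi>(1) \<psi>(1)])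
    show "l2_tendsto \<mu> (\<lambda>n x. \<phi> n x - \<psi> n x) (\<lambda>x. 0) sequentially"
      using l2_tendsto_diff[OF test_L2[OF \<phi>(1)] L(1) test_L2[OF \<psi>(1)] L(1) \<phi>(2) \<psi>(2)] by simp
    show "(\<lambda>x. g x - h x) \<in> L2 \<mu>" by (intro L2_diff L)
    show "l2_tendsto \<mu> (\<lambda>n. deriv (\<lambda>x. \<phi> n x - \<psi> n x)) (\<lambda>x. g x - h x) sequentially"
      using l2_tendsto_diff[OF test_deriv_L2[OF \<phi>(1)] L(2) test_deriv_L2[OF \<psi>(1)] L(4) \<phi>(3) \<psi>(3)]
      by (simp add: deriv_test_diff[OF \<phi>(1) \<psi>(1)])
  qed
  then show ?thesis by (simp add: AE_env)
qed

lemma form_approx_deriv_tendsto: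
  assumes "gradient u g" "form_approx w u \<phi>"
  shows "\<phi> n \<in> test_functions" "l2_tendsto \<mu> (\<lambda>n. deriv (\<phi> n)) g sequentially"
proof -
  note u = gradient_L2(1)[OF assms(1)]
  from assms(2) have t: "\<And>n. \<phi> n \<in> test_functions" unfolding form_approx_iff[OF u] by auto
  then show "\<phi> n \<in> test_functions" .
  from assms(2) obtain h where h: "h \<in> L2 \<mu>" "l2_tendsto \<mu> (\<lambda>n. deriv (\<phi> n)) h sequentially"
    unfolding form_approx_iff[OF u] by auto
  then have "gradient u h" using assms(2) u unfolding form_approx_iff[OF u] gradient_def by blast
  then have "AE x in \<mu>. h x = g x" using assms(1) by (rule gradient_unique)
  from l2_tendsto_cong_AE[OF test_deriv_L2 h(1) gradient_L2(2)[OF assms(1)] this h(2)] t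
  show "l2_tendsto \<mu> (\<lambda>n. deriv (\<phi> n)) g sequentially" by blast
qed

lemma gradient_form_approx:
  assumes "gradient u g" obtains \<phi> where "form_approx w u \<phi>"
  using assms form_approx_iff[OF gradient_L2(1)[OF assms]] unfolding gradient_def by blast

text \<open>
  Shows in particular that the definite description in the definition of the closed form
  denotes: all approximating sequences of a function have the same limit of derivatives.
\<close>

lemma closed_form_eq:
  assumes u: "gradient u g" and v: "gradient v h"
  shows "closed_form w u v = 1 / 2 * l2_inner \<mu> g h"
proof -
  have lim: "(\<lambda>n. pre_form w (\<phi> n) (\<psi> n)) \<longlonglongrightarrow> 1 / 2 * l2_inner \<mu> g h"
    if "form_approx w u \<phi>" "form_approx w v \<psi>" for \<phi> \<psi>
  proof -
    note a = form_approx_deriv_tendsto[OF u that(1)] and b = form_approx_deriv_tendsto[OF v that(2)]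
    show ?thesis unfolding pre_form_eq[OF a(1) b(1)]
      by (intro tendsto_mult tendsto_const l2_inner_tendsto2 test_deriv_L2 a b gradient_L2[OF u] gradient_L2[OF v])
  qed
  obtain \<phi> where \<phi>: "form_approx w u \<phi>" by (rule gradient_form_approx[OF u])
  obtain \<psi> where \<psi>: "form_approx w v \<psi>" by (rule gradient_form_approx[OF v])
  show ?thesis
    unfolding closed_form_def
  proof (rule the_equality)
    fix r assume "\<forall>\<phi> \<psi>. form_approx w u \<phi> \<longrightarrow> form_approx w v \<psi> \<longrightarrow> (\<lambda>n. pre_form w (\<phi> n) (\<psi> n)) \<longlonglongrightarrow> r"
    then show "r = 1 / 2 * l2_inner \<mu> g h" using \<phi> \<psi> lim[OF \<phi> \<psi>] LIMSEQ_unique by blast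
  qed (use lim in blast)
qed

lemma neg_form_generator_iff:
  "(u, F) \<in> neg_form_generator w \<longleftrightarrow> u \<in> form_domain w \<and> F \<in> L2 \<mu> \<and>
     (\<forall>v\<in>form_domain w. closed_form w u v = l2_inner \<mu> F v)"
proof -
  have "(u, F) \<in> neg_form_generator w \<longleftrightarrow> (u, \<lambda>x. - F x) \<in> form_generator w"
    unfolding neg_form_generator_def by force
  moreover have "(\<lambda>x. - F x) \<in> L2 \<mu> \<longleftrightarrow> F \<in> L2 \<mu>"
    using L2_scale[of F \<mu> "-1"] L2_scale[of "\<lambda>x. - F x" \<mu> "-1"] by auto
  ultimately show ?thesis by (simp add: form_generator_def)
qed


section \<open>The resolvent\<close>

text \<open>
  Solves \<open>(c - L) u = c f\<close>. The solution minimises \<open>1/2 \<parallel>u'\<parallel>\<^sup>2 + c \<parallel>u - f\<parallel>\<^sup>2\<close>: the parallelogram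
  identity makes every minimising sequence of test functions Cauchy together with its
  derivatives, and the vanishing of the first variation at the limit is the equation.
\<close>

lemma resolvent_solution:
  assumes c: "c > 0" and f: "f \<in> L2 \<mu>"
  obtains u where "(u, \<lambda>x. c * (f x - u x)) \<in> neg_form_generator w"
proof -
  \<comment> \<open>The functional to be minimised; its infimum need not be attained by a test function.\<close>
  define J where "J \<phi> = 1 / 2 * (l2_norm \<mu> (deriv \<phi>))\<^sup>2 + c * (l2_norm \<mu> (\<lambda>x. \<phi> x - f x))\<^sup>2" for \<phi>
  have J0: "0 \<le> J \<phi>" for \<phi> using c by (simp add: J_def)
  define I where "I = (INF \<phi>\<in>test_functions. J \<phi>)"
  have bdd: "bdd_below (J ` test_functions)" using J0 by (intro bdd_belowI2[of _ 0])
  have I_le: "I \<le> J \<phi>" if "\<phi> \<in> test_functions" for \<phi> unfolding I_def by (rule cINF_lower[OF bdd that])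
  have ne: "test_functions \<noteq> {}" using test_functionI[OF smooth_const[of 0]] by blast
  have "\<exists>\<phi>\<in>test_functions. J \<phi> < I + 1 / real (Suc n)" for n
    unfolding I_def by (rule cINF_less_iff[OF ne bdd, THEN iffD1]) simp
  then obtain \<phi> where \<phi>: "\<And>n. \<phi> n \<in> test_functions" and J\<phi>: "\<And>n. J (\<phi> n) < I + 1 / real (Suc n)" by metis
  note L = test_L2[OF \<phi>] and D = test_deriv_L2[OF \<phi>]
  have par: "1 / 2 * (l2_norm \<mu> (\<lambda>x. deriv (\<phi> m) x - deriv (\<phi> n) x))\<^sup>2 + c * (l2_norm \<mu> (\<lambda>x. \<phi> m x - \<phi> n x))\<^sup>2
      \<le> 2 * (J (\<phi> m) - I) + 2 * (J (\<phi> n) - I)" for m n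
  proof -
    \<comment> \<open>The parallelogram identity, applied to the derivatives and to the distances from \<open>f\<close>.\<close>
    have P: "4 * (l2_norm \<mu> (\<lambda>x. 1 / 2 * a x + 1 / 2 * b x))\<^sup>2 + (l2_norm \<mu> (\<lambda>x. a x - b x))\<^sup>2
        = 2 * (l2_norm \<mu> a)\<^sup>2 + 2 * (l2_norm \<mu> b)\<^sup>2" if "a \<in> L2 \<mu>" "b \<in> L2 \<mu>" for a b
      using l2_norm_sq_lincomb[OF that, of "1 / 2" "1 / 2"] l2_norm_sq_lincomb[OF that, of 1 "-1"]
      by (simp add: power2_eq_square)
    have comb: "4 * (1 / 2 * p + c * p') + (1 / 2 * q + c * q') = 2 * (1 / 2 * r + c * r') + 2 * (1 / 2 * s + c * s')"
      if "4 * p + q = 2 * r + 2 * s" "4 * p' + q' = 2 * r' + 2 * s'" for p q r s p' q' r' s' :: real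
    proof -
      have "c * (4 * p' + q') = c * (2 * r' + 2 * s')" using that(2) by simp
      then show ?thesis using that(1) by (simp add: algebra_simps)
    qed
    define \<zeta> where "\<zeta> x = 1 / 2 * \<phi> m x + 1 / 2 * \<phi> n x" for x
    have "\<zeta> \<in> test_functions" "deriv \<zeta> = (\<lambda>x. 1 / 2 * deriv (\<phi> m) x + 1 / 2 * deriv (\<phi> n) x)"
      unfolding \<zeta>_def by (intro test_lincomb deriv_test_lincomb \<phi>)+
    moreover have "(\<lambda>x. \<zeta> x - f x) = (\<lambda>x. 1 / 2 * (\<phi> m x - f x) + 1 / 2 * (\<phi> n x - f x))"
      by (simp add: \<zeta>_def fun_eq_iff field_simps)
    moreover have "(\<lambda>x. (\<phi> m x - f x) - (\<phi> n x - f x)) = (\<lambda>x. \<phi> m x - \<phi> n x)" by simp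
    ultimately have "4 * J \<zeta> + (1 / 2 * (l2_norm \<mu> (\<lambda>x. deriv (\<phi> m) x - deriv (\<phi> n) x))\<^sup>2
        + c * (l2_norm \<mu> (\<lambda>x. \<phi> m x - \<phi> n x))\<^sup>2) = 2 * J (\<phi> m) + 2 * J (\<phi> n)"
      using P[OF D D, of m n] P[OF L2_diff[OF L f] L2_diff[OF L f], of m n]
      unfolding J_def by (simp only: comb)
    moreover have "I \<le> J \<zeta>" by (intro I_le) fact
    moreover have "z \<le> 2 * (p - i) + 2 * (q - i)" if "4 * a + z = 2 * p + 2 * q" "i \<le> a" for a z p q i :: real
      using that by simp
    ultimately show ?thesis by blast
  qed
  have par': "1 / 2 * (l2_norm \<mu> (\<lambda>x. deriv (\<phi> m) x - deriv (\<phi> n) x))\<^sup>2 + c * (l2_norm \<mu> (\<lambda>x. \<phi> m x - \<phi> n x))\<^sup>2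
      < 4 / real (Suc N)" if "m \<ge> N" "n \<ge> N" for m n N
  proof -
    have "1 / real (Suc m) \<le> 1 / real (Suc N)" "1 / real (Suc n) \<le> 1 / real (Suc N)"
      using that by (auto simp: field_simps)
    then show ?thesis using par[of m n] J\<phi>[of m] J\<phi>[of n] by simp
  qed
  have small: "\<exists>N. 4 / real (Suc N) < e" if "e > 0" for e :: real
    using reals_Archimedean[of "e / 4"] that by (auto simp: field_simps)
  obtain g where g: "g \<in> L2 \<mu>" "l2_tendsto \<mu> (\<lambda>n. deriv (\<phi> n)) g sequentially"
  proof (rule l2_complete[OF D])
    fix e :: real assume "e > 0"
    then obtain N where N: "4 / real (Suc N) < e\<^sup>2 / 2" using small[of "e\<^sup>2 / 2"] by auto
    have "l2_norm \<mu> (\<lambda>x. deriv (\<phi> m) x - deriv (\<phi> n) x) < e" if "m \<ge> N" "n \<ge> N" for m n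
    proof (rule power2_less_imp_less)
      have "0 \<le> c * (l2_norm \<mu> (\<lambda>x. \<phi> m x - \<phi> n x))\<^sup>2" using c by simp
      then show "(l2_norm \<mu> (\<lambda>x. deriv (\<phi> m) x - deriv (\<phi> n) x))\<^sup>2 < e\<^sup>2" using par'[OF that] N by linarith
    qed (use \<open>e > 0\<close> in simp)
    then show "\<exists>N. \<forall>m\<ge>N. \<forall>n\<ge>N. l2_norm \<mu> (\<lambda>x. deriv (\<phi> m) x - deriv (\<phi> n) x) < e" by blast
  qed
  obtain u where u: "u \<in> L2 \<mu>" "l2_tendsto \<mu> \<phi> u sequentially"
  proof (rule l2_complete[OF L])
    fix e :: real assume "e > 0"
    then obtain N where N: "4 / real (Suc N) < c * e\<^sup>2" using small[of "c * e\<^sup>2"] c by auto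
    have "l2_norm \<mu> (\<lambda>x. \<phi> m x - \<phi> n x) < e" if "m \<ge> N" "n \<ge> N" for m n
    proof (rule power2_less_imp_less)
      have "0 \<le> 1 / 2 * (l2_norm \<mu> (\<lambda>x. deriv (\<phi> m) x - deriv (\<phi> n) x))\<^sup>2" by simp
      then have "c * (l2_norm \<mu> (\<lambda>x. \<phi> m x - \<phi> n x))\<^sup>2 < c * e\<^sup>2" using par'[OF that] N by linarith
      then show "(l2_norm \<mu> (\<lambda>x. \<phi> m x - \<phi> n x))\<^sup>2 < e\<^sup>2" using c by simp
    qed (use \<open>e > 0\<close> in simp)
    then show "\<exists>N. \<forall>m\<ge>N. \<forall>n\<ge>N. l2_norm \<mu> (\<lambda>x. \<phi> m x - \<phi> n x) < e" by blast
  qed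
  have grad: "gradient u g" unfolding gradient_def using u g \<phi> by blast
  have JI: "(\<lambda>n. J (\<phi> n)) \<longlonglongrightarrow> I"
  proof (rule tendsto_sandwich[of "\<lambda>_. I" _ _ "\<lambda>n. I + 1 / real (Suc n)"])
    show "(\<lambda>n. I + 1 / real (Suc n)) \<longlonglongrightarrow> I"
      using tendsto_add[OF tendsto_const LIMSEQ_inverse_real_of_nat, of I] by (simp add: inverse_eq_divide)
  qed (use I_le[OF \<phi>] J\<phi> in \<open>auto intro!: always_eventually less_imp_le\<close>)
  have test_eq: "1 / 2 * l2_inner \<mu> g (deriv v) + c * l2_inner \<mu> (\<lambda>x. u x - f x) v = 0"
    if v: "v \<in> test_functions" for v
  proof -
    define B where "B n = 1 / 2 * l2_inner \<mu> (deriv (\<phi> n)) (deriv v) + c * l2_inner \<mu> (\<lambda>x. \<phi> n x - f x) v" for n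
    define C where "C = 1 / 2 * (l2_norm \<mu> (deriv v))\<^sup>2 + c * (l2_norm \<mu> v)\<^sup>2"
    let ?B = "1 / 2 * l2_inner \<mu> g (deriv v) + c * l2_inner \<mu> (\<lambda>x. u x - f x) v"
    have expand: "J (\<lambda>x. 1 * \<phi> n x + t * v x) = J (\<phi> n) + 2 * t * B n + t\<^sup>2 * C" for n t
    proof -
      have "(\<lambda>x. 1 * \<phi> n x + t * v x - f x) = (\<lambda>x. 1 * (\<phi> n x - f x) + t * v x)" by (simp add: fun_eq_iff)
      then show ?thesis
        using l2_norm_sq_lincomb[OF D test_deriv_L2[OF v], of 1 n t]
          l2_norm_sq_lincomb[OF L2_diff[OF L f] test_L2[OF v], of 1 n t]
        unfolding J_def B_def C_def deriv_test_lincomb[OF \<phi> v] by (simp only:) (simp add: algebra_simps)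
    qed
    have "B \<longlonglongrightarrow> ?B"
    proof -
      have "(\<lambda>n. l2_inner \<mu> (\<phi> n) v - l2_inner \<mu> f v) \<longlonglongrightarrow> l2_inner \<mu> u v - l2_inner \<mu> f v"
        by (intro tendsto_diff tendsto_const l2_inner_tendsto L u test_L2[OF v])
      then have "(\<lambda>n. l2_inner \<mu> (\<lambda>x. \<phi> n x - f x) v) \<longlonglongrightarrow> l2_inner \<mu> (\<lambda>x. u x - f x) v"
        using l2_inner_diff[OF L f test_L2[OF v]] l2_inner_diff[OF u(1) f test_L2[OF v]] by simp
      moreover have "(\<lambda>n. l2_inner \<mu> (deriv (\<phi> n)) (deriv v)) \<longlonglongrightarrow> l2_inner \<mu> g (deriv v)"
        by (rule l2_inner_tendsto[OF D g(1) test_deriv_L2[OF v] g(2)])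
      ultimately show ?thesis unfolding B_def[abs_def] by (intro tendsto_add tendsto_mult tendsto_const)
    qed
    then have lim: "(\<lambda>n. J (\<phi> n) + 2 * t * B n + t\<^sup>2 * C) \<longlonglongrightarrow> I + 2 * t * ?B + t\<^sup>2 * C" for t
      by (intro tendsto_add tendsto_mult tendsto_const JI)
    have le: "I \<le> J (\<phi> n) + 2 * t * B n + t\<^sup>2 * C" for t n
      using I_le[OF test_lincomb[OF \<phi> v], of 1 n t] expand[of n t] by simp
    have "I \<le> I + 2 * t * ?B + t\<^sup>2 * C" for t
      by (rule LIMSEQ_le_const[OF lim]) (use le in blast)
    \<comment> \<open>A quadratic in \<open>t\<close> without constant term is nonnegative only if its linear term vanishes.\<close>
    then have "?B\<^sup>2 \<le> 0 * C" by (intro quadratic_discriminant_bound) (simp add: algebra_simps)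
    then show ?thesis by simp
  qed
  have "closed_form w u v = l2_inner \<mu> (\<lambda>x. c * (f x - u x)) v" if "v \<in> form_domain w" for v
  proof -
    from that obtain h where h: "gradient v h" unfolding form_domain_iff by blast
    obtain \<psi> where \<psi>: "\<And>n. \<psi> n \<in> test_functions" "l2_tendsto \<mu> \<psi> v sequentially"
      "l2_tendsto \<mu> (\<lambda>n. deriv (\<psi> n)) h sequentially" using h by (auto simp: gradient_def)
    have "(\<lambda>n. 1 / 2 * l2_inner \<mu> (deriv (\<psi> n)) g + c * l2_inner \<mu> (\<psi> n) (\<lambda>x. u x - f x)) \<longlonglongrightarrow>
        1 / 2 * l2_inner \<mu> h g + c * l2_inner \<mu> v (\<lambda>x. u x - f x)"
      using l2_inner_tendsto[OF test_deriv_L2[OF \<psi>(1)] gradient_L2(2)[OF h] g(1) \<psi>(3)]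
        l2_inner_tendsto[OF test_L2[OF \<psi>(1)] gradient_L2(1)[OF h] L2_diff[OF u(1) f] \<psi>(2)]
      by (intro tendsto_add tendsto_mult tendsto_const)
    moreover have "1 / 2 * l2_inner \<mu> (deriv (\<psi> n)) g + c * l2_inner \<mu> (\<psi> n) (\<lambda>x. u x - f x) = 0" for n
      using test_eq[OF \<psi>(1)] by (simp add: l2_inner_commute)
    ultimately have "1 / 2 * l2_inner \<mu> h g + c * l2_inner \<mu> v (\<lambda>x. u x - f x) = 0"
      using LIMSEQ_unique[OF _ tendsto_const] by simp
    then have "1 / 2 * l2_inner \<mu> g h = - c * l2_inner \<mu> (\<lambda>x. u x - f x) v"
      by (simp add: l2_inner_commute)
    also have "\<dots> = l2_inner \<mu> (\<lambda>x. c * f x + (- c) * u x) v"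
      unfolding l2_inner_lincomb[OF f u(1) gradient_L2(1)[OF h]] l2_inner_diff[OF u(1) f gradient_L2(1)[OF h]]
      by (simp add: algebra_simps)
    also have "(\<lambda>x. c * f x + (- c) * u x) = (\<lambda>x. c * (f x - u x))" by (simp add: fun_eq_iff algebra_simps)
    finally show ?thesis by (simp add: closed_form_eq[OF grad h])
  qed
  moreover have "u \<in> form_domain w" using grad form_domain_iff by blast
  moreover have "(\<lambda>x. c * (f x - u x)) \<in> L2 \<mu>" by (intro L2_scale L2_diff u f)
  ultimately show ?thesis by (intro that[of u]) (simp add: neg_form_generator_iff)
qed


lemma neg_form_generator_gradient:
  assumes "(u, F) \<in> neg_form_generator w"
  obtains g where "gradient u g" "F \<in> L2 \<mu>"
    "\<forall>v h. gradient v h \<longrightarrow> 1 / 2 * l2_inner \<mu> g h = l2_inner \<mu> F v"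
proof -
  from assms obtain g where g: "gradient u g" using neg_form_generator_iff form_domain_iff by blast
  have "1 / 2 * l2_inner \<mu> g h = l2_inner \<mu> F v" if "gradient v h" for v h
    using assms that closed_form_eq[OF g that] unfolding neg_form_generator_iff
    using form_domain_iff by metis
  with g show ?thesis using that assms neg_form_generator_iff by blast
qed

text \<open>
  Nonnegativity of the form gives \<open>- r \<parallel>u\<parallel>\<^sup>2 \<le> \<langle>F - r u, u\<rangle>\<close> for \<open>F = - L u\<close>, which bounds the
  inverse.
\<close>

lemma negative_in_resolvent_set:
  assumes "r < 0"
  shows "r \<in> resolvent_set \<mu> (neg_form_generator w)"
proof -
  have "\<exists>(u, F)\<in>neg_form_generator w. AE x in \<mu>. F x - r * u x = f x" if f: "f \<in> L2 \<mu>" for f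
  proof -
    obtain u where u: "(u, \<lambda>x. - r * (- (1 / r) * f x - u x)) \<in> neg_form_generator w"
      by (rule resolvent_solution[OF _ L2_scale[OF f], of "- r" "- (1 / r)"]) (use assms in auto)
    have "- r * (- (1 / r) * f x - u x) - r * u x = f x" for x
      using assms by (simp add: field_simps)
    then show ?thesis by (intro bexI[OF _ u]) simp
  qed
  moreover have "l2_norm \<mu> u \<le> - (1 / r) * l2_norm \<mu> (\<lambda>x. F x - r * u x)" if uF: "(u, F) \<in> neg_form_generator w" for u F
  proof -
    obtain g where g: "gradient u g" "F \<in> L2 \<mu>"
      "\<forall>v h. gradient v h \<longrightarrow> 1 / 2 * l2_inner \<mu> g h = l2_inner \<mu> F v"
      by (rule neg_form_generator_gradient[OF uF])
    note u = gradient_L2(1)[OF g(1)]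
    have FL: "(\<lambda>x. F x - r * u x) \<in> L2 \<mu>" by (intro L2_diff L2_scale g u)
    have "0 \<le> l2_inner \<mu> F u" using g(3)[rule_format, OF g(1)] l2_inner_self_nonneg[of \<mu> g] by simp
    moreover have "l2_inner \<mu> (\<lambda>x. 1 * F x + (- r) * u x) u = 1 * l2_inner \<mu> F u + (- r) * l2_inner \<mu> u u"
      by (rule l2_inner_lincomb[OF g(2) u u])
    ultimately have "- r * (l2_norm \<mu> u)\<^sup>2 \<le> l2_inner \<mu> (\<lambda>x. F x - r * u x) u" by (simp add: l2_norm_sq)
    also have "\<dots> \<le> l2_norm \<mu> (\<lambda>x. F x - r * u x) * l2_norm \<mu> u"
      using l2_cauchy_schwarz[OF FL u] by simp
    finally have *: "- r * l2_norm \<mu> u * l2_norm \<mu> u \<le> l2_norm \<mu> (\<lambda>x. F x - r * u x) * l2_norm \<mu> u"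
      by (simp add: power2_eq_square)
    show ?thesis
    proof (cases "l2_norm \<mu> u = 0")
      case True
      then show ?thesis using assms by (simp add: l2_norm_nonneg divide_nonneg_neg divide_nonpos_neg)
    next
      case False
      then have "l2_norm \<mu> u > 0" using l2_norm_nonneg[of \<mu> u] by simp
      with * have "- r * l2_norm \<mu> u \<le> l2_norm \<mu> (\<lambda>x. F x - r * u x)" by (rule mult_right_le_imp_le)
      then show ?thesis using assms by (simp add: field_simps)
    qed
  qed
  ultimately show ?thesis unfolding resolvent_set_def by blast
qed

text \<open>
  For \<open>u = c (c - L)\<^sup>-\<^sup>1 \<phi>\<close> one has \<open>- L u = c (\<phi> - u)\<close>. Testing this equation with \<open>\<phi> - u\<close>
  bounds \<open>c \<parallel>\<phi> - u\<parallel>\<^sup>2\<close> by the energy of \<open>\<phi>\<close>. Thus \<open>\<phi>\<close> is moved into the domain of the operator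
  at a cost controlled by its energy.
\<close>

lemma resolvent_approximation:
  assumes \<phi>: "\<phi> \<in> test_functions" and c: "c > 0"
  obtains u F where "(u, F) \<in> neg_form_generator w" "c * (l2_norm \<mu> (\<lambda>x. \<phi> x - u x))\<^sup>2 \<le> pre_form w \<phi> \<phi>"
    "(l2_norm \<mu> F)\<^sup>2 \<le> c * pre_form w \<phi> \<phi>"
proof -
  obtain u where uF: "(u, \<lambda>x. c * (\<phi> x - u x)) \<in> neg_form_generator w"
    by (rule resolvent_solution[OF c test_L2[OF \<phi>]])
  obtain g where g: "gradient u g" "(\<lambda>x. c * (\<phi> x - u x)) \<in> L2 \<mu>"
    "\<forall>v h. gradient v h \<longrightarrow> 1 / 2 * l2_inner \<mu> g h = l2_inner \<mu> (\<lambda>x. c * (\<phi> x - u x)) v"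
    by (rule neg_form_generator_gradient[OF uF])
  note L = gradient_L2[OF g(1)] test_L2[OF \<phi>] test_deriv_L2[OF \<phi>]
  have d: "(\<lambda>x. \<phi> x - u x) \<in> L2 \<mu>" by (intro L2_diff L)
  have inner: "l2_inner \<mu> (\<lambda>x. c * (\<phi> x - u x)) v = c * l2_inner \<mu> (\<lambda>x. \<phi> x - u x) v" if "v \<in> L2 \<mu>" for v
    using l2_inner_lincomb[OF d d that, of c 0] by simp
  have "c * (l2_norm \<mu> (\<lambda>x. \<phi> x - u x))\<^sup>2
      = c * (l2_inner \<mu> (\<lambda>x. \<phi> x - u x) \<phi> - l2_inner \<mu> (\<lambda>x. \<phi> x - u x) u)"
    using l2_inner_diff[OF L(3) L(1) d] by (simp add: l2_norm_sq l2_inner_commute)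
  also have "\<dots> = 1 / 2 * l2_inner \<mu> g (deriv \<phi>) - 1 / 2 * l2_inner \<mu> g g"
    using g(3)[rule_format, OF g(1)] g(3)[rule_format, OF gradient_test[OF \<phi>]] inner[OF L(1)] inner[OF L(3)]
    by (simp only: right_diff_distrib)
  also have "\<dots> \<le> pre_form w \<phi> \<phi>"
  proof -
    have "0 \<le> (l2_norm \<mu> (\<lambda>x. 1 * g x + (-1) * deriv \<phi> x))\<^sup>2" by simp
    also have "\<dots> = l2_inner \<mu> g g - 2 * l2_inner \<mu> g (deriv \<phi>) + l2_inner \<mu> (deriv \<phi>) (deriv \<phi>)"
      unfolding l2_norm_sq_lincomb[OF L(2,4)] by (simp add: l2_norm_sq)
    finally show ?thesis
      using l2_inner_self_nonneg[of \<mu> g] l2_inner_self_nonneg[of \<mu> "deriv \<phi>"]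
      unfolding pre_form_eq[OF \<phi> \<phi>] by linarith
  qed
  finally have 1: "c * (l2_norm \<mu> (\<lambda>x. \<phi> x - u x))\<^sup>2 \<le> pre_form w \<phi> \<phi>" .
  have "(l2_norm \<mu> (\<lambda>x. c * (\<phi> x - u x)))\<^sup>2 = c * (c * (l2_norm \<mu> (\<lambda>x. \<phi> x - u x))\<^sup>2)"
    unfolding l2_norm_scale by (simp add: power2_eq_square)
  also have "\<dots> \<le> c * pre_form w \<phi> \<phi>" using 1 c by (intro mult_left_mono) auto
  finally show ?thesis by (rule that[OF uF 1])
qed


section \<open>Infinite mass and test functions of low energy\<close>

text \<open>
  The increments \<open>\<phi>\<^sub>n(y) - \<phi>\<^sub>n(x) = \<integral> \<phi>\<^sub>n'\<close> of the approximating test functions tend to 0 while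
  a subsequence converges to \<open>u\<close> almost everywhere, so \<open>u\<close> is constant. A nonzero constant is
  not square integrable because the mass is infinite.
\<close>

lemma zero_gradient_imp_zero:
  assumes mass: "(\<integral>\<^sup>+x. ennreal (exp (- w x)) \<partial>lborel) = \<infinity>"
    and "gradient u (\<lambda>x. 0)"
  shows "AE x in \<mu>. u x = 0"
proof -
  obtain \<phi> where \<phi>: "\<And>n. \<phi> n \<in> test_functions" "l2_tendsto \<mu> \<phi> u sequentially"
      "l2_tendsto \<mu> (\<lambda>n. deriv (\<phi> n)) (\<lambda>x. 0) sequentially" using assms(2) by (auto simp: gradient_def)
  note u = gradient_L2(1)[OF assms(2)] and z = gradient_L2(2)[OF assms(2)]
  have "(\<lambda>n. (l2_norm \<mu> (\<lambda>x. \<phi> n x - u x))\<^sup>2) \<longlonglongrightarrow> 0\<^sup>2"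
    using \<phi>(2) unfolding l2_tendsto_def by (intro tendsto_power)
  then have "(\<lambda>n. \<integral>x. norm ((\<phi> n x - u x)\<^sup>2) \<partial>\<mu>) \<longlonglongrightarrow> 0"
    by (simp add: l2_norm_sq) (simp add: l2_inner_def power2_eq_square)
  then have "\<exists>r::nat\<Rightarrow>nat. strict_mono r \<and> (AE x in \<mu>. (\<lambda>n. (\<phi> (r n) x - u x)\<^sup>2) \<longlonglongrightarrow> 0)"
    by (intro tendsto_L1_AE_subseq L2_D(2) L2_diff test_L2 \<phi>(1) u)
  then obtain r :: "nat \<Rightarrow> nat" where r: "strict_mono r"
    and ae: "AE x in \<mu>. (\<lambda>n. (\<phi> (r n) x - u x)\<^sup>2) \<longlonglongrightarrow> 0" by blast
  define G where "G = {x. (\<lambda>n. \<phi> (r n) x) \<longlonglongrightarrow> u x}"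
  have G: "AE x in \<mu>. x \<in> G"
    using ae
  proof eventually_elim
    case (elim x)
    then have "(\<lambda>n. sqrt ((\<phi> (r n) x - u x)\<^sup>2)) \<longlonglongrightarrow> sqrt 0" by (intro tendsto_real_sqrt)
    then have "(\<lambda>n. \<phi> (r n) x - u x) \<longlonglongrightarrow> 0" by (simp add: tendsto_rabs_zero_iff)
    then show ?case by (simp add: G_def LIM_zero_iff)
  qed
  \<comment> \<open>Increments are continuous functionals of the derivative in \<open>L\<^sup>2(\<mu>)\<close>, so they tend to 0.\<close>
  have inc: "(\<lambda>n. \<phi> n y - \<phi> n x) \<longlonglongrightarrow> 0" if "x \<le> y" for x y
  proof -
    have "\<phi> n y - \<phi> n x = l2_inner \<mu> (deriv (\<phi> n)) (\<lambda>t. indicator {x..y} t * exp (w t))" for n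
    proof -
      have "(\<integral>t. indicator {x..y} t *\<^sub>R deriv (\<phi> n) t \<partial>lborel) = \<phi> n y - \<phi> n x"
      proof (rule integral_FTC_atLeastAtMost[OF that])
        show "(\<phi> n has_vector_derivative deriv (\<phi> n) t) (at t within {x..y})" for t
          using has_field_derivative_at_within[OF test_DERIV[OF \<phi>(1)]]
          by (simp add: has_real_derivative_iff_has_vector_derivative)
        show "continuous_on {x..y} (deriv (\<phi> n))"
          by (rule smooth_continuous_on[OF test_smooth[OF test_deriv[OF \<phi>(1)]]])
      qed
      then show ?thesis
        using weight_inner[OF _ test_measurable[OF test_deriv[OF \<phi>(1)]], of "indicator {x..y}" n]
        by (simp add: l2_inner_commute[of _ "deriv _"])
    qed
    moreover have "(\<lambda>n. l2_inner \<mu> (deriv (\<phi> n)) (\<lambda>t. indicator {x..y} t * exp (w t))) \<longlonglongrightarrow>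
        l2_inner \<mu> (\<lambda>x. 0) (\<lambda>t. indicator {x..y} t * exp (w t))"
      by (rule l2_inner_tendsto[OF test_deriv_L2[OF \<phi>(1)] z _ \<phi>(3)])
         (rule weight_L2[of _ 1 x y], auto simp: indicator_def)
    ultimately show ?thesis by (simp add: l2_inner_def)
  qed
  have const: "u x = u y" if "x \<in> G" "y \<in> G" "x \<le> y" for x y
  proof -
    have "(\<lambda>n. \<phi> (r n) y - \<phi> (r n) x) \<longlonglongrightarrow> u y - u x"
      using that unfolding G_def by (intro tendsto_diff) auto
    moreover have "(\<lambda>n. \<phi> (r n) y - \<phi> (r n) x) \<longlonglongrightarrow> 0"
      using LIMSEQ_subseq_LIMSEQ[OF inc[OF that(3)] r] by (simp add: o_def)
    ultimately show ?thesis using LIMSEQ_unique by force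
  qed
  have "G \<noteq> {}"
  proof
    assume "G = {}"
    then have "AE x in lborel. x \<notin> (UNIV :: real set)" using G by (simp add: AE_env)
    then have "emeasure lborel (UNIV :: real set) = 0" by (subst (asm) AE_iff_measurable[OF _ refl]) auto
    then show False by simp
  qed
  then obtain x0 where "x0 \<in> G" by blast
  have ux0: "u x = u x0" if "x \<in> G" for x
  proof (cases "x \<le> x0")
    case True
    with that \<open>x0 \<in> G\<close> show ?thesis by (rule const)
  next
    case False
    then have "u x0 = u x" by (intro const \<open>x0 \<in> G\<close> that) simp
    then show ?thesis by (rule sym)
  qed
  have "u x0 = 0"
  proof (rule ccontr)
    assume "u x0 \<noteq> 0"
    have "integrable \<mu> (\<lambda>x. (u x0)\<^sup>2)"
    proof (rule integrable_cong_AE_imp[OF L2_D(2)[OF u]])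
      show "AE x in \<mu>. (u x)\<^sup>2 = (u x0)\<^sup>2" using G by eventually_elim (simp add: ux0)
    qed simp
    then have "integrable lborel (\<lambda>x. (u x0)\<^sup>2 * exp (- w x))" by (subst (asm) integral_env(2)) auto
    then have "integrable lborel (\<lambda>x. exp (- w x))" using \<open>u x0 \<noteq> 0\<close> by simp
    then have "(\<integral>\<^sup>+x. ennreal (exp (- w x)) \<partial>lborel) < \<infinity>"
      by (simp add: integrable_iff_bounded)
    with mass show False by simp
  qed
  from G show ?thesis
  proof eventually_elim
    case (elim x)
    show ?case using ux0[OF elim] \<open>u x0 = 0\<close> by simp
  qed
qed




lemma low_energy_limit_zero:
  assumes mass: "(\<integral>\<^sup>+x. ennreal (exp (- w x)) \<partial>lborel) = \<infinity>"
    and \<phi>: "\<And>n. \<phi> n \<in> test_functions" and g: "g \<in> L2 \<mu>" "l2_tendsto \<mu> \<phi> g sequentially"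
    and E: "(\<lambda>n. pre_form w (\<phi> n) (\<phi> n)) \<longlonglongrightarrow> 0"
  shows "AE x in \<mu>. g x = 0"
proof (rule zero_gradient_imp_zero[OF mass])
  have "(\<lambda>n. sqrt (2 * pre_form w (\<phi> n) (\<phi> n))) \<longlonglongrightarrow> sqrt (2 * 0)"
    by (intro tendsto_real_sqrt tendsto_mult tendsto_const E)
  then have "l2_tendsto \<mu> (\<lambda>n. deriv (\<phi> n)) (\<lambda>x. 0) sequentially"
    unfolding pre_form_eq[OF \<phi> \<phi>] l2_tendsto_def by (simp add: l2_norm_def)
  moreover have "(\<lambda>x. 0) \<in> L2 \<mu>" by (simp add: L2_def)
  ultimately show "gradient g (\<lambda>x. 0)" unfolding gradient_def using \<phi> g by blast
qed

end

text \<open>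
  The path properties from which both conclusions follow: low energies put 0 into the spectrum,
  and the infinite mass keeps 0 from being an eigenvalue.
\<close>

locale infinite_mass_low_energy_env = loc_bounded_env +
  assumes infinite_mass: "(\<integral>\<^sup>+x. ennreal (exp (- w x)) \<partial>lborel) = \<infinity>"
    and low_energy: "\<And>\<epsilon>. \<epsilon> > 0 \<Longrightarrow> \<exists>\<phi>\<in>test_functions. l2_norm \<mu> \<phi> = 1 \<and> pre_form w \<phi> \<phi> \<le> \<epsilon>"
begin

text \<open>
  Take test functions of energy at most \<open>e\<^sup>2\<close> and apply \<open>e (e - L)\<^sup>-\<^sup>1\<close>. Then the squared
  distance to the test function is at most \<open>e\<close> and the squared norm of \<open>L u\<close> at most \<open>e\<^sup>3\<close>.
\<close>

lemma weyl_sequence: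
  obtains \<phi> u F where "\<forall>n. \<phi> n \<in> test_functions" "\<forall>n. l2_norm \<mu> (\<phi> n) = 1"
    "(\<lambda>n. pre_form w (\<phi> n) (\<phi> n)) \<longlonglongrightarrow> 0"
    "\<forall>n. (u n, F n) \<in> neg_form_generator w"
    "(\<lambda>n. l2_norm \<mu> (\<lambda>x. \<phi> n x - u n x)) \<longlonglongrightarrow> 0"
    "(\<lambda>n. l2_norm \<mu> (F n)) \<longlonglongrightarrow> 0"
proof -
  define e where "e n = 1 / real (Suc n)" for n
  have e: "0 < e n" "e n \<le> 1" for n by (simp_all add: e_def)
  have e0: "e \<longlonglongrightarrow> 0" unfolding e_def[abs_def] using LIMSEQ_inverse_real_of_nat by (simp add: inverse_eq_divide)
  have "\<forall>n. \<exists>\<phi>. \<phi> \<in> test_functions \<and> l2_norm \<mu> \<phi> = 1 \<and> pre_form w \<phi> \<phi> \<le> (e n)\<^sup>2"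
    using low_energy[OF zero_less_power[OF e(1)]] by blast
  from choice[OF this] obtain \<phi> where
    "\<forall>n. \<phi> n \<in> test_functions \<and> l2_norm \<mu> (\<phi> n) = 1 \<and> pre_form w (\<phi> n) (\<phi> n) \<le> (e n)\<^sup>2" by blast
  then have \<phi>: "\<phi> n \<in> test_functions" "l2_norm \<mu> (\<phi> n) = 1" "pre_form w (\<phi> n) (\<phi> n) \<le> (e n)\<^sup>2" for n by simp_all
  have "\<forall>n. \<exists>p. p \<in> neg_form_generator w \<and>
      e n * (l2_norm \<mu> (\<lambda>x. \<phi> n x - fst p x))\<^sup>2 \<le> pre_form w (\<phi> n) (\<phi> n) \<and>
      (l2_norm \<mu> (snd p))\<^sup>2 \<le> e n * pre_form w (\<phi> n) (\<phi> n)"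
  proof
    fix n
    obtain u F where "(u, F) \<in> neg_form_generator w"
      "e n * (l2_norm \<mu> (\<lambda>x. \<phi> n x - u x))\<^sup>2 \<le> pre_form w (\<phi> n) (\<phi> n)"
      "(l2_norm \<mu> F)\<^sup>2 \<le> e n * pre_form w (\<phi> n) (\<phi> n)"
      by (rule resolvent_approximation[OF \<phi>(1) e(1)])
    then show "\<exists>p. p \<in> neg_form_generator w \<and>
      e n * (l2_norm \<mu> (\<lambda>x. \<phi> n x - fst p x))\<^sup>2 \<le> pre_form w (\<phi> n) (\<phi> n) \<and>
      (l2_norm \<mu> (snd p))\<^sup>2 \<le> e n * pre_form w (\<phi> n) (\<phi> n)"
      by (intro exI[of _ "(u, F)"]) simp
  qed
  from choice[OF this] obtain p where p: "\<forall>n. p n \<in> neg_form_generator w \<and>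
      e n * (l2_norm \<mu> (\<lambda>x. \<phi> n x - fst (p n) x))\<^sup>2 \<le> pre_form w (\<phi> n) (\<phi> n) \<and>
      (l2_norm \<mu> (snd (p n)))\<^sup>2 \<le> e n * pre_form w (\<phi> n) (\<phi> n)" by blast
  define u where "u n = fst (p n)" for n
  define F where "F n = snd (p n)" for n
  have uF: "(u n, F n) \<in> neg_form_generator w" for n using p by (simp add: u_def F_def)
  have d: "e n * (l2_norm \<mu> (\<lambda>x. \<phi> n x - u n x))\<^sup>2 \<le> pre_form w (\<phi> n) (\<phi> n)" for n using p by (simp add: u_def)
  have F: "(l2_norm \<mu> (F n))\<^sup>2 \<le> e n * pre_form w (\<phi> n) (\<phi> n)" for n using p by (simp add: F_def)
  have sq: "(\<lambda>n. a n) \<longlonglongrightarrow> 0" if "\<And>n. 0 \<le> a n" "\<And>n. (a n)\<^sup>2 \<le> e n" for a :: "nat \<Rightarrow> real"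
  proof (rule tendsto_sandwich[of "\<lambda>_. 0" _ _ "\<lambda>n. sqrt (e n)"])
    show "(\<lambda>n. sqrt (e n)) \<longlonglongrightarrow> 0" using tendsto_real_sqrt[OF e0] by simp
    show "\<forall>\<^sub>F n in sequentially. a n \<le> sqrt (e n)" using that(2) real_le_rsqrt by simp
  qed (use that in auto)
  have e2: "(e n)\<^sup>2 \<le> e n" for n using e[of n] mult_left_mono[of "e n" 1 "e n"] by (simp add: power2_eq_square)
  show ?thesis
  proof (rule that)
    show "\<forall>n. \<phi> n \<in> test_functions" "\<forall>n. l2_norm \<mu> (\<phi> n) = 1" "\<forall>n. (u n, F n) \<in> neg_form_generator w"
      using \<phi> uF by blast+
    show "(\<lambda>n. pre_form w (\<phi> n) (\<phi> n)) \<longlonglongrightarrow> 0"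
    proof (rule tendsto_sandwich[of "\<lambda>_. 0" _ _ e])
      show "\<forall>\<^sub>F n in sequentially. 0 \<le> pre_form w (\<phi> n) (\<phi> n)"
        by (simp add: pre_form_eq[OF \<phi>(1) \<phi>(1)] l2_inner_self_nonneg)
      show "\<forall>\<^sub>F n in sequentially. pre_form w (\<phi> n) (\<phi> n) \<le> e n"
        using order_trans[OF \<phi>(3) e2] by simp
    qed (use e0 in auto)
    show "(\<lambda>n. l2_norm \<mu> (\<lambda>x. \<phi> n x - u n x)) \<longlonglongrightarrow> 0"
    proof (rule sq)
      fix n
      have "e n * (l2_norm \<mu> (\<lambda>x. \<phi> n x - u n x))\<^sup>2 \<le> e n * e n"
        using order_trans[OF d \<phi>(3)] by (simp add: power2_eq_square)
      then show "(l2_norm \<mu> (\<lambda>x. \<phi> n x - u n x))\<^sup>2 \<le> e n" by (rule mult_left_le_imp_le[OF _ e(1)])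
    qed (rule l2_norm_nonneg)
    show "(\<lambda>n. l2_norm \<mu> (F n)) \<longlonglongrightarrow> 0"
    proof (rule sq)
      fix n
      have "e n * pre_form w (\<phi> n) (\<phi> n) \<le> e n * 1"
        using order_trans[OF \<phi>(3) order_trans[OF e2 e(2)], of n] e(1)[of n] by (intro mult_left_mono) auto
      then show "(l2_norm \<mu> (F n))\<^sup>2 \<le> e n" using F[of n] by simp
    qed (rule l2_norm_nonneg)
  qed
qed

lemma zero_in_spectrum: "0 \<in> spectrum_of \<mu> (neg_form_generator w)"
proof -
  obtain \<phi> u F where \<phi>': "\<forall>n. \<phi> n \<in> test_functions" "\<forall>n. l2_norm \<mu> (\<phi> n) = 1"
    and E: "(\<lambda>n. pre_form w (\<phi> n) (\<phi> n)) \<longlonglongrightarrow> 0"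
    and uF': "\<forall>n. (u n, F n) \<in> neg_form_generator w"
    and d: "(\<lambda>n. l2_norm \<mu> (\<lambda>x. \<phi> n x - u n x)) \<longlonglongrightarrow> 0"
    and F: "(\<lambda>n. l2_norm \<mu> (F n)) \<longlonglongrightarrow> 0" by (rule weyl_sequence)
  note \<phi> = \<phi>'[rule_format] and uF = uF'[rule_format]
  have u: "u n \<in> L2 \<mu>" for n
  proof -
    have "u n \<in> form_domain w" using uF[of n] unfolding neg_form_generator_iff by blast
    then show ?thesis by (simp add: form_domain_def)
  qed
  have "0 \<notin> resolvent_set \<mu> (neg_form_generator w)"
  proof
    assume "0 \<in> resolvent_set \<mu> (neg_form_generator w)"
    then obtain C where C: "\<forall>(u, F)\<in>neg_form_generator w. l2_norm \<mu> u \<le> C * l2_norm \<mu> (\<lambda>x. F x - 0 * u x)"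
      unfolding resolvent_set_def by blast
    have "1 \<le> l2_norm \<mu> (\<lambda>x. \<phi> n x - u n x) + C * l2_norm \<mu> (F n)" for n
    proof -
      have "l2_norm \<mu> (\<lambda>x. (\<phi> n x - u n x) + u n x) \<le> l2_norm \<mu> (\<lambda>x. \<phi> n x - u n x) + l2_norm \<mu> (u n)"
        by (intro l2_norm_triangle L2_diff test_L2 \<phi>(1) u)
      moreover have "l2_norm \<mu> (u n) \<le> C * l2_norm \<mu> (F n)" using bspec[OF C uF[of n]] by simp
      ultimately show ?thesis using \<phi>(2)[of n] by simp
    qed
    moreover have "(\<lambda>n. l2_norm \<mu> (\<lambda>x. \<phi> n x - u n x) + C * l2_norm \<mu> (F n)) \<longlonglongrightarrow> 0 + C * 0"
      by (intro tendsto_add tendsto_mult tendsto_const d F)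
    ultimately have "1 \<le> 0 + C * (0::real)" by (intro LIMSEQ_le_const) auto
    then show False by simp
  qed
  then show ?thesis by (simp add: spectrum_of_def)
qed

lemma zero_not_eigenvalue:
  assumes "u \<in> eigenspace \<mu> (neg_form_generator w) 0"
  shows "AE x in \<mu>. u x = 0"
proof -
  obtain F where uF: "(u, F) \<in> neg_form_generator w" and F0: "AE x in \<mu>. F x = 0"
    using assms by (auto simp: eigenspace_def)
  obtain g where g: "gradient u g" "F \<in> L2 \<mu>"
      "\<forall>v h. gradient v h \<longrightarrow> 1 / 2 * l2_inner \<mu> g h = l2_inner \<mu> F v"
    by (rule neg_form_generator_gradient[OF uF])
  have "l2_inner \<mu> F u = (\<integral>x. 0 \<partial>\<mu>)"
    unfolding l2_inner_def
    by (rule integral_cong_AE) (use F0 L2_D(1)[OF g(2)] L2_D(1)[OF gradient_L2(1)[OF g(1)]] in auto)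
  then have "l2_norm \<mu> g = 0" using g(3)[rule_format, OF g(1)] by (simp add: l2_norm_def)
  then have g0: "AE x in \<mu>. g x = 0" by (rule l2_norm_zero_AE[OF gradient_L2(2)[OF g(1)]])
  obtain \<phi> where \<phi>: "\<And>n. \<phi> n \<in> test_functions" "l2_tendsto \<mu> \<phi> u sequentially"
      "l2_tendsto \<mu> (\<lambda>n. deriv (\<phi> n)) g sequentially" using g(1) by (auto simp: gradient_def)
  have z: "(\<lambda>x. 0) \<in> L2 \<mu>" by (simp add: L2_def)
  have "l2_tendsto \<mu> (\<lambda>n. deriv (\<phi> n)) (\<lambda>x. 0) sequentially"
    by (rule l2_tendsto_cong_AE[OF test_deriv_L2[OF \<phi>(1)] gradient_L2(2)[OF g(1)] z g0 \<phi>(3)])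
  then have "gradient u (\<lambda>x. 0)" unfolding gradient_def using \<phi> z gradient_L2(1)[OF g(1)] by blast
  then show ?thesis by (rule zero_gradient_imp_zero[OF infinite_mass])
qed

theorem lambda_ess_zero: "lambda_ess w = 0"
proof -
  have "0 \<notin> discrete_spectrum \<mu> (neg_form_generator w)"
    unfolding discrete_spectrum_def using zero_not_eigenvalue by blast
  then have "ereal 0 \<in> ereal ` essential_spectrum \<mu> (neg_form_generator w)"
    using zero_in_spectrum by (auto simp: essential_spectrum_def)
  then have "lambda_ess w \<le> ereal 0" unfolding lambda_ess_def by (rule Inf_lower)
  moreover have "ereal 0 \<le> lambda_ess w"
    unfolding lambda_ess_def
  proof (rule Inf_greatest)
    fix y assume "y \<in> ereal ` essential_spectrum \<mu> (neg_form_generator w)"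
    then obtain r where r: "y = ereal r" "r \<notin> resolvent_set \<mu> (neg_form_generator w)"
      by (auto simp: essential_spectrum_def spectrum_of_def)
    then have "\<not> r < 0" using negative_in_resolvent_set by blast
    then show "ereal 0 \<le> y" using r(1) by simp
  qed
  ultimately show ?thesis by (simp add: zero_ereal_def)
qed

theorem semigroup_not_compact:
  assumes "semigroup_of_env w P" shows "\<not> compact_semigroup \<mu> P"
proof
  assume "compact_semigroup \<mu> P"
  then have comp: "compact_operator \<mu> (P 1)" by (simp add: compact_semigroup_def)
  from assms have P: "markovian_semigroup \<mu> P" and gen: "infinitesimal_generator \<mu> P = form_generator w"
    by (auto simp: semigroup_of_env_def)
  obtain \<phi> u F where \<phi>': "\<forall>n. \<phi> n \<in> test_functions" "\<forall>n. l2_norm \<mu> (\<phi> n) = 1"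
    and E: "(\<lambda>n. pre_form w (\<phi> n) (\<phi> n)) \<longlonglongrightarrow> 0"
    and uF': "\<forall>n. (u n, F n) \<in> neg_form_generator w"
    and d: "(\<lambda>n. l2_norm \<mu> (\<lambda>x. \<phi> n x - u n x)) \<longlonglongrightarrow> 0"
    and F: "(\<lambda>n. l2_norm \<mu> (F n)) \<longlonglongrightarrow> 0" by (rule weyl_sequence)
  note \<phi> = \<phi>'[rule_format] and uF = uF'[rule_format]
  have u: "u n \<in> L2 \<mu>" for n
  proof -
    have "u n \<in> form_domain w" using uF[of n] unfolding neg_form_generator_iff by blast
    then show ?thesis by (simp add: form_domain_def)
  qed
  have Pu: "P 1 (u n) \<in> L2 \<mu>" for n using markovian_semigroupD(1)[OF P _ u] by simp
  have inc: "l2_norm \<mu> (\<lambda>x. P 1 (u n) x - u n x) \<le> l2_norm \<mu> (F n)" for n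
  proof -
    obtain f where f: "(u n, f) \<in> form_generator w" "F n = (\<lambda>x. - f x)"
      using uF[of n] by (auto simp: neg_form_generator_def)
    then show ?thesis
      using semigroup_increment_le[OF P, of "u n" f 1] by (simp add: gen l2_norm_minus)
  qed
  have "\<exists>C. \<forall>n. l2_norm \<mu> (u n) \<le> C"
  proof -
    obtain K where K: "\<And>n. \<bar>l2_norm \<mu> (\<lambda>x. \<phi> n x - u n x)\<bar> \<le> K"
      using convergent_imp_Bseq[OF convergentI[OF d]] by (auto simp: Bseq_def)
    have "l2_norm \<mu> (u n) \<le> 1 + K" for n
    proof -
      have "l2_norm \<mu> (\<lambda>x. (u n x - \<phi> n x) + \<phi> n x) \<le> l2_norm \<mu> (\<lambda>x. u n x - \<phi> n x) + l2_norm \<mu> (\<phi> n)"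
        by (intro l2_norm_triangle L2_diff test_L2 \<phi>(1) u)
      then show ?thesis using K[of n] \<phi>(2)[of n] l2_norm_diff_commute[of \<mu> "u n" "\<phi> n"] by simp
    qed
    then show ?thesis by blast
  qed
  then obtain s g where s: "strict_mono s" and g: "g \<in> L2 \<mu>"
    and lim: "l2_tendsto \<mu> (\<lambda>n. P 1 (u (s n))) g sequentially"
    using comp u unfolding compact_operator_def by meson
  note sub = LIMSEQ_subseq_LIMSEQ[OF _ s, unfolded o_def]
  have \<phi>g: "l2_tendsto \<mu> (\<lambda>n. \<phi> (s n)) g sequentially"
    unfolding l2_tendsto_def
  proof (rule tendsto_sandwich[of "\<lambda>_. 0"])
    show "(\<lambda>n. l2_norm \<mu> (\<lambda>x. \<phi> (s n) x - u (s n) x)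
        + (l2_norm \<mu> (F (s n)) + l2_norm \<mu> (\<lambda>x. P 1 (u (s n)) x - g x))) \<longlonglongrightarrow> 0"
      using tendsto_add[OF sub[OF d] tendsto_add[OF sub[OF F] lim[unfolded l2_tendsto_def]]] by simp
    show "\<forall>\<^sub>F n in sequentially. l2_norm \<mu> (\<lambda>x. \<phi> (s n) x - g x) \<le>
        l2_norm \<mu> (\<lambda>x. \<phi> (s n) x - u (s n) x)
        + (l2_norm \<mu> (F (s n)) + l2_norm \<mu> (\<lambda>x. P 1 (u (s n)) x - g x))"
    proof (intro always_eventually allI)
      fix n
      show "l2_norm \<mu> (\<lambda>x. \<phi> (s n) x - g x) \<le> l2_norm \<mu> (\<lambda>x. \<phi> (s n) x - u (s n) x)
        + (l2_norm \<mu> (F (s n)) + l2_norm \<mu> (\<lambda>x. P 1 (u (s n)) x - g x))"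
        using l2_norm_triangle_diff[OF test_L2[OF \<phi>(1)] u g, of "s n" "s n"]
          l2_norm_triangle_diff[OF u Pu g, of "s n" "s n"] inc[of "s n"]
          l2_norm_diff_commute[of \<mu> "u (s n)" "P 1 (u (s n))"] by simp
    qed
  qed (auto simp: l2_norm_nonneg)
  have "AE x in \<mu>. g x = 0"
    by (rule low_energy_limit_zero[OF infinite_mass \<phi>(1) g \<phi>g sub[OF E]])
  then have "l2_norm \<mu> g = l2_norm \<mu> (\<lambda>x. 0)"
    by (rule l2_norm_cong_AE) (use L2_D(1)[OF g] in auto)
  moreover have "(\<lambda>n. l2_norm \<mu> (\<phi> (s n))) \<longlonglongrightarrow> l2_norm \<mu> g"
    by (rule l2_norm_tendsto[OF test_L2[OF \<phi>(1)] g \<phi>g])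
  ultimately have "(\<lambda>n. 1) \<longlonglongrightarrow> (0 :: real)" using \<phi>(2) by (simp add: l2_norm_def l2_inner_def)
  then show False using LIMSEQ_unique[OF tendsto_const] by force
qed

end


section \<open>Divergence of both exponential integrals\<close>

text \<open>
  Used both for the far slope, where \<open>f = exp w\<close>, and for the mass between the slopes, where
  \<open>f = exp (- w)\<close>.
\<close>

lemma divergent_integral_large:
  fixes f :: "real \<Rightarrow> real"
  assumes [measurable]: "f \<in> borel_measurable borel" and f0: "\<And>x. 0 \<le> f x"
    and int: "\<And>a b. integrable lborel (\<lambda>x. f x * indicator {a..b} x)"
    and inf: "(\<integral>\<^sup>+x. ennreal (f x) * indicator {0..} x \<partial>lborel) = \<infinity>"
  obtains b where "b > a" "M \<le> (\<integral>x. f x * indicator {a..b} x \<partial>lborel)"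
proof -
  have nn: "(\<integral>\<^sup>+x. ennreal (f x) * indicator {s..t} x \<partial>lborel) = ennreal (\<integral>x. f x * indicator {s..t} x \<partial>lborel)" for s t
  proof -
    have "(\<integral>\<^sup>+x. ennreal (f x) * indicator {s..t} x \<partial>lborel) = (\<integral>\<^sup>+x. ennreal (f x * indicator {s..t} x) \<partial>lborel)"
      by (intro nn_integral_cong) (auto simp: indicator_def)
    then show ?thesis using nn_integral_eq_integral[OF int] f0 by simp
  qed
  have "\<exists>b>a. M \<le> (\<integral>x. f x * indicator {a..b} x \<partial>lborel)"
  proof (rule ccontr)
    assume "\<not> ?thesis"
    then have less: "(\<integral>x. f x * indicator {a..b} x \<partial>lborel) < M" if "b > a" for b using that by force
    have "(\<lambda>n. \<integral>\<^sup>+x. ennreal (f x) * indicator {a..a + 1 + real n} x \<partial>lborel) \<longlonglongrightarrow>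
        (\<integral>\<^sup>+x. ennreal (f x) * indicator {a..} x \<partial>lborel)"
    proof (rule nn_integral_LIMSEQ)
      show "incseq (\<lambda>n x. ennreal (f x) * indicator {a..a + 1 + real n} x)"
        by (auto simp: incseq_def le_fun_def indicator_def)
      fix x
      obtain N :: nat where N: "x \<le> real N + a + 1" using real_arch_simple[of "x - a - 1"] by (auto simp: algebra_simps)
      show "(\<lambda>n. ennreal (f x) * indicator {a..a + 1 + real n} x) \<longlonglongrightarrow> ennreal (f x) * indicator {a..} x"
        using N by (intro tendsto_eventually) (auto simp: eventually_sequentially indicator_def intro!: exI[of _ N])
    qed auto
    then have "(\<integral>\<^sup>+x. ennreal (f x) * indicator {a..} x \<partial>lborel) \<le> ennreal M"
    proof (rule LIMSEQ_le_const2)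
      show "\<exists>N. \<forall>n\<ge>N. (\<integral>\<^sup>+x. ennreal (f x) * indicator {a..a + 1 + real n} x \<partial>lborel) \<le> ennreal M"
        unfolding nn by (intro exI[of _ 0] allI impI ennreal_leI less_imp_le less) simp
    qed
    moreover have "(\<integral>\<^sup>+x. ennreal (f x) * indicator {0..} x \<partial>lborel) \<le>
        (\<integral>\<^sup>+x. ennreal (f x) * indicator {0..a} x + ennreal (f x) * indicator {a..} x \<partial>lborel)"
      by (intro nn_integral_mono) (auto simp: indicator_def)
    moreover have "\<dots> = ennreal (\<integral>x. f x * indicator {0..a} x \<partial>lborel)
        + (\<integral>\<^sup>+x. ennreal (f x) * indicator {a..} x \<partial>lborel)"
      by (subst nn_integral_add) (auto simp: nn)
    ultimately show False using inf by (auto simp: top_unique)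
  qed
  then show ?thesis using that by blast
qed

context loc_bounded_env begin

lemma integrable_exp_interval:
  "integrable lborel (\<lambda>x. exp (w x) * indicator {a..b} x)"
  "integrable lborel (\<lambda>x. exp (- w x) * indicator {a..b} x)"
proof -
  obtain B where B: "B > 0" "\<forall>x\<in>{a..b}. exp (- w x) \<le> B \<and> exp (w x) \<le> B" by (rule exp_loc_bounded)
  show "integrable lborel (\<lambda>x. exp (w x) * indicator {a..b} x)"
    "integrable lborel (\<lambda>x. exp (- w x) * indicator {a..b} x)"
    by (rule integrable_bounded_interval[of _ a b B]; use B in \<open>auto simp: indicator_def\<close>)+
qed

lemma integral_exp_interval_pos:
  assumes "a < b" shows "0 < (\<integral>x. exp (w x) * indicator {a..b} x \<partial>lborel)"
proof -
  obtain B where B: "B > 0" "\<forall>x\<in>{a..b}. exp (- w x) \<le> B \<and> exp (w x) \<le> B" by (rule exp_loc_bounded)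
  have "0 < (b - a) / B" using assms B by simp
  also have "\<dots> = (\<integral>x. 1 / B * indicator {a..b} x \<partial>lborel)" using assms by simp
  also have "\<dots> \<le> (\<integral>x. exp (w x) * indicator {a..b} x \<partial>lborel)"
  proof (rule integral_mono)
    show "integrable lborel (\<lambda>x. 1 / B * indicator {a..b} x)"
      by (rule integrable_bounded_interval[of _ a b "1 / B"]) (use B in \<open>auto simp: indicator_def\<close>)
    show "1 / B * indicator {a..b} x \<le> exp (w x) * indicator {a..b} x" for x
      using B(1) bspec[OF B(2), of x] by (auto simp: indicator_def exp_minus field_simps)
  qed (rule integrable_exp_interval)
  finally show ?thesis .
qed

text \<open>
  The trapezoidal profile that climbs on \<open>[0, 1]\<close> and descends on \<open>[c, d]\<close> with slopes
  proportional to \<open>exp w\<close>, smoothed by the approximation of primitives and then normalised.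
\<close>

lemma low_energy_test_function:
  assumes scale: "(\<integral>\<^sup>+x. ennreal (exp (w x)) * indicator {0..} x \<partial>lborel) = \<infinity>"
    and mass: "(\<integral>\<^sup>+x. ennreal (exp (- w x)) * indicator {0..} x \<partial>lborel) = \<infinity>"
    and "\<epsilon> > 0"
  shows "\<exists>\<phi>\<in>test_functions. l2_norm \<mu> \<phi> = 1 \<and> pre_form w \<phi> \<phi> \<le> \<epsilon>"
proof -
  define A where "A = (\<integral>x. exp (w x) * indicator {0..1} x \<partial>lborel)"
  have A: "A > 0" unfolding A_def by (rule integral_exp_interval_pos) simp
  \<comment> \<open>With this mass the energy, at most \<open>1/2 (1/A + 1)\<close> in the limit, is less than \<open>\<epsilon>\<close> times the squared norm.\<close>
  define M where "M = (1 / A + 1) / \<epsilon>"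
  obtain c where c: "c > 1" "M \<le> (\<integral>x. exp (- w x) * indicator {1..c} x \<partial>lborel)"
    by (rule divergent_integral_large[of "\<lambda>x. exp (- w x)" 1 M]) (use mass integrable_exp_interval in auto)
  obtain d where d: "d > c" "1 \<le> (\<integral>x. exp (w x) * indicator {c..d} x \<partial>lborel)"
    by (rule divergent_integral_large[of "\<lambda>x. exp (w x)" c 1]) (use scale integrable_exp_interval in auto)
  define D where "D = (\<integral>x. exp (w x) * indicator {c..d} x \<partial>lborel)"
  \<comment> \<open>The slope of the profile; its two parts integrate to \<open>1\<close> and \<open>- 1\<close>.\<close>
  define h where "h x = 1 / A * (exp (w x) * indicator {0..1} x) - 1 / D * (exp (w x) * indicator {c..d} x)" for x
  have [measurable]: "h \<in> borel_measurable borel" unfolding h_def by measurable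
  have "D \<ge> 1" using d by (simp add: D_def)
  have h0: "h x = 0" if "x \<notin> {0..d}" for x using that c d by (auto simp: h_def indicator_def)
  obtain B where B: "B > 0" "\<forall>x\<in>{-1..d + 1}. exp (- w x) \<le> B \<and> exp (w x) \<le> B" by (rule exp_loc_bounded)
  have hB: "\<bar>h x\<bar> \<le> B / A + B" for x
  proof (cases "x \<in> {0..d}")
    case True
    then have e: "exp (w x) \<le> B" using B(2) by auto
    have 1: "exp (w x) / A \<le> B / A" using e A by (simp add: divide_right_mono)
    have "exp (w x) / D \<le> exp (w x) / 1" using \<open>D \<ge> 1\<close> by (intro divide_left_mono) auto
    then have 2: "exp (w x) / D \<le> B" using e by simp
    have 3: "0 \<le> exp (w x) / A" "0 \<le> exp (w x) / D" using A \<open>D \<ge> 1\<close> by auto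
    show ?thesis using 1 2 3 c by (auto simp: h_def indicator_def)
  qed (use h0 A B in auto)
  have intexp: "(\<integral>x. p * (exp (w x) * indicator {0..1} x) + q * (exp (w x) * indicator {c..d} x) \<partial>lborel) = p * A + q * D" for p q
    unfolding A_def D_def by (subst Bochner_Integration.integral_add) (auto intro!: integrable_exp_interval)
  have int0: "(\<integral>x. h x \<partial>lborel) = 0"
    using intexp[of "1 / A" "- (1 / D)"] A \<open>D \<ge> 1\<close> by (simp add: h_def[abs_def])
  have energy: "(\<integral>x. (h x)\<^sup>2 * exp (- w x) \<partial>lborel) = 1 / A + 1 / D"
  proof -
    have "(h x)\<^sup>2 * exp (- w x) = 1 / A\<^sup>2 * (exp (w x) * indicator {0..1} x) + 1 / D\<^sup>2 * (exp (w x) * indicator {c..d} x)" for x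
      using c by (auto simp: h_def indicator_def power2_eq_square exp_minus field_simps)
    then show ?thesis using intexp[of "1 / A\<^sup>2" "1 / D\<^sup>2"] A \<open>D \<ge> 1\<close> by (simp add: power2_eq_square)
  qed
  have "0 \<le> d" using c d by simp
  obtain \<Theta> C where \<Theta>: "\<And>n. \<Theta> n \<in> test_functions"
    and \<Theta>C: "\<And>n x. \<bar>\<Theta> n x\<bar> \<le> C" "\<And>n x. \<bar>deriv (\<Theta> n) x\<bar> \<le> C"
    and \<Theta>0: "\<And>n x. x \<notin> {0 - 1..d + 1} \<Longrightarrow> \<Theta> n x = 0"
    and dlim: "AE x in lborel. (\<lambda>n. deriv (\<Theta> n) x) \<longlonglongrightarrow> h x"
    and \<Theta>lim: "\<And>x. (\<lambda>n. \<Theta> n x) \<longlonglongrightarrow> (\<integral>y. h y * indicator {..x} y \<partial>lborel)"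
    using approx_primitive_by_test_functions[of h "B / A + B" 0 d, OF _ hB h0 \<open>0 \<le> d\<close> int0] by auto
  note m [measurable] = test_measurable[OF \<Theta>] test_measurable[OF test_deriv[OF \<Theta>]]
  have C0: "C \<ge> 0" using order_trans[OF abs_ge_zero \<Theta>C(1)[of 0 0]] .
  have sqC: "y\<^sup>2 * exp (- w x) \<le> C\<^sup>2 * B" if "x \<in> {-1..d + 1}" "\<bar>y\<bar> \<le> C" for x y
    using that B C0 power_mono[OF that(2), of 2] by (intro mult_mono) auto
  have E: "(\<lambda>n. pre_form w (\<Theta> n) (\<Theta> n)) \<longlonglongrightarrow> 1 / 2 * (1 / A + 1 / D)"
  proof -
    have "(\<lambda>n. \<integral>x. (deriv (\<Theta> n) x)\<^sup>2 * exp (- w x) \<partial>lborel) \<longlonglongrightarrow> (\<integral>x. (h x)\<^sup>2 * exp (- w x) \<partial>lborel)"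
    proof (rule bounded_interval_convergence[where a = "-1" and b = "d + 1" and C = "C\<^sup>2 * B"])
      show "\<bar>(deriv (\<Theta> n) x)\<^sup>2 * exp (- w x)\<bar> \<le> C\<^sup>2 * B" if "x \<in> {- 1..d + 1}" for n x
        using sqC[OF that \<Theta>C(2)[of n x]] by simp
      show "(deriv (\<Theta> n) x)\<^sup>2 * exp (- w x) = 0" if "x \<notin> {- 1..d + 1}" for n x
        using deriv_zero_outside[of "-1" "d + 1" "\<Theta> n" x] \<Theta>0[of _ n] that by simp
      show "AE x in lborel. (\<lambda>n. (deriv (\<Theta> n) x)\<^sup>2 * exp (- w x)) \<longlonglongrightarrow> (h x)\<^sup>2 * exp (- w x)"
        using dlim by eventually_elim (intro tendsto_intros)
    qed auto
    then have "(\<lambda>n. 1 / 2 * (\<integral>x. (deriv (\<Theta> n) x)\<^sup>2 * exp (- w x) \<partial>lborel)) \<longlonglongrightarrow> 1 / 2 * (1 / A + 1 / D)"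
      unfolding energy by (intro tendsto_mult tendsto_const)
    then show ?thesis by (simp add: pre_form_def power2_eq_square)
  qed
  define m where "m = (\<integral>x. exp (- w x) * indicator {1..c} x \<partial>lborel)"
  have N: "(\<lambda>n. \<integral>x. (\<Theta> n x)\<^sup>2 * (exp (- w x) * indicator {1..c} x) \<partial>lborel) \<longlonglongrightarrow> m"
    unfolding m_def
  proof (rule bounded_interval_convergence[where a = 1 and b = c and C = "C\<^sup>2 * B"])
    show "\<bar>(\<Theta> n x)\<^sup>2 * (exp (- w x) * indicator {1..c} x)\<bar> \<le> C\<^sup>2 * B" if "x \<in> {1..c}" for n x
      using sqC[of x "\<Theta> n x"] \<Theta>C(1)[of n x] that d by (simp add: indicator_def)
    \<comment> \<open>For \<open>x = c\<close> the integrand below also contains the second slope, at a single point.\<close>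
    have "AE x in lborel. x \<noteq> c" by (rule AE_lborel_singleton)
    then show "AE x in lborel. (\<lambda>n. (\<Theta> n x)\<^sup>2 * (exp (- w x) * indicator {1..c} x)) \<longlonglongrightarrow> exp (- w x) * indicator {1..c} x"
    proof eventually_elim
      case (elim x)
      show ?case
      proof (cases "x \<in> {1..c}")
        case True
        have "h y * indicator {..x} y = 1 / A * (exp (w y) * indicator {0..1} y)" for y
          using True elim d by (auto simp: h_def indicator_def)
        then have "(\<integral>y. h y * indicator {..x} y \<partial>lborel) = 1"
          using A by (simp add: A_def)
        then have "(\<lambda>n. (\<Theta> n x)\<^sup>2 * (exp (- w x) * indicator {1..c} x)) \<longlonglongrightarrow> 1\<^sup>2 * (exp (- w x) * indicator {1..c} x)"
          using \<Theta>lim[of x] by (intro tendsto_mult tendsto_power tendsto_const) simp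
        then show ?thesis by simp
      qed simp
    qed
  qed auto
  have norm_ge: "(\<integral>x. (\<Theta> n x)\<^sup>2 * (exp (- w x) * indicator {1..c} x) \<partial>lborel) \<le> (l2_norm \<mu> (\<Theta> n))\<^sup>2" for n
  proof -
    have i: "integrable lborel (\<lambda>x. (\<Theta> n x)\<^sup>2 * exp (- w x))"
      using L2_D(2)[OF test_L2[OF \<Theta>]] by (subst (asm) integral_env(2)) auto
    have "(l2_norm \<mu> (\<Theta> n))\<^sup>2 = (\<integral>x. (\<Theta> n x)\<^sup>2 * exp (- w x) \<partial>lborel)"
      unfolding l2_norm_sq l2_inner_def by (subst integral_env(1)) (auto simp: power2_eq_square)
    moreover have "(\<integral>x. (\<Theta> n x)\<^sup>2 * (exp (- w x) * indicator {1..c} x) \<partial>lborel) \<le> (\<integral>x. (\<Theta> n x)\<^sup>2 * exp (- w x) \<partial>lborel)"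
    proof (rule integral_mono[OF _ i])
      show "integrable lborel (\<lambda>x. (\<Theta> n x)\<^sup>2 * (exp (- w x) * indicator {1..c} x))"
        using integrable_mult_indicator[OF _ i, of "{1..c}"] by (simp add: mult_ac)
    qed (auto simp: indicator_def)
    ultimately show ?thesis by simp
  qed
  have "1 / 2 * (1 / A + 1 / D) < \<epsilon> * m"
  proof -
    have "1 / D \<le> 1" using \<open>D \<ge> 1\<close> by simp
    moreover have "0 < 1 / A" using A by simp
    ultimately have "1 / 2 * (1 / A + 1 / D) < 1 / A + 1" by argo
    also have "\<dots> = \<epsilon> * M" using \<open>\<epsilon> > 0\<close> by (simp add: M_def)
    also have "\<dots> \<le> \<epsilon> * m" using c(2) \<open>\<epsilon> > 0\<close> by (simp add: m_def)
    finally show ?thesis .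
  qed
  moreover have "(\<lambda>n. \<epsilon> * (\<integral>x. (\<Theta> n x)\<^sup>2 * (exp (- w x) * indicator {1..c} x) \<partial>lborel)
      - pre_form w (\<Theta> n) (\<Theta> n)) \<longlonglongrightarrow> \<epsilon> * m - 1 / 2 * (1 / A + 1 / D)"
    by (intro tendsto_diff tendsto_mult tendsto_const N E)
  ultimately have "\<forall>\<^sub>F n in sequentially. 0 < \<epsilon> * (\<integral>x. (\<Theta> n x)\<^sup>2 * (exp (- w x) * indicator {1..c} x) \<partial>lborel)
      - pre_form w (\<Theta> n) (\<Theta> n)"
    by (intro order_tendstoD(1)) auto
  then have "\<exists>n. pre_form w (\<Theta> n) (\<Theta> n) < \<epsilon> * (\<integral>x. (\<Theta> n x)\<^sup>2 * (exp (- w x) * indicator {1..c} x) \<partial>lborel)"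
    unfolding eventually_sequentially by (auto simp: algebra_simps)
  then obtain n where n: "pre_form w (\<Theta> n) (\<Theta> n) < \<epsilon> * (\<integral>x. (\<Theta> n x)\<^sup>2 * (exp (- w x) * indicator {1..c} x) \<partial>lborel)" ..
  also have "\<dots> \<le> \<epsilon> * (l2_norm \<mu> (\<Theta> n))\<^sup>2" using norm_ge[of n] \<open>\<epsilon> > 0\<close> by simp
  finally have less: "pre_form w (\<Theta> n) (\<Theta> n) < \<epsilon> * (l2_norm \<mu> (\<Theta> n))\<^sup>2" .
  define N where "N = l2_norm \<mu> (\<Theta> n)"
  have E0: "0 \<le> pre_form w (\<Theta> n) (\<Theta> n)" by (simp add: pre_form_eq[OF \<Theta> \<Theta>] l2_inner_self_nonneg)
  have "N \<noteq> 0" using less E0 by (auto simp: N_def)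
  then have N0: "N > 0" using l2_norm_nonneg[of \<mu> "\<Theta> n"] by (simp add: N_def)
  define \<phi> where "\<phi> x = 1 / N * \<Theta> n x + 0 * \<Theta> n x" for x
  have \<phi>: "\<phi> \<in> test_functions" unfolding \<phi>_def by (rule test_lincomb[OF \<Theta> \<Theta>])
  have d\<phi>: "deriv \<phi> = (\<lambda>x. 1 / N * deriv (\<Theta> n) x)"
    unfolding \<phi>_def deriv_test_lincomb[OF \<Theta> \<Theta>] by simp
  have "l2_norm \<mu> \<phi> = \<bar>1 / N\<bar> * l2_norm \<mu> (\<Theta> n)"
    unfolding l2_norm_scale[symmetric] by (simp add: \<phi>_def[abs_def])
  then have 1: "l2_norm \<mu> \<phi> = 1" using N0 by (simp add: N_def[symmetric])
  have "pre_form w \<phi> \<phi> = 1 / 2 * (l2_norm \<mu> (\<lambda>x. 1 / N * deriv (\<Theta> n) x))\<^sup>2"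
    unfolding pre_form_eq[OF \<phi> \<phi>] d\<phi> l2_norm_sq by simp
  also have "\<dots> = pre_form w (\<Theta> n) (\<Theta> n) / N\<^sup>2"
    unfolding l2_norm_scale pre_form_eq[OF \<Theta> \<Theta>] l2_norm_sq[symmetric] by (simp add: power_mult_distrib power_divide)
  also have "\<dots> \<le> \<epsilon>" using less N0 by (simp add: N_def[symmetric] field_simps)
  finally show ?thesis using \<phi> 1 by blast
qed

lemma infinite_mass_low_energy:
  assumes scale: "(\<integral>\<^sup>+x. ennreal (exp (w x)) * indicator {0..} x \<partial>lborel) = \<infinity>"
    and mass: "(\<integral>\<^sup>+x. ennreal (exp (- w x)) * indicator {0..} x \<partial>lborel) = \<infinity>"
  shows "infinite_mass_low_energy_env w"
proof (intro infinite_mass_low_energy_env.intro infinite_mass_low_energy_env_axioms.intro)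
  show "loc_bounded_env w" by unfold_locales
  have "(\<integral>\<^sup>+x. ennreal (exp (- w x)) * indicator {0..} x \<partial>lborel) \<le> (\<integral>\<^sup>+x. ennreal (exp (- w x)) \<partial>lborel)"
    by (intro nn_integral_mono) (auto simp: indicator_def)
  then show "(\<integral>\<^sup>+x. ennreal (exp (- w x)) \<partial>lborel) = \<infinity>" using mass by (simp add: top_unique)
qed (rule low_energy_test_function[OF assms])

end


section \<open>Random walks that do not drift to minus infinity\<close>

text \<open>
  The sequence does not tend to \<open>- \<infinity>\<close>. The bound \<open>K\<close> may depend on the sequence, which makes the
  property invariant under adding constants, and hence a tail property of the increments.
\<close>

definition not_drifting_down :: "(nat \<Rightarrow> real) \<Rightarrow> bool" where
  "not_drifting_down a \<longleftrightarrow> (\<exists>K::nat. \<forall>N. \<exists>n\<ge>N. - real K \<le> a n)"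

lemma not_drifting_down_shift:
  "not_drifting_down a \<longleftrightarrow> not_drifting_down (\<lambda>n. a (m + n) + c)"
proof
  assume "not_drifting_down a"
  then obtain K :: nat where K: "\<And>N. \<exists>n\<ge>N. - real K \<le> a n" by (auto simp: not_drifting_down_def)
  obtain L :: nat where L: "\<bar>c\<bar> \<le> real L" using real_arch_simple by blast
  have "\<exists>n\<ge>N. - real (K + L) \<le> a (m + n) + c" for N
  proof -
    obtain n where "n \<ge> m + N" "- real K \<le> a n" using K by blast
    then show ?thesis using L by (intro exI[of _ "n - m"]) auto
  qed
  then show "not_drifting_down (\<lambda>n. a (m + n) + c)" unfolding not_drifting_down_def by blast
next
  assume "not_drifting_down (\<lambda>n. a (m + n) + c)"
  then obtain K :: nat where K: "\<And>N. \<exists>n\<ge>N. - real K \<le> a (m + n) + c" by (auto simp: not_drifting_down_def)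
  obtain L :: nat where L: "\<bar>c\<bar> \<le> real L" using real_arch_simple by blast
  have "\<exists>n\<ge>N. - real (K + L) \<le> a n" for N
  proof -
    obtain n where "n \<ge> N" "- real K \<le> a (m + n) + c" using K by blast
    then show ?thesis using L by (intro exI[of _ "m + n"]) auto
  qed
  then show "not_drifting_down a" unfolding not_drifting_down_def by blast
qed

lemma not_drifting_down_suminf:
  assumes "not_drifting_down a" shows "(\<Sum>n. ennreal (exp (a n))) = \<infinity>"
proof (rule ccontr)
  assume "(\<Sum>n. ennreal (exp (a n))) \<noteq> \<infinity>"
  then have "summable (\<lambda>n. exp (a n))" by (intro summable_suminf_not_top) auto
  then have lim: "(\<lambda>n. exp (a n)) \<longlonglongrightarrow> 0" by (rule summable_LIMSEQ_zero)
  obtain K :: nat where K: "\<And>N. \<exists>n\<ge>N. - real K \<le> a n"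
    using assms by (auto simp: not_drifting_down_def)
  have "\<forall>\<^sub>F n in sequentially. exp (a n) < exp (- real K)"
    using order_tendstoD(2)[OF lim, of "exp (- real K)"] by simp
  then obtain N where "\<forall>n\<ge>N. exp (a n) < exp (- real K)" by (auto simp: eventually_sequentially)
  with K[of N] show False by force
qed

text \<open>
  The event is a tail event of the increments: from time \<open>m\<close> on, the walk differs by the
  constant \<open>S m\<close> from a sum of the increments after time \<open>m\<close>. It has probability at least \<open>1/2\<close>,
  since the walk being negative from some time \<open>N\<close> on is an increasing union of events of
  probability at most \<open>1/2\<close>.
\<close>

lemma (in prob_space) not_drifting_down_random_walk:
  fixes S :: "nat \<Rightarrow> 'a \<Rightarrow> real"
  assumes [measurable]: "\<And>n. S n \<in> borel_measurable M"
    and indep: "\<And>n::nat. indep_vars (\<lambda>_. borel) (\<lambda>i \<omega>. S (Suc i) \<omega> - S i \<omega>) {..<n}"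
    and half: "\<And>n. prob {\<omega> \<in> space M. S n \<omega> < 0} \<le> 1 / 2"
  shows "AE \<omega> in M. not_drifting_down (\<lambda>n. S n \<omega>)"
proof -
  define X where "X i \<omega> = S (Suc i) \<omega> - S i \<omega>" for i \<omega>
  define A where "A i = {X i -` B \<inter> space M | B. B \<in> sets (borel :: real measure)}" for i
  have [measurable]: "X i \<in> borel_measurable M" for i unfolding X_def by measurable
  have ind: "indep_sets A {..<n}" for n
    using indep[of n] unfolding indep_vars_def2 A_def X_def by auto
  have "indep_sets A UNIV"
    unfolding indep_sets_finite_index_sets[of A UNIV]
  proof (intro allI impI)
    fix J :: "nat set" assume "finite J"
    then obtain n where "J \<subseteq> {..<n}" using finite_nat_bounded by blast
    then show "indep_sets A J" using ind by (rule indep_sets_mono_index)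
  qed
  moreover have sa: "sigma_algebra (space M) (A i)" for i
  proof -
    have "A i = sets (vimage_algebra (space M) (X i) borel)"
      by (subst sets_vimage_algebra2) (auto simp: A_def)
    then show ?thesis using sets.sigma_algebra_axioms[of "vimage_algebra (space M) (X i) borel"] by simp
  qed
  \<comment> \<open>The event of the claim; it is shown to have probability 0 or 1, and then that it is not 0.\<close>
  define E where "E = {\<omega> \<in> space M. not_drifting_down (\<lambda>n. S n \<omega>)}"
  have "E \<in> tail_events A"
    unfolding tail_events_def
  proof (rule INT_I)
    fix m :: nat
    \<comment> \<open>The \<open>\<sigma>\<close>-algebra generated by the increments from time \<open>m\<close> on.\<close>
    define G where "G = sigma (space M) (\<Union> (A ` {m..}))"
    have sub: "\<Union> (A ` {m..}) \<subseteq> Pow (space M)" by (auto simp: A_def)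
    have spG: "space G = space M" by (simp add: G_def space_measure_of[OF sub])
    have setsG: "sets G = sigma_sets (space M) (\<Union> (A ` {m..}))" by (simp add: G_def sets_measure_of[OF sub])
    have XG [measurable]: "X i \<in> borel_measurable G" if "i \<ge> m" for i
    proof (rule measurableI)
      fix B :: "real set" assume "B \<in> sets borel"
      then have "X i -` B \<inter> space M \<in> \<Union> (A ` {m..})" using that by (auto simp: A_def)
      then show "X i -` B \<inter> space G \<in> sets G" unfolding spG setsG by (rule sigma_sets.Basic)
    qed simp
    define T where "T n \<omega> = (\<Sum>i\<in>{m..<m + n}. X i \<omega>)" for n \<omega>
    have [measurable]: "T n \<in> borel_measurable G" for n unfolding T_def by (intro borel_measurable_sum XG) simp
    have T: "S (m + n) \<omega> + - S m \<omega> = T n \<omega>" for n \<omega>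
      using sum_Suc_diff'[of m "m + n" "\<lambda>i. S i \<omega>"] by (simp add: T_def X_def)
    have "not_drifting_down (\<lambda>n. S n \<omega>) \<longleftrightarrow> not_drifting_down (\<lambda>n. T n \<omega>)" for \<omega>
      using not_drifting_down_shift[of "\<lambda>n. S n \<omega>" m "- S m \<omega>"] by (simp only: T)
    then have "E = {\<omega> \<in> space G. not_drifting_down (\<lambda>n. T n \<omega>)}"
      unfolding E_def spG by blast
    also have "\<dots> \<in> sets G" unfolding not_drifting_down_def by measurable
    finally show "E \<in> sigma_sets (space M) (\<Union> (A ` {m..}))" by (simp add: setsG)
  qed
  ultimately have 01: "prob E = 0 \<or> prob E = 1" using kolmogorov_0_1_law[of A E] sa by blast
  have [measurable]: "E \<in> events" unfolding E_def not_drifting_down_def by measurable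
  define B where "B N = {\<omega> \<in> space M. \<forall>n\<ge>N. S n \<omega> < 0}" for N
  have [measurable]: "B N \<in> events" for N unfolding B_def by measurable
  have "incseq B" by (auto simp: incseq_def B_def)
  then have "(\<lambda>N. prob (B N)) \<longlonglongrightarrow> prob (\<Union>N. B N)" by (intro finite_Lim_measure_incseq) auto
  moreover have "prob (B N) \<le> 1 / 2" for N
    by (rule order_trans[OF finite_measure_mono half[of N]]) (auto simp: B_def)
  ultimately have "prob (\<Union>N. B N) \<le> 1 / 2" by (intro LIMSEQ_le_const2) auto
  moreover have "space M - (\<Union>N. B N) \<subseteq> E"
  proof
    fix \<omega> assume \<omega>: "\<omega> \<in> space M - (\<Union>N. B N)"
    then have "\<exists>n\<ge>N. - real 0 \<le> S n \<omega>" for N by (auto simp: B_def not_less)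
    then show "\<omega> \<in> E" using \<omega> unfolding E_def not_drifting_down_def by blast
  qed
  then have "prob (space M - (\<Union>N. B N)) \<le> prob E" by (intro finite_measure_mono) auto
  ultimately have "prob E \<noteq> 0" by (subst (asm) prob_compl) auto
  with 01 have "prob E = 1" by simp
  then have "AE \<omega> in M. \<omega> \<in> E" by (simp add: prob_eq_1)
  then show ?thesis by (auto simp: E_def)
qed

lemma nn_integral_halfline_periodic:
  fixes f :: "real \<Rightarrow> ennreal"
  assumes [measurable]: "f \<in> borel_measurable borel"
  shows "(\<integral>\<^sup>+x. f x * indicator {0..} x \<partial>lborel)
    = (\<integral>\<^sup>+s. (\<Sum>n. f (s + real n)) * indicator {0..<1} s \<partial>lborel)"
proof -
  have one: "indicator {0..} x = (\<Sum>n. indicator {real n..<real n + 1} x :: ennreal)" for x :: real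
  proof -
    have "(\<Sum>n. indicator {real n..<real n + 1} x) = (indicator (\<Union>n. {real n..<real n + 1}) x :: ennreal)"
    proof (rule suminf_indicator)
      show "disjoint_family (\<lambda>n. {real n..<real n + 1})"
        unfolding disjoint_family_on_def
      proof (intro ballI impI)
        fix m n :: nat assume "m \<noteq> n"
        then have "real m + 1 \<le> real n \<or> real n + 1 \<le> real m" by linarith
        then show "{real m..<real m + 1} \<inter> {real n..<real n + 1} = {}" by auto
      qed
    qed
    moreover have "(\<Union>n. {real n..<real n + 1}) = {0..}"
    proof (intro set_eqI iffI)
      fix y :: real assume "y \<in> {0..}"
      then have "y \<in> {real (nat \<lfloor>y\<rfloor>)..<real (nat \<lfloor>y\<rfloor>) + 1}" by auto
      then show "y \<in> (\<Union>n. {real n..<real n + 1})" by blast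
    qed auto
    ultimately show ?thesis by simp
  qed
  have "(\<integral>\<^sup>+x. f x * indicator {0..} x \<partial>lborel) = (\<integral>\<^sup>+x. (\<Sum>n. f x * indicator {real n..<real n + 1} x) \<partial>lborel)"
    by (simp add: one)
  also have "\<dots> = (\<Sum>n. \<integral>\<^sup>+x. f x * indicator {real n..<real n + 1} x \<partial>lborel)"
    by (rule nn_integral_suminf) auto
  also have "\<dots> = (\<Sum>n. \<integral>\<^sup>+s. f (s + real n) * indicator {0..<1} s \<partial>lborel)"
  proof (rule suminf_cong)
    fix n
    have "(\<integral>\<^sup>+x. f x * indicator {real n..<real n + 1} x \<partial>lborel)
        = ennreal \<bar>1\<bar> * (\<integral>\<^sup>+s. f (real n + 1 * s) * indicator {real n..<real n + 1} (real n + 1 * s) \<partial>lborel)"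
      by (rule nn_integral_real_affine) auto
    also have "\<dots> = (\<integral>\<^sup>+s. f (s + real n) * indicator {0..<1} s \<partial>lborel)"
      by (simp add: add.commute indicator_def)
    finally show "(\<integral>\<^sup>+x. f x * indicator {real n..<real n + 1} x \<partial>lborel)
        = (\<integral>\<^sup>+s. f (s + real n) * indicator {0..<1} s \<partial>lborel)" .
  qed
  also have "\<dots> = (\<integral>\<^sup>+s. (\<Sum>n. f (s + real n) * indicator {0..<1} s) \<partial>lborel)"
    by (rule nn_integral_suminf[symmetric]) auto
  finally show ?thesis by simp
qed

lemma divergent_if_not_drifting_down:
  fixes f :: "real \<Rightarrow> real"
  assumes [measurable]: "f \<in> borel_measurable borel"
    and "AE s in lborel. not_drifting_down (\<lambda>n. f (max 0 s + real n))"
  shows "(\<integral>\<^sup>+x. ennreal (exp (f x)) * indicator {0..} x \<partial>lborel) = \<infinity>"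
proof -
  have "(\<integral>\<^sup>+x. ennreal (exp (f x)) * indicator {0..} x \<partial>lborel)
      = (\<integral>\<^sup>+s. (\<Sum>n. ennreal (exp (f (s + real n)))) * indicator {0..<1} s \<partial>lborel)"
    by (rule nn_integral_halfline_periodic) measurable
  also have "\<dots> = (\<integral>\<^sup>+s. \<infinity> * indicator {0..<1::real} s \<partial>lborel)"
  proof (rule nn_integral_cong_AE)
    show "AE s in lborel. (\<Sum>n. ennreal (exp (f (s + real n)))) * indicator {0..<1} s
        = \<infinity> * indicator {0..<1::real} s"
      using assms(2)
    proof eventually_elim
      case (elim s)
      show ?case
      proof (cases "s \<in> {0..<1}")
        case True
        then have "(\<Sum>n. ennreal (exp (f (s + real n)))) = \<infinity>"
          using not_drifting_down_suminf[OF elim] by simp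
        then show ?thesis by simp
      qed simp
    qed
  qed
  also have "\<dots> = \<infinity>" by (subst nn_integral_cmult_indicator) auto
  finally show ?thesis .
qed


section \<open>Sample paths\<close>

text \<open>
  The next point of the grid of mesh \<open>1 / (k + 1)\<close> strictly to the right of \<open>x\<close>. Evaluating a
  right continuous path there approximates its value at \<open>x\<close>.
\<close>

definition grid_above :: "nat \<Rightarrow> real \<Rightarrow> real" where
  "grid_above k x = (of_int \<lfloor>real (Suc k) * x\<rfloor> + 1) / real (Suc k)"

lemma filterlim_grid_above: "filterlim (\<lambda>k. grid_above k x) (at_right x) sequentially"
proof (rule tendsto_imp_filterlim_at_right)
  have less: "x < grid_above k x" for k
  proof -
    have "real (Suc k) * x < of_int \<lfloor>real (Suc k) * x\<rfloor> + 1" by linarith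
    then show ?thesis by (simp add: grid_above_def field_simps del: of_nat_Suc)
  qed
  then show "\<forall>\<^sub>F k in sequentially. x < grid_above k x" by simp
  have le: "grid_above k x \<le> x + 1 / real (Suc k)" for k
    unfolding grid_above_def by (simp add: field_simps del: of_nat_Suc)
  show "(\<lambda>k. grid_above k x) \<longlonglongrightarrow> x"
  proof (rule tendsto_sandwich[of "\<lambda>_. x" _ _ "\<lambda>k. x + 1 / real (Suc k)"])
    show "(\<lambda>k. x + 1 / real (Suc k)) \<longlonglongrightarrow> x"
      using tendsto_add[OF tendsto_const LIMSEQ_inverse_real_of_nat, of x] by (simp add: inverse_eq_divide)
    show "\<forall>\<^sub>F k in sequentially. x \<le> grid_above k x" using less_imp_le[OF less] by (intro always_eventually allI)
    show "\<forall>\<^sub>F k in sequentially. grid_above k x \<le> x + 1 / real (Suc k)" using le by (intro always_eventually allI)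
  qed simp
qed

lemma evaluation_measurable: "(\<lambda>w. w x) \<in> borel_measurable path_algebra"
  unfolding path_algebra_def by (rule measurable_restrict_space1) (rule measurable_component_singleton, simp)

lemma path_right_limit:
  assumes "w \<in> path_space" "x \<ge> 0" shows "(\<lambda>k. w (grid_above k x)) \<longlonglongrightarrow> w x"
proof -
  have "(w \<longlongrightarrow> w x) (at_right x)" using assms by (simp add: path_space_def continuous_within)
  then show ?thesis by (rule filterlim_compose[OF _ filterlim_grid_above])
qed

text \<open>
  For each grid the evaluation at the next grid point takes countably many times, and right
  continuity gives the limit. Needed to apply Fubini's theorem to times and paths.
\<close>

lemma path_evaluation_jointly_measurable:
  "(\<lambda>(x, w). w (max 0 x)) \<in> borel_measurable (borel \<Otimes>\<^sub>M path_algebra)"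
proof -
  have lim: "(\<lambda>k. snd p (grid_above k (max 0 (fst p)))) \<longlonglongrightarrow> (case p of (x, w) \<Rightarrow> w (max 0 x))"
    if "p \<in> space (borel \<Otimes>\<^sub>M path_algebra)" for p
  proof -
    have "snd p \<in> path_space"
      using that by (auto simp: space_pair_measure path_algebra_def space_restrict_space)
    then show ?thesis using path_right_limit[of "snd p" "max 0 (fst p)"] by (simp add: case_prod_unfold)
  qed
  have "(\<lambda>p. (\<lambda>i p. snd p ((of_int i + 1) / real (Suc k))) (\<lfloor>real (Suc k) * max 0 (fst p)\<rfloor>) p)
      \<in> borel_measurable (borel \<Otimes>\<^sub>M path_algebra)" for k
  proof (rule measurable_compose_countable[where f = "\<lambda>i p. snd p ((of_int i + 1) / real (Suc k))"
        and g = "\<lambda>p. \<lfloor>real (Suc k) * max 0 (fst p)\<rfloor>"])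
    show "(\<lambda>p. snd p ((of_int i + 1) / real (Suc k))) \<in> borel_measurable (borel \<Otimes>\<^sub>M path_algebra)" for i :: int
      by (rule measurable_compose[OF measurable_snd evaluation_measurable])
  qed measurable
  then have meas: "(\<lambda>p. snd p (grid_above k (max 0 (fst p)))) \<in> borel_measurable (borel \<Otimes>\<^sub>M path_algebra)" for k
    by (simp add: grid_above_def)
  show ?thesis
    by (rule borel_measurable_LIMSEQ_real[where u = "\<lambda>k p. snd p (grid_above k (max 0 (fst p)))"])
       (rule lim meas, assumption?)+
qed

lemma path_space_reflect:
  assumes "w \<in> path_space" shows "(\<lambda>x. w (- x)) \<in> path_space"
proof -
  have "((\<lambda>x. w (- x)) \<longlongrightarrow> l) (at_right x) \<longleftrightarrow> (w \<longlongrightarrow> l) (at_left (- x))"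
    "((\<lambda>x. w (- x)) \<longlongrightarrow> l) (at_left x) \<longleftrightarrow> (w \<longlongrightarrow> l) (at_right (- x))" for l x
    using filterlim_at_left_to_right[of w _ "- x"] filterlim_at_left_to_right[of "\<lambda>x. w (- x)" _ x]
    by simp_all
  then show ?thesis using assms by (simp add: path_space_def continuous_within)
qed

lemma path_measurable:
  assumes w: "w \<in> path_space" shows "w \<in> borel_measurable borel"
proof -
  have sec: "(\<lambda>x. v (max 0 x)) \<in> borel_measurable borel" if "v \<in> path_space" for v
  proof -
    have "(\<lambda>x. (x, v)) \<in> borel \<rightarrow>\<^sub>M (borel \<Otimes>\<^sub>M path_algebra)"
      using that by (intro measurable_Pair2') (simp add: path_algebra_def space_restrict_space space_PiM)
    from measurable_compose[OF this path_evaluation_jointly_measurable] show ?thesis by simp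
  qed
  have "(\<lambda>x. w (- max 0 (- x))) \<in> borel_measurable borel"
    using measurable_compose[OF borel_measurable_uminus[OF measurable_ident] sec[OF path_space_reflect[OF w]]] by simp
  with sec[OF w] have "(\<lambda>x. if 0 \<le> x then w (max 0 x) else w (- max 0 (- x))) \<in> borel_measurable borel"
    by measurable
  also have "(\<lambda>x. if 0 \<le> x then w (max 0 x) else w (- max 0 (- x))) = w"
    by (auto simp: fun_eq_iff)
  finally show ?thesis .
qed

text \<open>
  One-sided limits exist everywhere, so each point has a neighbourhood on which the path is
  bounded; then use compactness.
\<close>

lemma path_locally_bounded:
  assumes w: "w \<in> path_space" shows "\<exists>B. \<forall>x\<in>{a..b}. \<bar>w x\<bar> \<le> B"
proof -
  have side: "\<exists>B. \<forall>\<^sub>F y in F. \<bar>w y\<bar> \<le> B" if "(w \<longlongrightarrow> l) F" for l F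
  proof (intro exI)
    show "\<forall>\<^sub>F y in F. \<bar>w y\<bar> \<le> \<bar>l\<bar> + 1"
      using order_tendstoD(2)[OF tendsto_rabs[OF that], of "\<bar>l\<bar> + 1"] by (auto elim: eventually_mono)
  qed
  have right: "\<exists>l. (w \<longlongrightarrow> l) (at_right x)" for x
    using w by (cases "x \<ge> 0") (auto simp: path_space_def continuous_within)
  have left: "\<exists>l. (w \<longlongrightarrow> l) (at_left x)" for x
    using w by (cases "x \<le> 0") (auto simp: path_space_def continuous_within)
  have nbhd: "\<exists>U B. open U \<and> x \<in> U \<and> (\<forall>y\<in>U. \<bar>w y\<bar> \<le> B)" for x
  proof -
    from right obtain l1 where "(w \<longlongrightarrow> l1) (at_right x)" ..
    from side[OF this] obtain B1 where B1: "\<forall>\<^sub>F y in at_right x. \<bar>w y\<bar> \<le> B1" ..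
    from left obtain l2 where "(w \<longlongrightarrow> l2) (at_left x)" ..
    from side[OF this] obtain B2 where B2: "\<forall>\<^sub>F y in at_left x. \<bar>w y\<bar> \<le> B2" ..
    define B where "B = max (max B1 B2) \<bar>w x\<bar>"
    have "\<forall>\<^sub>F y in at x. \<bar>w y\<bar> \<le> B"
      unfolding eventually_at_split using B1 B2 by (auto elim!: eventually_mono simp: B_def)
    then have "\<forall>\<^sub>F y in nhds x. \<bar>w y\<bar> \<le> B"
      unfolding eventually_at_filter by eventually_elim (auto simp: B_def)
    then show ?thesis by (auto simp: eventually_nhds)
  qed
  then have "\<forall>x. \<exists>p. open (fst p) \<and> x \<in> fst p \<and> (\<forall>y\<in>fst p. \<bar>w y\<bar> \<le> snd p)" by (metis fst_conv snd_conv)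
  from choice[OF this] obtain p where p: "\<forall>x. open (fst (p x)) \<and> x \<in> fst (p x) \<and> (\<forall>y\<in>fst (p x). \<bar>w y\<bar> \<le> snd (p x))" ..
  define U where "U x = fst (p x)" for x
  define B where "B x = snd (p x)" for x
  have U: "open (U x)" "x \<in> U x" "y \<in> U x \<Longrightarrow> \<bar>w y\<bar> \<le> B x" for x y using p by (auto simp: U_def B_def)
  have "compact {a..b}" by simp
  then obtain D where D: "D \<subseteq> {a..b}" "finite D" "{a..b} \<subseteq> (\<Union>x\<in>D. U x)"
    by (rule compactE_image[of _ "{a..b}" U]) (use U in auto)
  have "\<bar>w y\<bar> \<le> (\<Sum>x\<in>D. \<bar>B x\<bar>)" if y: "y \<in> {a..b}" for y
  proof -
    obtain x where "x \<in> D" "y \<in> U x" using D(3) y by blast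
    then have "\<bar>w y\<bar> \<le> \<bar>B x\<bar>" using U(3)[of y x] by linarith
    also have "\<dots> \<le> (\<Sum>x\<in>D. \<bar>B x\<bar>)" using D(2) \<open>x \<in> D\<close> by (intro member_le_sum) auto
    finally show ?thesis .
  qed
  then show ?thesis by blast
qed



lemma path_loc_bounded_env: "w \<in> path_space \<Longrightarrow> loc_bounded_env w"
  by unfold_locales (auto intro: path_measurable path_locally_bounded)


section \<open>Symmetric Levy environments\<close>

text \<open>
  The two events are disjoint and have equal probability.
\<close>

lemma symmetric_process_half:
  assumes Q: "prob_space Q" and [measurable]: "X t \<in> borel_measurable Q"
    and sym: "symmetric_process Q X" and t: "t \<ge> 0"
  shows "measure Q {\<omega> \<in> space Q. X t \<omega> < 0} \<le> 1 / 2" "measure Q {\<omega> \<in> space Q. - X t \<omega> < 0} \<le> 1 / 2"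
proof -
  interpret prob_space Q by fact
  define p where "p f = f t" for f :: "real \<Rightarrow> real"
  have p [measurable]: "p \<in> borel_measurable (\<Pi>\<^sub>M i\<in>{t}. borel)"
    unfolding p_def by (rule measurable_component_singleton) simp
  have m [measurable]: "(\<lambda>\<omega>. \<lambda>i\<in>{t}. Y i \<omega>) \<in> Q \<rightarrow>\<^sub>M (\<Pi>\<^sub>M i\<in>{t}. borel)"
    if "Y t \<in> borel_measurable Q" for Y :: "real \<Rightarrow> 'a \<Rightarrow> real"
    using that by (intro measurable_restrict) auto
  have "distr Q (\<Pi>\<^sub>M i\<in>{t}. borel) (\<lambda>\<omega>. \<lambda>i\<in>{t}. X i \<omega>) = distr Q (\<Pi>\<^sub>M i\<in>{t}. borel) (\<lambda>\<omega>. \<lambda>i\<in>{t}. - X i \<omega>)"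
    using sym t by (auto simp: symmetric_process_def same_fdd_def)
  then have "distr (distr Q (\<Pi>\<^sub>M i\<in>{t}. borel) (\<lambda>\<omega>. \<lambda>i\<in>{t}. X i \<omega>)) borel p
      = distr (distr Q (\<Pi>\<^sub>M i\<in>{t}. borel) (\<lambda>\<omega>. \<lambda>i\<in>{t}. - X i \<omega>)) borel p" by simp
  then have "distr Q borel (X t) = distr Q borel (\<lambda>\<omega>. - X t \<omega>)"
    by (simp add: distr_distr[OF p m] o_def p_def)
  then have "measure (distr Q borel (X t)) {..<0} = measure (distr Q borel (\<lambda>\<omega>. - X t \<omega>)) {..<0}" by simp
  moreover have "measure (distr Q borel (X t)) {..<0} = prob {\<omega> \<in> space Q. X t \<omega> < 0}"
    by (subst measure_distr) (auto intro!: arg_cong[of _ _ prob])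
  moreover have "measure (distr Q borel (\<lambda>\<omega>. - X t \<omega>)) {..<0} = prob {\<omega> \<in> space Q. - X t \<omega> < 0}"
    by (subst measure_distr) (auto intro!: arg_cong[of _ _ prob])
  ultimately have eq: "prob {\<omega> \<in> space Q. X t \<omega> < 0} = prob {\<omega> \<in> space Q. - X t \<omega> < 0}" by simp
  have "prob {\<omega> \<in> space Q. X t \<omega> < 0} + prob {\<omega> \<in> space Q. - X t \<omega> < 0}
      = prob ({\<omega> \<in> space Q. X t \<omega> < 0} \<union> {\<omega> \<in> space Q. - X t \<omega> < 0})"
    by (rule finite_measure_Union[symmetric]) auto
  also have "\<dots> \<le> 1" by (rule prob_le_1)
  finally show "prob {\<omega> \<in> space Q. X t \<omega> < 0} \<le> 1 / 2" "prob {\<omega> \<in> space Q. - X t \<omega> < 0} \<le> 1 / 2"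
    using eq by auto
qed

lemma symmetric_levy_process_recurrent:
  assumes levy: "levy_process Q X" and sym: "symmetric_process Q X" and s: "s \<ge> 0"
  shows "AE \<omega> in Q. not_drifting_down (\<lambda>n. X (s + real n) \<omega>)"
    and "AE \<omega> in Q. not_drifting_down (\<lambda>n. - X (s + real n) \<omega>)"
proof -
  interpret prob_space Q using levy by (simp add: levy_process_def)
  have m: "X (s + real n) \<in> borel_measurable Q" for n using levy s by (simp add: levy_process_def)
  have "\<forall>(n::nat) t. 0 \<le> t 0 \<and> (\<forall>i<n. t i < t (Suc i)) \<longrightarrow>
      indep_vars (\<lambda>_. borel) (\<lambda>i \<omega>. X (t (Suc i)) \<omega> - X (t i) \<omega>) {..<n}"
    using levy by (simp add: levy_process_def)
  from this[THEN spec, THEN spec, THEN mp, of "\<lambda>i. s + real i"] s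
  have ind: "indep_vars (\<lambda>_. borel) (\<lambda>i \<omega>. X (s + real (Suc i)) \<omega> - X (s + real i) \<omega>) {..<n}" for n
    by simp
  note half = symmetric_process_half[OF prob_space_axioms m sym]
  show "AE \<omega> in Q. not_drifting_down (\<lambda>n. X (s + real n) \<omega>)"
    by (rule not_drifting_down_random_walk[OF m ind half(1)]) (use s in simp)
  show "AE \<omega> in Q. not_drifting_down (\<lambda>n. - X (s + real n) \<omega>)"
  proof (rule not_drifting_down_random_walk)
    show "indep_vars (\<lambda>_. borel) (\<lambda>i \<omega>. - X (s + real (Suc i)) \<omega> - - X (s + real i) \<omega>) {..<n}" for n
      using indep_vars_compose2[OF ind, of n "\<lambda>_ x. - x" "\<lambda>_. borel"] by simp
    show "(\<lambda>\<omega>. - X (s + real n) \<omega>) \<in> borel_measurable Q" for n using m by simp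
    show "prob {\<omega> \<in> space Q. - X (s + real n) \<omega> < 0} \<le> 1 / 2" for n
      by (rule half(2)) (use s in simp)
  qed
qed
text \<open>
  Fubini's theorem exchanges the two almost everywhere quantifiers. The sign \<open>\<sigma>\<close> covers the path
  and its negative.
\<close>

lemma AE_paths_not_drifting_down_AE:
  assumes Q: "prob_space Q" "space Q = path_space" "sets Q = sets path_algebra"
    and rec: "\<And>s. s \<ge> 0 \<Longrightarrow> AE w in Q. not_drifting_down (\<lambda>n. \<sigma> * w (s + real n))"
  shows "AE w in Q. AE s in lborel. not_drifting_down (\<lambda>n. \<sigma> * w (max 0 s + real n))"
proof -
  interpret prob_space Q by fact
  interpret pair_sigma_finite lborel Q ..
  have sets: "sets (lborel \<Otimes>\<^sub>M Q) = sets (borel \<Otimes>\<^sub>M path_algebra)"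
    by (rule sets_pair_measure_cong) (simp_all add: Q)
  have [measurable]: "(\<lambda>p. \<sigma> * snd p (max 0 (fst p) + real n)) \<in> borel_measurable (lborel \<Otimes>\<^sub>M Q)" for n
  proof -
    have "(\<lambda>p. (max 0 (fst p) + real n, snd p)) \<in> (borel \<Otimes>\<^sub>M path_algebra) \<rightarrow>\<^sub>M (borel \<Otimes>\<^sub>M path_algebra)"
      by (rule measurable_Pair) measurable
    from measurable_compose[OF this path_evaluation_jointly_measurable]
    have "(\<lambda>p. snd p (max 0 (fst p) + real n)) \<in> borel_measurable (borel \<Otimes>\<^sub>M path_algebra)"
      by (simp add: max_def cong: if_cong)
    then have "(\<lambda>p. snd p (max 0 (fst p) + real n)) \<in> borel_measurable (lborel \<Otimes>\<^sub>M Q)"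
      by (simp add: measurable_cong_sets[OF sets refl])
    then show ?thesis by measurable
  qed
  have "{p \<in> space (lborel \<Otimes>\<^sub>M Q). not_drifting_down (\<lambda>n. \<sigma> * snd p (max 0 (fst p) + real n))} \<in> sets (lborel \<Otimes>\<^sub>M Q)"
    unfolding not_drifting_down_def by measurable
  from AE_commute[OF this] show ?thesis using rec by simp
qed

theorem proposition4p6:
  fixes Q :: "(real \<Rightarrow> real) measure" and \<alpha> :: real
  assumes "levy_environment Q \<alpha>"
    and "stable_levy_process Q V_plus \<alpha>"
    and "symmetric_process Q V_plus"
  shows "(AE w in Q. lambda_ess (V w) = 0) \<and>
         (AE w in Q. \<forall>P. semigroup_of_env (V w) P \<longrightarrow>
            \<not> compact_semigroup (env_measure (V w)) P)"
proof -
  from assms(1) have Q: "prob_space Q" "space Q = path_space" "sets Q = sets path_algebra"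
    and levy: "levy_process Q V_plus"
    by (simp_all add: levy_environment_def scaling_levy_process_def)
  have V: "V w = w" for w by (simp add: V_def V_plus_def V_minus_def fun_eq_iff)
  note rec = symmetric_levy_process_recurrent[OF levy assms(3), unfolded V_plus_def]
  have up: "AE w in Q. AE s in lborel. not_drifting_down (\<lambda>n. 1 * w (max 0 s + real n))"
    by (rule AE_paths_not_drifting_down_AE[OF Q]) (use rec(1) in simp)
  have down: "AE w in Q. AE s in lborel. not_drifting_down (\<lambda>n. - 1 * w (max 0 s + real n))"
    by (rule AE_paths_not_drifting_down_AE[OF Q]) (use rec(2) in simp)
  have "AE w in Q. infinite_mass_low_energy_env w"
    using up down AE_space
  proof eventually_elim
    case (elim w)
    then have w: "w \<in> path_space" using Q(2) by simp
    interpret loc_bounded_env w by (rule path_loc_bounded_env[OF w])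
    show ?case
    proof (rule infinite_mass_low_energy)
      show "(\<integral>\<^sup>+x. ennreal (exp (w x)) * indicator {0..} x \<partial>lborel) = \<infinity>"
        by (rule divergent_if_not_drifting_down) (use elim(1) in auto)
      show "(\<integral>\<^sup>+x. ennreal (exp (- w x)) * indicator {0..} x \<partial>lborel) = \<infinity>"
        by (rule divergent_if_not_drifting_down) (use elim(2) in auto)
    qed
  qed
  then show ?thesis
    unfolding V using infinite_mass_low_energy_env.lambda_ess_zero infinite_mass_low_energy_env.semigroup_not_compact
    by (auto elim!: eventually_mono)
qed

end
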